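(* Let $\beta_1,\dots,\beta_n$ be distinct positive reals ($n\ge1$), let $C_{j,n}:=\prod_{k=1,\,k\neq j}^n\frac{\beta_k}{\beta_k-\beta_j}$, and let $\nu$ be an infinitely divisible probability measure on $\mathbb{R}^d$. Then $$\mathcal{J}^{\{\beta_1,\dots,\beta_n\}}(\nu)=\big(\mathcal{J}^{\{\beta_1\}}(\nu)\big)^{\ast C_{1,n}}\ast\cdots\ast\big(\mathcal{J}^{\{\beta_n\}}(\nu)\big)^{\ast C_{n,n}},$$ where for $C_{j,n}<0$ the corresponding convolution power is understood through the reciprocal of the corresponding infinitely divisible Fourier transform; that is, the identity means that the characteristic function of the left-hand side equals $\prod_{j=1}^n\exp\big(C_{j,n}\,\Phi_j(y)\big)$ for all $y\in\mathbb{R}^d$, where $\Phi_j$ is the Lévy exponent of $\mathcal{J}^{\{\beta_j\}}(\nu)$.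
   Context: The Lévy exponent of an infinitely divisible probability measure $\mu$ on $\mathbb{R}^d$ is the unique continuous function $\Phi$ with $\Phi(0)=0$ and $\hat\mu(y)=\int e^{i\langle y,x\rangle}\mu(dx)=e^{\Phi(y)}$; for $c>0$, $\mu^{\ast c}$ is the measure with characteristic function $e^{c\Phi}$. $\mathcal{L}(X)$ is the distribution of $X$. $(Y_\nu(t))_{t\ge0}$ denotes an $\mathbb{R}^d$-valued Lévy process (stationary independent increments, starting from $0$, cadlag paths) with $\mathcal{L}(Y_\nu(1))=\nu$. Random integrals are defined pathwise by formal integration by parts: for $h$ continuous of bounded variation and $r\ge 0$ monotone, $\int_{(a,b]}h(t)\,dY_\nu(r(t)):=h(b)Y_\nu(r(b))-h(a)Y_\nu(r(a))-\int_{(a,b]}Y_\nu(r(t))\,dh(t)$. For $\beta>0$ and $\nu$ infinitely divisible, $$\mathcal{J}^{\{\beta\}}(\nu)\equiv\mathcal{J}^{\beta}(\nu):=\mathcal{L}\Big(\int_{(0,1]}t^{1/\beta}\,dY_\nu(t)\Big)=\mathcal{L}\Big(\int_{(0,1]}t\,dY_\nu(t^\beta)\Big),$$ which is again infinitely divisible, and for $m\ge2$, $\mathcal{J}^{\{\beta_1,\dots,\beta_m\}}(\nu):=\mathcal{J}^{\beta_m}(\mathcal{J}^{\{\beta_1,\dots,\beta_{m-1}\}}(\nu))$. Empty products equal $1$. *)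

theory Defs
  imports "HOL-Probability.Probability"
begin

primrec convolution_power :: "(real^'d) measure \<Rightarrow> nat \<Rightarrow> (real^'d) measure" where
  "convolution_power \<mu> 0 = return borel 0"
| "convolution_power \<mu> (Suc n) = (convolution_power \<mu> n \<star> \<mu>)"

definition borel_probability :: "(real^'d) measure \<Rightarrow> bool" where
  "borel_probability \<mu> \<longleftrightarrow> prob_space \<mu> \<and> sets \<mu> = sets borel"

definition infinitely_divisible :: "(real^'d) measure \<Rightarrow> bool" where
  "infinitely_divisible \<mu> \<longleftrightarrow> borel_probability \<mu> \<and>
     (\<forall>n\<ge>1. \<exists>\<rho>. borel_probability \<rho> \<and> convolution_power \<rho> n = \<mu>)"

text \<open>The characteristic function on \<open>\<real>\<^sup>d\<close>; the library's \<open>char\<close> is one-dimensional.\<close>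

definition charf :: "(real^'d) measure \<Rightarrow> real^'d \<Rightarrow> complex" where
  "charf \<mu> y = (CLINT x|\<mu>. iexp (y \<bullet> x))"

definition levy_exponent :: "(real^'d) measure \<Rightarrow> real^'d \<Rightarrow> complex" where
  "levy_exponent \<mu> =
     (THE \<Phi>. continuous_on UNIV \<Phi> \<and> \<Phi> 0 = 0 \<and> (\<forall>y. charf \<mu> y = exp (\<Phi> y)))"

definition cadlag :: "(real \<Rightarrow> real^'d) \<Rightarrow> bool" where
  "cadlag f \<longleftrightarrow> (\<forall>t\<ge>0. (f \<longlongrightarrow> f t) (at_right t)) \<and> (\<forall>t>0. \<exists>l. (f \<longlongrightarrow> l) (at_left t))"

text \<open>Only times \<open>t \<ge> 0\<close> matter; the values of \<open>Y\<close> at negative times are unconstrained.\<close>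

definition levy_process :: "'w measure \<Rightarrow> (real \<Rightarrow> 'w \<Rightarrow> real^'d) \<Rightarrow> bool" where
  "levy_process M Y \<longleftrightarrow>
     prob_space M \<and>
     (\<forall>t\<ge>0. Y t \<in> borel_measurable M) \<and>
     (\<forall>\<omega>\<in>space M. Y 0 \<omega> = 0) \<and>
     (\<forall>\<omega>\<in>space M. cadlag (\<lambda>t. Y t \<omega>)) \<and>
     (\<forall>s\<ge>0. \<forall>h\<ge>0. distr M borel (\<lambda>\<omega>. Y (s + h) \<omega> - Y s \<omega>) = distr M borel (Y h)) \<and>
     (\<forall>n. \<forall>t :: nat \<Rightarrow> real. 0 \<le> t 0 \<and> (\<forall>i<n. t i \<le> t (Suc i)) \<longrightarrow>
        prob_space.indep_vars M (\<lambda>_. borel) (\<lambda>i \<omega>. Y (t (Suc i)) \<omega> - Y (t i) \<omega>) {..<n})"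

text \<open>The pathwise integral of \<open>h\<close> against \<open>dY(r(t))\<close> over \<open>(a,b]\<close>, by formal integration by
  parts, for \<open>h\<close> continuous and nondecreasing on \<open>[a,b]\<close>. The measure \<open>dh\<close> is the
  Lebesgue-Stieltjes measure of \<open>h\<close>; since \<open>interval_measure\<close> needs a function that is nondecreasing
  and right-continuous on the whole line, \<open>h\<close> is extended by constants outside \<open>[a,b]\<close>.\<close>

definition random_integral ::
    "real \<Rightarrow> real \<Rightarrow> (real \<Rightarrow> real) \<Rightarrow> (real \<Rightarrow> 'w \<Rightarrow> real^'d) \<Rightarrow> (real \<Rightarrow> real) \<Rightarrow> 'w \<Rightarrow> real^'d" where
  "random_integral a b h Y r \<omega> =
     h b *\<^sub>R Y (r b) \<omega> - h a *\<^sub>R Y (r a) \<omega>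
       - (LINT t:{a<..b}|interval_measure (\<lambda>s. h (max a (min b s))). Y (r t) \<omega>)"

text \<open>The law of the integral of \<open>t\<^bsup>1/\<beta>\<^esup>\<close> over \<open>(0,1]\<close> against a Levy process \<open>Y\<close> whose law at
  time 1 is \<open>\<nu>\<close>. Taking the space of paths as the type of the sample space is no
  restriction: every Levy process has the same law as its coordinate process on the set of cadlag
  paths. The law does not depend on the chosen process.\<close>

definition Jmap :: "real \<Rightarrow> (real^'d) measure \<Rightarrow> (real^'d) measure" where
  "Jmap \<beta> \<nu> = (THE \<mu>. \<exists>(M :: (real \<Rightarrow> real^'d) measure) Y.
     levy_process M Y \<and> distr M borel (Y 1) = \<nu> \<and>
     \<mu> = distr M borel (random_integral 0 1 (\<lambda>t. t powr (1 / \<beta>)) Y (\<lambda>t. t)))"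

text \<open>\<open>Jmap_iter \<beta> m\<close> is the composition of \<open>Jmap (\<beta> 1)\<close>, ..., \<open>Jmap (\<beta> m)\<close>, with
  \<open>Jmap (\<beta> 1)\<close> applied first.\<close>

primrec Jmap_iter :: "(nat \<Rightarrow> real) \<Rightarrow> nat \<Rightarrow> (real^'d) measure \<Rightarrow> (real^'d) measure" where
  "Jmap_iter \<beta> 0 \<nu> = \<nu>"
| "Jmap_iter \<beta> (Suc m) \<nu> = Jmap (\<beta> (Suc m)) (Jmap_iter \<beta> m \<nu>)"

definition Ccoeff :: "(nat \<Rightarrow> real) \<Rightarrow> nat \<Rightarrow> nat \<Rightarrow> real" where
  "Ccoeff \<beta> j n = (\<Prod>k\<in>{1..n} - {j}. \<beta> k / (\<beta> k - \<beta> j))"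

end

theory Submission
  imports Defs
begin

text \<open>
Write \<open>\<Phi>\<close> for the exponent of \<open>\<nu>\<close>. A Levy process with law \<open>\<nu>\<close> at time 1 has \<open>exp (t \<Phi> y)\<close> as characteristic function at time \<open>t\<close>.
By partial summation the random integral is a limit of sums of independent increments of this process with
coefficients \<open>t\<^sup>1\<^sup>/\<^sup>\<beta>\<close>, so \<open>Jmap \<beta> \<nu>\<close> has the exponent \<open>J\<^sub>\<beta> \<Phi>(y) = \<integral>\<^sub>0\<^sup>1 \<Phi>(t\<^sup>1\<^sup>/\<^sup>\<beta> y) dt\<close> (lemma \<open>Jmap_has_exponent\<close>).
The exponents of the iterated map are therefore obtained by composing the linear operators \<open>J\<^sub>\<beta>\<close>. For two distinct parameters,
\<open>J\<^sub>b J\<^sub>a = (b J\<^sub>a - a J\<^sub>b) / (b - a)\<close> (lemma \<open>J_exponent_comp\<close>): along a ray, \<open>r\<^sup>\<beta> J\<^sub>\<beta> \<Phi>(r y)\<close> has the derivative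
\<open>\<beta> r\<^sup>\<beta>\<^sup>-\<^sup>1 \<Phi>(r y)\<close>, so both sides, multiplied by \<open>r\<^sup>b\<close>, vanish at \<open>r = 0\<close> and have the same derivative. Induction on the number of parameters and the partial fraction
identity \<open>partial_fractions\<close> then give \<open>\<Sum>\<^sub>j C\<^sub>j J\<^bsub>\<beta>\<^sub>j\<^esub> \<Phi>\<close>.

\<open>Jmap\<close> is a definite description, so it has a meaning only if some Levy process with law \<open>\<nu>\<close> at time 1 exists and all such processes give the same
law to the integral. Uniqueness follows from the computed exponent and from the fact that characteristic functions determine measures on \<open>\<real>\<^sup>d\<close>
(\<open>charf_uniqueness\<close>). Existence (\<open>levy_process_exists\<close>) is the main part of the work:

\<^item> The characteristic function of an infinitely divisible measure has no zeros (\<open>infinitely_divisible_charf_nonzero\<close>), hence a continuous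
 logarithm \<open>\<Phi>\<close>, and the convolution roots have the exponents \<open>\<Phi> / n\<close>.
\<^item> The roots of order \<open>2\<^sup>k\<close> are the step laws of random walks with time step \<open>2\<^sup>-\<^sup>k\<close>. These walks are consistent, so
 Kolmogorov's theorem yields a process on the dyadic times (\<open>dyadic_process_exists\<close>).
\<^item> Small increments are uniformly small in probability. A first-exit argument turns this into a geometric bound for the probability
 of \<open>p\<close> oscillations of a given size in a short interval (\<open>oscillates_prob\<close>). So almost surely only finitely many occur, and the path has one-sided limits along the dyadic times.
\<^item> The right limits form a process with cadlag paths. The laws and the independence of its increments pass to the limit (\<open>indep_vars_AE_limit\<close>).
\<close>

section \<open>Characteristic functions on Euclidean space\<close>

lemma charf_distr:
  fixes X :: "'w \<Rightarrow> real^'d"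
  assumes "X \<in> borel_measurable M"
  shows "charf (distr M borel X) y = (CLINT w|M. iexp (y \<bullet> X w))"
  unfolding charf_def using assms by (subst integral_distr) auto

lemma (in prob_space) integrable_iexp_inner:
  fixes X :: "'a \<Rightarrow> real^'d"
  assumes [measurable]: "X \<in> borel_measurable M"
  shows "integrable M (\<lambda>w. iexp (y \<bullet> X w))"
  by (rule integrable_const_bound[of _ 1]) auto

lemma borel_probability_distr:
  assumes "prob_space M" "X \<in> borel_measurable M"
  shows "borel_probability (distr M borel X)"
  using assms by (auto simp: borel_probability_def intro: prob_space.prob_space_distr)

lemma borel_probability_measurable_cong:
  "borel_probability \<mu> \<Longrightarrow> measurable \<mu> N = measurable borel N"
  by (auto simp: borel_probability_def intro: measurable_cong_sets)

lemma charf_0: "borel_probability \<mu> \<Longrightarrow> charf \<mu> 0 = 1"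
  by (auto simp: charf_def borel_probability_def prob_space.prob_space)

lemma continuous_charf:
  fixes \<mu> :: "(real^'d) measure"
  assumes "borel_probability \<mu>"
  shows "continuous_on UNIV (charf \<mu>)"
proof -
  interpret prob_space \<mu> using assms by (simp add: borel_probability_def)
  note m = borel_probability_measurable_cong[OF assms]
  have "continuous (at t) (charf \<mu>)" for t
    unfolding continuous_at_sequentially comp_def charf_def
    by (auto intro!: integral_dominated_convergence[where w="\<lambda>_. 1"] tendsto_intros simp: m)
  then show ?thesis by (simp add: continuous_at_imp_continuous_on)
qed

lemma charf_convolution:
  fixes \<mu> \<nu> :: "(real^'d) measure"
  assumes "borel_probability \<mu>" "borel_probability \<nu>"
  shows "borel_probability (\<mu> \<star> \<nu>)" "charf (\<mu> \<star> \<nu>) y = charf \<mu> y * charf \<nu> y"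
proof -
  interpret M: prob_space \<mu> using assms by (simp add: borel_probability_def)
  interpret N: prob_space \<nu> using assms by (simp add: borel_probability_def)
  interpret P: pair_prob_space \<mu> \<nu> ..
  have s[measurable_cong]: "sets \<mu> = sets borel" "sets \<nu> = sets borel"
    using assms by (auto simp: borel_probability_def)
  show "borel_probability (\<mu> \<star> \<nu>)"
    unfolding convolution_def by (rule borel_probability_distr) (auto intro: P.prob_space_axioms)
  have "charf (\<mu> \<star> \<nu>) y = (CLINT z|\<mu> \<Otimes>\<^sub>M \<nu>. iexp (y \<bullet> (fst z + snd z)))"
    unfolding convolution_def by (subst charf_distr) (auto simp: case_prod_beta)
  also have "\<dots> = (CLINT z|\<mu> \<Otimes>\<^sub>M \<nu>. (case z of (u, v) \<Rightarrow> iexp (y \<bullet> u) * iexp (y \<bullet> v)))"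
    by (simp add: inner_add_right exp_add ring_distribs case_prod_beta)
  also have "\<dots> = (CLINT u|\<mu>. CLINT v|\<nu>. iexp (y \<bullet> u) * iexp (y \<bullet> v))"
    by (subst P.integral_fst'[symmetric])
       (auto intro!: P.integrable_const_bound[of _ 1] simp: norm_mult case_prod_beta)
  also have "\<dots> = charf \<mu> y * charf \<nu> y"
    unfolding charf_def by simp
  finally show "charf (\<mu> \<star> \<nu>) y = charf \<mu> y * charf \<nu> y" .
qed

lemma charf_convolution_power:
  fixes \<mu> :: "(real^'d) measure"
  assumes "borel_probability \<mu>"
  shows "borel_probability (convolution_power \<mu> n) \<and> charf (convolution_power \<mu> n) y = charf \<mu> y ^ n"
proof (induction n)
  case 0
  have "charf (return borel (0::real^'d)) y = 1"
    unfolding charf_def by (subst integral_return) auto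
  then show ?case by (auto simp: borel_probability_def prob_space_return)
next
  case (Suc n)
  then show ?case using charf_convolution[of "convolution_power \<mu> n" \<mu>] assms by simp
qed

text \<open>The weights \<open>y i\<close> may vary with the index because the Riemann sums of a random integral give each increment its own coefficient.\<close>

lemma (in prob_space) charf_sum_indep:
  fixes X :: "'i \<Rightarrow> 'a \<Rightarrow> real^'d"
  assumes I: "finite I" "indep_vars (\<lambda>_. borel) X I"
  shows "(CLINT w|M. iexp (\<Sum>i\<in>I. y i \<bullet> X i w)) = (\<Prod>i\<in>I. CLINT w|M. iexp (y i \<bullet> X i w))"
proof -
  have [measurable]: "\<And>i. i \<in> I \<Longrightarrow> X i \<in> borel_measurable M" using I by (auto simp: indep_vars_def)
  have "indep_vars (\<lambda>_. borel) (\<lambda>i w. iexp (y i \<bullet> X i w)) I"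
    by (rule indep_vars_compose2[OF I(2), where Y="\<lambda>i x. iexp (y i \<bullet> x)"]) auto
  then have "(CLINT w|M. (\<Prod>i\<in>I. iexp (y i \<bullet> X i w))) = (\<Prod>i\<in>I. CLINT w|M. iexp (y i \<bullet> X i w))"
    by (intro indep_vars_lebesgue_integral I) (auto intro!: integrable_iexp_inner)
  then show ?thesis by (simp add: exp_sum[OF I(1)] sum_distrib_left)
qed

section \<open>The uniqueness theorem in several dimensions\<close>

text \<open>Tilting: after normalisation, \<open>w \<mu>\<close> and \<open>w \<nu>\<close> are probability measures, and the hypothesis says that
the image measures under \<open>f\<close> have the same one-dimensional characteristic function. Hence Levy's uniqueness
theorem on the line identifies these images.\<close>

lemma weighted_law_eq:
  fixes w f :: "'a \<Rightarrow> real"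
  assumes "prob_space \<mu>" "prob_space \<nu>" and s: "sets \<nu> = sets \<mu>"
    and w[measurable]: "w \<in> borel_measurable \<mu>" and b: "\<And>x. 1 \<le> w x" "\<And>x. w x \<le> B"
    and f[measurable]: "f \<in> borel_measurable \<mu>"
    and eq: "\<And>t. (CLINT x|\<mu>. w x * iexp (t * f x)) = (CLINT x|\<nu>. w x * iexp (t * f x))"
    and A[measurable]: "A \<in> sets borel"
  shows "(LINT x|\<mu>. w x * indicator A (f x)) = (LINT x|\<nu>. w x * indicator A (f x))"
proof -
  define c where "c = (LINT x|\<mu>. w x)"
  have key: "\<exists>m. m = distr (density \<kappa> (\<lambda>x. ennreal (w x / c))) borel f \<and> real_distribution m
      \<and> (\<forall>t. char m t = (CLINT x|\<kappa>. w x * iexp (t * f x)) / c)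
      \<and> measure m A = (LINT x|\<kappa>. w x * indicator A (f x)) / c \<and> c \<ge> 1"
    if k: "prob_space \<kappa>" and sk[measurable_cong]: "sets \<kappa> = sets \<mu>" and ck: "c = (LINT x|\<kappa>. w x)" for \<kappa>
  proof -
    interpret prob_space \<kappa> by fact
    have wm[measurable]: "w \<in> borel_measurable \<kappa>" "f \<in> borel_measurable \<kappa>" by measurable
    have wb: "\<bar>w x\<bar> \<le> B" for x using b[of x] by linarith
    have "integrable \<kappa> w" by (rule integrable_const_bound[of _ B]) (auto intro!: AE_I2 simp: wb)
    note i = this
    have "(LINT x|\<kappa>. 1) \<le> c" unfolding ck by (rule integral_mono[OF _ i]) (auto simp: b)
    then have c: "c \<ge> 1" by (simp add: prob_space)
    have nn: "w x \<ge> 0" for x using b[of x] by linarith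
    let ?D = "density \<kappa> (\<lambda>x. ennreal (w x / c))"
    have [measurable_cong]: "sets ?D = sets \<mu>" using sk by simp
    have "emeasure ?D (space ?D) = (\<integral>\<^sup>+x. ennreal (w x / c) \<partial>\<kappa>)"
      by (auto simp: emeasure_density intro!: nn_integral_cong)
    also have "\<dots> = ennreal (LINT x|\<kappa>. w x / c)"
      by (rule nn_integral_eq_integral) (use i c nn in auto)
    also have "\<dots> = 1" using c by (simp add: ck[symmetric])
    finally have D: "prob_space ?D" by (intro prob_spaceI) auto
    interpret D: prob_space ?D by fact
    have 1: "real_distribution (distr ?D borel f)"
      by (auto simp: real_distribution_def real_distribution_axioms_def intro!: D.prob_space_distr)
    have 2: "char (distr ?D borel f) t = (CLINT x|\<kappa>. w x * iexp (t * f x)) / c" for t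
    proof -
      have "char (distr ?D borel f) t = (CLINT x|?D. iexp (t * f x))"
        unfolding char_def by (subst integral_distr) auto
      also have "\<dots> = (CLINT x|\<kappa>. (w x / c) *\<^sub>R iexp (t * f x))"
        by (subst integral_density) (use c nn in auto)
      also have "\<dots> = (CLINT x|\<kappa>. w x * iexp (t * f x) / c)"
        by (simp add: scaleR_conv_of_real)
      finally show ?thesis by (simp)
    qed
    have 3: "measure (distr ?D borel f) A = (LINT x|\<kappa>. w x * indicator A (f x)) / c"
    proof -
      have "measure (distr ?D borel f) A = (LINT x|distr ?D borel f. indicator A x)"
        by simp
      also have "\<dots> = (LINT x|?D. indicator A (f x))"
        by (subst integral_distr) auto
      also have "\<dots> = (LINT x|\<kappa>. (w x / c) *\<^sub>R indicator A (f x))"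
        by (subst integral_density) (use c nn in auto)
      finally show ?thesis by simp
    qed
    show ?thesis using 1 2 3 c by auto
  qed
  have "complex_of_real (LINT x|\<mu>. w x) = of_real (LINT x|\<nu>. w x)"
    using eq[of 0] by simp
  then have "c = (LINT x|\<nu>. w x)" by (simp add: c_def)
  with key[OF assms(2) s] key[OF assms(1) refl c_def]
  obtain m1 m2 where m: "real_distribution m1" "real_distribution m2"
    "\<forall>t. char m1 t = (CLINT x|\<mu>. w x * iexp (t * f x)) / c"
    "\<forall>t. char m2 t = (CLINT x|\<nu>. w x * iexp (t * f x)) / c"
    "measure m1 A = (LINT x|\<mu>. w x * indicator A (f x)) / c"
    "measure m2 A = (LINT x|\<nu>. w x * indicator A (f x)) / c" "c \<ge> 1" by blast
  have "m1 = m2" by (rule Levy_uniqueness) (use m eq in auto)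
  with m show ?thesis by auto
qed

text \<open>Exponentials are replaced by indicators one coordinate at a time. When coordinate \<open>k\<close> is treated, the product of
the indicators obtained so far with the remaining exponential is a bounded complex weight; its real and imaginary parts are
handled by tilting, with \<open>f x = x $ k\<close>.\<close>

lemma charf_eq_imp_rectangle_eq:
  fixes \<mu> \<nu> :: "(real^'d) measure" and A :: "'d \<Rightarrow> real set"
  assumes \<mu>: "borel_probability \<mu>" and \<nu>: "borel_probability \<nu>"
    and eq: "\<And>y. charf \<mu> y = charf \<nu> y"
    and A[measurable]: "\<And>k. A k \<in> sets borel"
  shows "(CLINT x|\<mu>. (\<Prod>k\<in>S. indicator (A k) (x $ k)) * iexp (y \<bullet> x)) =
         (CLINT x|\<nu>. (\<Prod>k\<in>S. indicator (A k) (x $ k)) * iexp (y \<bullet> x))"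
  using finite[of S]
proof (induction S arbitrary: y rule: finite_induct)
  case empty
  then show ?case using eq[of y] by (simp add: charf_def)
next
  case (insert k S)
  interpret M: prob_space \<mu> using \<mu> by (simp add: borel_probability_def)
  interpret N: prob_space \<nu> using \<nu> by (simp add: borel_probability_def)
  have s[measurable_cong]: "sets \<mu> = sets borel" "sets \<nu> = sets borel"
    using \<mu> \<nu> by (auto simp: borel_probability_def)
  define p :: "real^'d \<Rightarrow> complex" where "p x = (\<Prod>k\<in>S. indicator (A k) (x $ k))" for x
  have p_real: "cnj (p x) = p x" for x by (auto simp: p_def indicator_def cnj_prod intro!: prod.cong)
  have p_bd: "cmod (p x) \<le> 1" for x unfolding p_def prod_norm[symmetric] by (rule prod_le_1) (auto simp: indicator_def)
  have [measurable]: "p \<in> borel_measurable borel" unfolding p_def by measurable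
  define g where "g x = p x * iexp (y \<bullet> x)" for x
  have g_bd: "cmod (g x) \<le> 1" for x using p_bd by (simp add: g_def norm_mult)
  have [measurable]: "g \<in> borel_measurable borel" unfolding g_def by measurable
  have [measurable]: "(\<lambda>x. cnj (g x)) \<in> borel_measurable borel"
    by (rule measurable_compose[OF _ borel_measurable_continuous_onI[of cnj]]) (auto intro: continuous_intros)
  have int: "integrable \<mu> h" "integrable \<nu> h"
    if "h \<in> borel_measurable borel" "\<And>x. cmod (h x) \<le> 1" for h :: "real^'d \<Rightarrow> complex"
    using that by (auto intro!: M.integrable_const_bound[of _ 1] N.integrable_const_bound[of _ 1])
  have IH: "(CLINT x|\<mu>. p x * iexp (z \<bullet> x)) = (CLINT x|\<nu>. p x * iexp (z \<bullet> x))" for z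
    using insert.IH[of z] by (simp add: p_def)
  have shift: "iexp (y \<bullet> x) * iexp (t * x $ k) = iexp ((y + axis k t) \<bullet> x)" for x :: "real^'d" and t
    by (simp add: inner_add_left inner_axis' exp_add[symmetric] ring_distribs)
  have cn: "cnj (iexp r) = iexp (- r)" for r
    by (simp only: exp_cnj complex_cnj_mult complex_cnj_i complex_cnj_complex_of_real of_real_minus mult_minus_left mult_minus_right)
  have 1: "(CLINT x|\<mu>. g x * iexp (t * x $ k)) = (CLINT x|\<nu>. g x * iexp (t * x $ k))" for t
  proof -
    have *: "g x * iexp (t * x $ k) = p x * iexp ((y + axis k t) \<bullet> x)" for x
      using shift[of x t] by (simp add: g_def mult.assoc)
    show ?thesis unfolding * by (rule IH)
  qed
  have 2: "(CLINT x|\<mu>. cnj (g x) * iexp (t * x $ k)) = (CLINT x|\<nu>. cnj (g x) * iexp (t * x $ k))" for t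
  proof -
    have *: "cnj (g x) * iexp (t * x $ k) = cnj (g x * iexp ((-t) * x $ k))" for x
      by (simp only: complex_cnj_mult cn mult_minus_left minus_minus)
    show ?thesis unfolding * Bochner_Integration.integral_cnj 1[of "-t"] ..
  qed
  have 3: "(CLINT x|\<mu>. iexp (t * x $ k)) = (CLINT x|\<nu>. iexp (t * x $ k))" for t
    using eq[of "axis k t"] by (simp add: charf_def inner_axis')
  \<comment> \<open>A real part \<open>r\<close> of the complex weight \<open>g\<close> lies in \<open>[-1,1]\<close>; adding 2 makes it a positive density. The choices \<open>a = 1/2\<close> and \<open>a = -\<i>/2\<close> give \<open>Re\<close> and \<open>Im\<close>, and \<open>a = 0\<close> the constant weight to be subtracted.\<close>
  have part: "(LINT x|\<mu>. (2 + r (g x)) * indicator (A k) (x $ k)) = (LINT x|\<nu>. (2 + r (g x)) * indicator (A k) (x $ k))"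
    if r: "\<And>z. of_real (r z) = a * z + cnj a * cnj z" "cmod a \<le> 1/2" and [measurable]: "r \<in> borel_measurable borel"
    for r :: "complex \<Rightarrow> real" and a
  proof (rule weighted_law_eq[where B=3])
    have "\<bar>r (g x)\<bar> \<le> 1" for x
    proof -
      have "cmod a * cmod (g x) \<le> 1/2 * 1" by (rule mult_mono) (use r g_bd in auto)
      moreover have "\<bar>r (g x)\<bar> = cmod (a * g x + cnj a * cnj (g x))"
        unfolding r(1)[symmetric] norm_of_real by simp
      moreover have "\<dots> \<le> cmod (a * g x) + cmod (cnj a * cnj (g x))" by (rule norm_triangle_ineq)
      ultimately show ?thesis unfolding norm_mult complex_mod_cnj by linarith
    qed
    then have "- 1 \<le> r (g x) \<and> r (g x) \<le> 1" for x by (metis abs_le_D1 abs_le_D2 minus_le_iff)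
    then show "1 \<le> 2 + r (g x)" "2 + r (g x) \<le> 3" for x by (smt (verit))+
    fix t
    have *: "complex_of_real (2 + r (g x)) * iexp (t * x $ k) =
      2 * iexp (t * x $ k) + (a * (g x * iexp (t * x $ k)) + cnj a * (cnj (g x) * iexp (t * x $ k)))" for x
      by (simp only: of_real_add of_real_numeral r ring_distribs mult.assoc)
    have i: "integrable \<kappa> (\<lambda>x. iexp (t * x $ k))" "integrable \<kappa> (\<lambda>x. g x * iexp (t * x $ k))"
       "integrable \<kappa> (\<lambda>x. cnj (g x) * iexp (t * x $ k))" if "\<kappa> \<in> {\<mu>, \<nu>}" for \<kappa>
      using that by (auto intro!: int simp: norm_mult g_bd)
    have "(CLINT x|\<kappa>. complex_of_real (2 + r (g x)) * iexp (t * x $ k)) =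
      2 * (CLINT x|\<kappa>. iexp (t * x $ k)) + (a * (CLINT x|\<kappa>. g x * iexp (t * x $ k))
        + cnj a * (CLINT x|\<kappa>. cnj (g x) * iexp (t * x $ k)))" if "\<kappa> \<in> {\<mu>, \<nu>}" for \<kappa>
      unfolding * using i[OF that]
      by (simp only: Bochner_Integration.integral_add integrable_mult_right
          Bochner_Integration.integrable_add integral_mult_right_zero)
    from this[of \<mu>] this[of \<nu>]
    show "(CLINT x|\<mu>. complex_of_real (2 + r (g x)) * iexp (t * x $ k)) = (CLINT x|\<nu>. complex_of_real (2 + r (g x)) * iexp (t * x $ k))"
      unfolding 1 2 3 by simp
  qed (auto simp: s M.prob_space_axioms N.prob_space_axioms)
  have c: "(LINT x|\<mu>. indicator (A k) (x $ k)) = (LINT x|\<nu>. indicator (A k) (x $ k) :: real)"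
    using part[of "\<lambda>_. 0" 0] by simp
  have ir: "integrable \<mu> h" "integrable \<nu> h"
    if "h \<in> borel_measurable borel" "\<And>x. \<bar>h x\<bar> \<le> 1" for h :: "real^'d \<Rightarrow> real"
    using that by (auto intro!: M.integrable_const_bound[of _ 1] N.integrable_const_bound[of _ 1])
  have bR: "\<bar>Re (g x)\<bar> \<le> 1" "\<bar>Im (g x)\<bar> \<le> 1" for x
    using g_bd[of x] abs_Re_le_cmod[of "g x"] abs_Im_le_cmod[of "g x"] by linarith+
  have R: "(LINT x|\<mu>. Re (g x) * indicator (A k) (x $ k)) = (LINT x|\<nu>. Re (g x) * indicator (A k) (x $ k))"
  proof -
    have "(LINT x|\<mu>. (2 + Re (g x)) * indicator (A k) (x $ k)) = (LINT x|\<nu>. (2 + Re (g x)) * indicator (A k) (x $ k))"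
      by (rule part[of Re "1/2"]) (auto simp: complex_eq_iff)
    then show ?thesis using c
      by (simp add: ring_distribs Bochner_Integration.integral_add ir integrable_mult_right bR abs_mult indicator_def)
  qed
  have I: "(LINT x|\<mu>. Im (g x) * indicator (A k) (x $ k)) = (LINT x|\<nu>. Im (g x) * indicator (A k) (x $ k))"
  proof -
    have "(LINT x|\<mu>. (2 + Im (g x)) * indicator (A k) (x $ k)) = (LINT x|\<nu>. (2 + Im (g x)) * indicator (A k) (x $ k))"
      by (rule part[of Im "-\<i>/2"]) (auto simp: complex_eq_iff)
    then show ?thesis using c
      by (simp add: ring_distribs Bochner_Integration.integral_add ir integrable_mult_right bR abs_mult indicator_def)
  qed
  have split: "(CLINT x|\<kappa>. (\<Prod>k\<in>insert k S. indicator (A k) (x $ k)) * iexp (y \<bullet> x)) =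
     Complex (LINT x|\<kappa>. Re (g x) * indicator (A k) (x $ k)) (LINT x|\<kappa>. Im (g x) * indicator (A k) (x $ k))"
    if "\<kappa> \<in> {\<mu>, \<nu>}" for \<kappa>
  proof -
    have i: "integrable \<kappa> (\<lambda>x. g x * indicator (A k) (x $ k))"
      using that by (auto intro!: int simp: norm_mult g_bd indicator_def)
    have "(CLINT x|\<kappa>. (\<Prod>k\<in>insert k S. indicator (A k) (x $ k)) * iexp (y \<bullet> x)) = (CLINT x|\<kappa>. g x * indicator (A k) (x $ k))"
      using insert.hyps by (intro Bochner_Integration.integral_cong) (auto simp: g_def p_def)
    moreover have "Re (g x * indicator (A k) (x $ k)) = Re (g x) * indicator (A k) (x $ k)"
      "Im (g x * indicator (A k) (x $ k)) = Im (g x) * indicator (A k) (x $ k)" for x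
      by (auto simp: indicator_def)
    ultimately show ?thesis using integral_Re[OF i] integral_Im[OF i]
      by (simp add: complex_eq_iff)
  qed
  show ?case using R I by (simp add: split)
qed

text \<open>All coordinates have been replaced: at \<open>y = 0\<close> the preceding lemma compares the multivariate distribution functions.\<close>

theorem charf_uniqueness:
  fixes \<mu> \<nu> :: "(real^'d) measure"
  assumes \<mu>: "borel_probability \<mu>" and \<nu>: "borel_probability \<nu>"
    and eq: "\<And>y. charf \<mu> y = charf \<nu> y"
  shows "\<mu> = \<nu>"
proof -
  interpret M: prob_space \<mu> using \<mu> by (simp add: borel_probability_def)
  interpret N: prob_space \<nu> using \<nu> by (simp add: borel_probability_def)
  have s[measurable_cong]: "sets \<mu> = sets borel" "sets \<nu> = sets borel"
    using \<mu> \<nu> by (auto simp: borel_probability_def)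
  have sp: "space \<mu> = UNIV" "space \<nu> = UNIV" using s[THEN sets_eq_imp_space_eq] by auto
  have *: "(CLINT x|\<kappa>. (\<Prod>k\<in>UNIV. indicator {..a $ k} (x $ k)) * iexp (0 \<bullet> x)) = of_real (measure \<kappa> {..a})"
    if "\<kappa> \<in> {\<mu>, \<nu>}" for a :: "real^'d" and \<kappa>
  proof -
    have "(\<Prod>k\<in>UNIV. indicator {..a $ k} (x $ k)) = complex_of_real (indicator {..a} x)" for x
    proof (cases "x \<le> a")
      case True then show ?thesis by (auto simp: less_eq_vec_def)
    next
      case False then obtain k where "\<not> x $ k \<le> a $ k" by (auto simp: less_eq_vec_def)
      then have "(\<Prod>k\<in>UNIV. indicator {..a $ k} (x $ k)) = (0::complex)" by (intro prod_zero) (auto intro!: exI[of _ k])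
      then show ?thesis using False by simp
    qed
    then show ?thesis using that s sp by auto
  qed
  have m: "measure \<mu> {..a} = measure \<nu> {..a}" for a :: "real^'d"
    using charf_eq_imp_rectangle_eq[OF \<mu> \<nu> eq, of "\<lambda>k. {..a $ k}" UNIV 0] *[of \<mu> a] *[of \<nu> a]
    by simp
  show ?thesis
  proof (rule measure_eqI_generator_eq[where E="range atMost" and \<Omega>=UNIV and A="\<lambda>i::nat. {..(\<chi> k. real i)}"])
    show "Int_stable (range (atMost :: real^'d \<Rightarrow> _))"
    proof (rule Int_stableI_image)
      fix a b :: "real^'d" show "\<exists>c\<in>UNIV. {..a} \<inter> {..b} = {..c}"
        by (rule bexI[of _ "inf a b"]) auto
    qed
    show "emeasure \<mu> X = emeasure \<nu> X" if "X \<in> range (atMost :: real^'d \<Rightarrow> _)" for X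
      using that m by (auto simp: M.emeasure_eq_measure N.emeasure_eq_measure)
    show "(\<Union>i. {..(\<chi> k. real i) :: real^'d}) = UNIV"
    proof safe
      fix x :: "real^'d"
      obtain n :: nat where n: "norm x \<le> n" using real_arch_simple by blast
      have "x $ k \<le> n" for k using component_le_norm_cart[of x k] n by linarith
      then show "x \<in> (\<Union>i. {..(\<chi> k. real i)})" by (auto simp: less_eq_vec_def)
    qed auto
  qed (auto simp: s borel_eq_atMost)
qed

section \<open>Exponents of infinitely divisible measures\<close>

lemma continuous_log_unique:
  fixes \<Phi> \<Psi> :: "real^'d \<Rightarrow> complex"
  assumes c: "continuous_on UNIV \<Phi>" "continuous_on UNIV \<Psi>" and 0: "\<Phi> 0 = \<Psi> 0"
    and e: "\<And>y. exp (\<Phi> y) = exp (\<Psi> y)"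
  shows "\<Phi> = \<Psi>"
proof -
  \<comment> \<open>The difference takes values in \<open>2 \<pi> \<i> \<int>\<close>, a set with gaps of size \<open>2 \<pi>\<close>, and the domain is connected.\<close>
  have "(\<lambda>y. \<Phi> y - \<Psi> y) constant_on UNIV"
  proof (rule continuous_discrete_range_constant)
    show "continuous_on UNIV (\<lambda>y. \<Phi> y - \<Psi> y)" using c by (intro continuous_intros)
    fix x :: "real^'d"
    show "\<exists>e>0. \<forall>y. y \<in> UNIV \<and> \<Phi> y - \<Psi> y \<noteq> \<Phi> x - \<Psi> x \<longrightarrow> e \<le> norm (\<Phi> y - \<Psi> y - (\<Phi> x - \<Psi> x))"
    proof (intro exI[of _ "2 * pi"] conjI allI impI)
      fix y assume y: "y \<in> UNIV \<and> \<Phi> y - \<Psi> y \<noteq> \<Phi> x - \<Psi> x"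
      define d where "d = \<Phi> y - \<Psi> y - (\<Phi> x - \<Psi> x)"
      have "exp d = 1" using e by (simp add: d_def exp_diff)
      then obtain n :: int where n: "Re d = 0" "Im d = of_int (2 * n) * pi" by (auto simp: exp_eq_1)
      have "d \<noteq> 0" using y by (auto simp: d_def)
      then have "n \<noteq> 0" using n by (auto simp: complex_eq_iff)
      then have "1 \<le> \<bar>real_of_int n\<bar>" by linarith
      then have "2 * pi \<le> \<bar>Im d\<bar>" by (auto simp: n abs_mult)
      then show "2 * pi \<le> norm (\<Phi> y - \<Psi> y - (\<Phi> x - \<Psi> x))"
        using abs_Im_le_cmod[of d] by (simp add: d_def)
    qed simp
  qed auto
  then obtain k where k: "\<And>y. \<Phi> y - \<Psi> y = k" by (auto simp: constant_on_def)
  then show ?thesis using k[of 0] 0 by (auto simp: fun_eq_iff)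
qed

text \<open>\<open>|charf \<rho>|\<^sup>2\<close> is the expectation of \<open>cos (y \<bullet> (U - V))\<close> for independent \<open>U\<close>, \<open>V\<close> with law \<open>\<rho>\<close>, so an inequality for the cosine suffices.\<close>

lemma charf_doubling:
  fixes \<rho> :: "(real^'d) measure"
  assumes "borel_probability \<rho>"
  shows "1 - (cmod (charf \<rho> (2 *\<^sub>R y)))\<^sup>2 \<le> 4 * (1 - (cmod (charf \<rho> y))\<^sup>2)"
proof -
  interpret M: prob_space \<rho> using assms by (simp add: borel_probability_def)
  interpret P: pair_prob_space \<rho> \<rho> ..
  have s[measurable_cong]: "sets \<rho> = sets borel" using assms by (auto simp: borel_probability_def)
  have cnj_iexp: "cnj (iexp r) = iexp (- r)" for r
    by (simp only: exp_cnj complex_cnj_mult complex_cnj_i complex_cnj_complex_of_real of_real_minus mult_minus_left mult_minus_right)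
  have *: "(cmod (charf \<rho> y))\<^sup>2 = (LINT z|(\<rho> \<Otimes>\<^sub>M \<rho>). cos (y \<bullet> (fst z - snd z)))" for y
  proof -
    have i: "integrable (\<rho> \<Otimes>\<^sub>M \<rho>) (\<lambda>z. iexp (y \<bullet> (fst z - snd z)))"
      by (intro P.integrable_const_bound[of _ 1]) auto
    have "of_real ((cmod (charf \<rho> y))\<^sup>2) = charf \<rho> y * cnj (charf \<rho> y)" by (rule complex_norm_square)
    also have "\<dots> = (CLINT u|\<rho>. CLINT v|\<rho>. iexp (y \<bullet> u) * iexp (- (y \<bullet> v)))"
      unfolding charf_def Bochner_Integration.integral_cnj[symmetric] cnj_iexp by simp
    also have "\<dots> = (CLINT z|(\<rho> \<Otimes>\<^sub>M \<rho>). (case z of (u, v) \<Rightarrow> iexp (y \<bullet> u) * iexp (- (y \<bullet> v))))"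
      by (subst P.integral_fst'[symmetric])
       (auto intro!: P.integrable_const_bound[of _ 1] simp: norm_mult case_prod_beta)
    also have "\<dots> = (CLINT z|(\<rho> \<Otimes>\<^sub>M \<rho>). iexp (y \<bullet> (fst z - snd z)))"
      by (intro Bochner_Integration.integral_cong) (auto simp: exp_add[symmetric] inner_diff_right ring_distribs)
    finally have "(cmod (charf \<rho> y))\<^sup>2 = Re (CLINT z|(\<rho> \<Otimes>\<^sub>M \<rho>). iexp (y \<bullet> (fst z - snd z)))"
      by (metis Re_complex_of_real)
    then show ?thesis unfolding integral_Re[OF i, symmetric] by (simp add: Re_exp)
  qed
  have ic: "integrable (\<rho> \<Otimes>\<^sub>M \<rho>) (\<lambda>z. cos (y \<bullet> (fst z - snd z)))" for y
    by (intro P.integrable_const_bound[of _ 1]) auto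
  have one: "(LINT z|(\<rho> \<Otimes>\<^sub>M \<rho>). (1::real)) = 1" by (simp add: P.prob_space)
  have "1 - (cmod (charf \<rho> (2 *\<^sub>R y)))\<^sup>2 = (LINT z|(\<rho> \<Otimes>\<^sub>M \<rho>). 1 - cos ((2 *\<^sub>R y) \<bullet> (fst z - snd z)))"
    unfolding * using ic[of "2 *\<^sub>R y"] one by (subst Bochner_Integration.integral_diff) auto
  also have "\<dots> \<le> (LINT z|(\<rho> \<Otimes>\<^sub>M \<rho>). 4 * (1 - cos (y \<bullet> (fst z - snd z))))"
  proof (rule integral_mono)
    fix z :: "(real^'d) \<times> (real^'d)"
    define t where "t = y \<bullet> (fst z - snd z)"
    \<comment> \<open>\<open>1 - cos 2t = 2 (1 - cos\<^sup>2 t)\<close> falls short of \<open>4 (1 - cos t)\<close> by exactly \<open>2 (1 - cos t)\<^sup>2\<close>.\<close>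
    have "cos (2 * t) = 2 * cos t ^ 2 - 1" by (rule cos_double_cos)
    moreover have "0 \<le> 2 * (1 - cos t)^2" by simp
    ultimately have "1 - cos (2 * t) \<le> 4 * (1 - cos t)"
      by (simp add: power2_eq_square algebra_simps)
    then show "1 - cos ((2 *\<^sub>R y) \<bullet> (fst z - snd z)) \<le> 4 * (1 - cos (y \<bullet> (fst z - snd z)))"
      by (simp add: t_def)
  qed (use ic[of "2 *\<^sub>R y"] ic[of y] in auto)
  also have "\<dots> = 4 * (1 - (cmod (charf \<rho> y))\<^sup>2)"
    unfolding * using ic one by (simp add: Bochner_Integration.integral_diff)
  finally show ?thesis .
qed

text \<open>The doubling inequality for the \<open>n\<close>-th convolution roots, with \<open>n\<close> large, shows that a zero at \<open>2 y\<close> forces a zero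
at \<open>y\<close>. Repeated halving would then contradict continuity at the origin.\<close>

lemma infinitely_divisible_charf_nonzero:
  fixes \<nu> :: "(real^'d) measure"
  assumes "infinitely_divisible \<nu>"
  shows "charf \<nu> y \<noteq> 0"
proof -
  have b: "borel_probability \<nu>" using assms by (simp add: infinitely_divisible_def)
  have root: "\<exists>\<rho>. borel_probability \<rho> \<and> (\<forall>y. charf \<rho> y ^ n = charf \<nu> y)" if "n \<ge> 1" for n
    using assms that charf_convolution_power unfolding infinitely_divisible_def by metis
  have dbl: "charf \<nu> (2 *\<^sub>R y) \<noteq> 0" if y: "charf \<nu> y \<noteq> 0" for y
  proof -
    define a where "a = (cmod (charf \<nu> y))\<^sup>2"
    have a: "0 < a" using y by (simp add: a_def)
    \<comment> \<open>The squared modulus for an \<open>n\<close>-th root is \<open>a\<^sup>1\<^sup>/\<^sup>n\<close>, which exceeds \<open>3/4\<close> for large \<open>n\<close>; doubling the argument leaves it above \<open>1 - 4 (1 - 3/4) = 0\<close>.\<close>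
    have "(\<lambda>n. root n a) \<longlonglongrightarrow> 1" using a by (rule LIMSEQ_root_const)
    then have "eventually (\<lambda>n. root n a > 3/4) sequentially" by (rule order_tendstoD) simp
    then have "eventually (\<lambda>n. n \<ge> 1 \<and> root n a > 3/4) sequentially"
      using eventually_ge_at_top[of 1] by eventually_elim auto
    then obtain n where n: "n \<ge> 1" "root n a > 3/4" by (auto simp: eventually_sequentially)
    obtain \<rho> where \<rho>: "borel_probability \<rho>" "\<And>y. charf \<rho> y ^ n = charf \<nu> y" using root[OF n(1)] by auto
    have "((cmod (charf \<rho> y))\<^sup>2) ^ n = a"
      by (simp add: a_def \<rho>(2)[symmetric] norm_power power_mult[symmetric] mult.commute)
    then have "root n a = (cmod (charf \<rho> y))\<^sup>2" using n by (intro real_root_pos_unique) auto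
    then have "4 * (1 - (cmod (charf \<rho> y))\<^sup>2) < 1" using n(2) by (simp add: field_simps)
    then have "1 - (cmod (charf \<rho> (2 *\<^sub>R y)))\<^sup>2 < 1"
      by (rule le_less_trans[OF charf_doubling[OF \<rho>(1)]])
    then show ?thesis using \<rho>(2)[of "2 *\<^sub>R y"] n by auto
  qed
  have "isCont (charf \<nu>) 0" using continuous_charf[OF b] by (simp add: continuous_on_eq_continuous_at)
  moreover have "(\<lambda>m. (1 / 2 ^ m) *\<^sub>R y) \<longlonglongrightarrow> 0"
  proof -
    have "(\<lambda>m. (1/2) ^ m *\<^sub>R y) \<longlonglongrightarrow> 0 *\<^sub>R y" by (intro tendsto_intros LIMSEQ_realpow_zero) auto
    then show ?thesis by (simp add: power_one_over)
  qed
  ultimately have "(\<lambda>m. charf \<nu> ((1 / 2 ^ m) *\<^sub>R y)) \<longlonglongrightarrow> charf \<nu> 0"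
    by (rule isCont_tendsto_compose)
  then have "eventually (\<lambda>m. charf \<nu> ((1 / 2 ^ m) *\<^sub>R y) \<noteq> 0) sequentially"
    by (rule tendsto_imp_eventually_ne) (simp add: charf_0 b)
  then obtain m where m: "charf \<nu> ((1 / 2 ^ m) *\<^sub>R y) \<noteq> 0" by (auto simp: eventually_sequentially)
  \<comment> \<open>Near the origin the function does not vanish; double the argument \<open>m\<close> times to reach \<open>y\<close>.\<close>
  have "charf \<nu> ((2 ^ k / 2 ^ m) *\<^sub>R y) \<noteq> 0" for k
  proof (induction k)
    case (Suc k) then show ?case using dbl[OF Suc] by (simp add: mult.assoc)
  qed (use m in simp)
  from this[of m] show ?thesis by simp
qed

text \<open>The relational form of \<open>levy_exponent\<close>: it asserts existence as well, and by the uniqueness of characteristic functions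
it determines the measure.\<close>

definition has_exponent :: "(real^'d) measure \<Rightarrow> (real^'d \<Rightarrow> complex) \<Rightarrow> bool" where
  "has_exponent \<mu> \<Phi> \<longleftrightarrow> borel_probability \<mu> \<and> continuous_on UNIV \<Phi> \<and> \<Phi> 0 = 0 \<and>
     (\<forall>y. charf \<mu> y = exp (\<Phi> y))"

lemma has_exponent_levy_exponent:
  assumes "has_exponent \<mu> \<Phi>"
  shows "levy_exponent \<mu> = \<Phi>"
  unfolding levy_exponent_def
proof (rule the_equality)
  show "continuous_on UNIV \<Phi> \<and> \<Phi> 0 = 0 \<and> (\<forall>y. charf \<mu> y = exp (\<Phi> y))"
    using assms by (simp add: has_exponent_def)
  fix \<Psi> assume "continuous_on UNIV \<Psi> \<and> \<Psi> 0 = 0 \<and> (\<forall>y. charf \<mu> y = exp (\<Psi> y))"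
  then show "\<Psi> = \<Phi>" using assms by (intro continuous_log_unique) (auto simp: has_exponent_def)
qed

lemma has_exponent_measure_eq:
  assumes "has_exponent \<mu> \<Phi>" "has_exponent \<nu> \<Phi>"
  shows "\<mu> = \<nu>"
  using assms by (intro charf_uniqueness) (auto simp: has_exponent_def)

lemma has_exponent_exists:
  fixes \<mu> :: "(real^'d) measure"
  assumes b: "borel_probability \<mu>" and nz: "\<And>y. charf \<mu> y \<noteq> 0"
  shows "\<exists>\<Phi>. has_exponent \<mu> \<Phi>"
proof -
  obtain g where g: "continuous_on UNIV g" "\<And>y. y \<in> UNIV \<Longrightarrow> charf \<mu> y = exp (g y)"
    using continuous_logarithm_on_contractible[OF continuous_charf[OF b]] nz
    by (metis contractible_UNIV)
  have "exp (g 0) = 1" using g(2)[of 0] by (simp add: charf_0 b)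
  then have "has_exponent \<mu> (\<lambda>y. g y - g 0)"
    unfolding has_exponent_def using b g by (auto intro!: continuous_intros simp: exp_diff)
  then show ?thesis by blast
qed

text \<open>The logarithm of \<open>charf \<rho>\<close>, multiplied by \<open>n\<close>, and \<open>\<Phi>\<close> are continuous logarithms of the same function; so no multiple of \<open>2 \<pi> \<i> / n\<close> can intervene.\<close>

lemma has_exponent_root:
  fixes \<rho> :: "(real^'d) measure"
  assumes \<Phi>: "continuous_on UNIV \<Phi>" "\<Phi> 0 = 0" and \<rho>: "borel_probability \<rho>" and n: "n \<ge> 1"
    and eq: "\<And>y. charf \<rho> y ^ n = exp (\<Phi> y)"
  shows "has_exponent \<rho> (\<lambda>y. \<Phi> y / of_nat n)"
proof -
  have "charf \<rho> y \<noteq> 0" for y using eq[of y] n by (metis exp_not_eq_zero power_0_left not_one_le_zero)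
  then obtain \<Psi> where \<Psi>: "has_exponent \<rho> \<Psi>" using has_exponent_exists[OF \<rho>] by blast
  have "(\<lambda>y. of_nat n * \<Psi> y) = \<Phi>"
  proof (rule continuous_log_unique)
    show "exp (of_nat n * \<Psi> y) = exp (\<Phi> y)" for y
      using \<Psi> eq[of y] by (simp add: has_exponent_def exp_of_nat_mult)
  qed (use \<Phi> \<Psi> in \<open>auto simp: has_exponent_def intro!: continuous_intros\<close>)
  then have "\<Phi> y / of_nat n = \<Psi> y" for y using n by (auto simp: fun_eq_iff field_simps)
  then show ?thesis using \<Psi> by simp
qed

text \<open>Infinite divisibility in terms of exponents: a convolution root is described by its exponent alone.\<close>

definition has_id_exponent :: "(real^'d) measure \<Rightarrow> (real^'d \<Rightarrow> complex) \<Rightarrow> bool" where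
  "has_id_exponent \<mu> \<Phi> \<longleftrightarrow> has_exponent \<mu> \<Phi> \<and> 
     (\<forall>n\<ge>1. \<exists>\<rho>. has_exponent \<rho> (\<lambda>y. \<Phi> y / of_nat n))"

lemma infinitely_divisible_has_id_exponent:
  fixes \<mu> :: "(real^'d) measure"
  assumes "infinitely_divisible \<mu>"
  shows "\<exists>\<Phi>. has_id_exponent \<mu> \<Phi>"
proof -
  have b: "borel_probability \<mu>" using assms by (simp add: infinitely_divisible_def)
  obtain \<Phi> where \<Phi>: "has_exponent \<mu> \<Phi>"
    using has_exponent_exists[OF b] infinitely_divisible_charf_nonzero[OF assms] by blast
  have "\<exists>\<rho>. has_exponent \<rho> (\<lambda>y. \<Phi> y / of_nat n)" if n: "n \<ge> 1" for n
  proof -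
    obtain \<rho> where \<rho>: "borel_probability \<rho>" "convolution_power \<rho> n = \<mu>"
      using assms n by (auto simp: infinitely_divisible_def)
    then have "charf \<rho> y ^ n = exp (\<Phi> y)" for y
      using charf_convolution_power[of \<rho> n y] \<Phi> by (simp add: has_exponent_def)
    then show ?thesis using has_exponent_root[of \<Phi> \<rho> n] \<Phi> \<rho> n by (auto simp: has_exponent_def)
  qed
  then show ?thesis using \<Phi> by (auto simp: has_id_exponent_def)
qed

lemma has_id_exponent_root:
  fixes \<mu> \<rho> :: "(real^'d) measure"
  assumes "has_id_exponent \<mu> \<Phi>" "has_exponent \<rho> (\<lambda>y. \<Phi> y / of_nat m)" "m \<ge> 1"
  shows "has_id_exponent \<rho> (\<lambda>y. \<Phi> y / of_nat m)"
proof -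
  have "\<exists>\<sigma>. has_exponent \<sigma> (\<lambda>y. \<Phi> y / of_nat m / of_nat n)" if "n \<ge> 1" for n
  proof -
    have "m * n \<ge> 1" using that assms(3) by simp
    then have "\<exists>\<sigma>. has_exponent \<sigma> (\<lambda>y. \<Phi> y / of_nat (m * n))"
      using assms(1) unfolding has_id_exponent_def by blast
    then show ?thesis by (simp add: field_simps)
  qed
  then show ?thesis using assms(2) by (auto simp: has_id_exponent_def)
qed

section \<open>Kolmogorov extension over the dyadic times\<close>

definition grid :: "nat \<Rightarrow> real set" where
  "grid k = range (\<lambda>i::nat. real i / 2 ^ k)"

definition dyadic_times :: "real set" where
  "dyadic_times = (\<Union>k. grid k)"

lemma grid_mono: "k \<le> l \<Longrightarrow> grid k \<subseteq> grid l"
proof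
  fix t assume kl: "k \<le> l" and "t \<in> grid k"
  then obtain i :: nat where "t = real i / 2 ^ k" by (auto simp: grid_def)
  moreover have "(2::real) ^ l = 2 ^ (l - k) * 2 ^ k"
    using kl by (simp add: power_add[symmetric])
  ultimately have "t = real (i * 2 ^ (l - k)) / 2 ^ l" by simp
  then show "t \<in> grid l" unfolding grid_def by blast
qed

lemma grid_subset_dyadic_times: "grid k \<subseteq> dyadic_times"
  by (auto simp: dyadic_times_def)

lemma finite_subset_grid:
  assumes "finite J" "J \<subseteq> dyadic_times"
  shows "\<exists>k. J \<subseteq> grid k"
  using assms
proof (induction J rule: finite_induct)
  case (insert t J)
  then obtain k l where "J \<subseteq> grid k" "t \<in> grid l" by (auto simp: dyadic_times_def)
  then have "insert t J \<subseteq> grid (max k l)" using grid_mono[of k "max k l"] grid_mono[of l "max k l"] by auto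
  then show ?case by blast
qed auto

text \<open>The partial sums of a step sequence, read as a process with time step \<open>2\<^sup>-\<^sup>k\<close>.\<close>

definition walk :: "nat \<Rightarrow> (nat \<Rightarrow> real^'d) \<Rightarrow> real \<Rightarrow> real^'d" where
  "walk k x t = (\<Sum>i<nat \<lfloor>t * 2 ^ k\<rfloor>. x i)"

lemma walk_grid: "walk k x (real i / 2 ^ k) = (\<Sum>j<i. x j)"
  by (simp add: walk_def)

definition pair_sums :: "(nat \<Rightarrow> real^'d) \<Rightarrow> nat \<Rightarrow> real^'d" where
  "pair_sums x i = x (2 * i) + x (2 * i + 1)"

lemma walk_pair_sums:
  assumes "t \<in> grid k"
  shows "walk (Suc k) x t = walk k (pair_sums x) t"
proof -
  obtain i :: nat where i: "t = real i / 2 ^ k" using assms by (auto simp: grid_def)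
  then have i': "t = real (2 * i) / 2 ^ Suc k" by simp
  have "(\<Sum>j<2*i. x j) = (\<Sum>j<i. pair_sums x j)"
    by (induction i) (auto simp: pair_sums_def algebra_simps)
  then show ?thesis using walk_grid[of "Suc k" x "2 * i"] walk_grid[of k "pair_sums x" i] i i' by metis
qed

lemma indep_vars_coordinates:
  assumes "\<And>i. i \<in> I \<Longrightarrow> prob_space (M i)" "I \<noteq> {}"
  shows "prob_space.indep_vars (PiM I M) M (\<lambda>i x. x i) I"
proof -
  interpret P: prob_space "PiM I M" by (rule prob_space_PiM) fact
  have "distr (PiM I M) (PiM I M) (\<lambda>x. \<lambda>i\<in>I. x i) = distr (PiM I M) (PiM I M) (\<lambda>x. x)"
    by (rule distr_cong) (auto simp: space_PiM PiE_restrict)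
  also have "\<dots> = PiM I M" by (rule distr_id2) simp
  also have "\<dots> = PiM I (\<lambda>i. distr (PiM I M) (M i) (\<lambda>x. x i))"
    by (rule PiM_cong) (auto simp: distr_PiM_component assms)
  finally show ?thesis using assms by (subst P.indep_vars_iff_distr_eq_PiM') auto
qed

text \<open>A sequence of successive square roots with respect to convolution; \<open>\<rho> k\<close> is to be the law of an increment over a time interval of length
\<open>2\<^sup>-\<^sup>k\<close>.\<close>

locale dyadic_roots =
  fixes \<rho> :: "nat \<Rightarrow> (real^'d) measure"
  assumes prob: "\<And>k. borel_probability (\<rho> k)"
    and halve: "\<And>k. \<rho> (Suc k) \<star> \<rho> (Suc k) = \<rho> k"
begin

definition iid_steps :: "nat \<Rightarrow> (nat \<Rightarrow> real^'d) measure" where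
  "iid_steps k = PiM UNIV (\<lambda>_. \<rho> k)"

lemma sets_\<rho>[simp, measurable_cong]: "sets (\<rho> k) = sets borel"
  using prob by (simp add: borel_probability_def)

lemma prob_\<rho>: "prob_space (\<rho> k)"
  using prob by (simp add: borel_probability_def)

lemma sets_iid_steps[simp, measurable_cong]: "sets (iid_steps k) = sets (PiM UNIV (\<lambda>_. borel))"
  unfolding iid_steps_def by (rule sets_PiM_cong) auto

lemma prob_iid_steps: "prob_space (iid_steps k)"
  unfolding iid_steps_def by (rule prob_space_PiM) (rule prob_\<rho>)

lemma measurable_pair_sums[measurable]: "pair_sums \<in> measurable (PiM UNIV (\<lambda>_. borel)) (PiM UNIV (\<lambda>_. borel))"
  unfolding pair_sums_def by (rule measurable_PiM_single') auto

lemma measurable_walk[measurable]: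
  "(\<lambda>x. \<lambda>t\<in>J. walk k x t) \<in> measurable (PiM UNIV (\<lambda>_. borel)) (PiM J (\<lambda>_. borel))"
  unfolding walk_def by measurable

text \<open>Halving the time step refines the walk without changing its law on the coarser grid. This is the consistency needed for Kolmogorov's theorem.\<close>

lemma pair_sums_iid_steps: "distr (iid_steps (Suc k)) (PiM UNIV (\<lambda>_. borel)) pair_sums = iid_steps k"
proof -
  interpret P: prob_space "iid_steps (Suc k)" by (rule prob_iid_steps)
  have c: "P.indep_vars (\<lambda>_. \<rho> (Suc k)) (\<lambda>i x. x i) UNIV"
    unfolding iid_steps_def by (rule indep_vars_coordinates) (auto simp: prob_\<rho>)
  have c: "P.indep_vars (\<lambda>_. borel) (\<lambda>i x. x i) UNIV"
    using P.indep_vars_compose2[OF c, where N="\<lambda>_. borel" and Y="\<lambda>_ x. x"] by simp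
  \<comment> \<open>Sums over disjoint pairs of coordinates are independent.\<close>
  have "i = j" if "z \<in> {2 * i, 2 * i + 1} \<inter> {2 * j, 2 * j + 1}" for i j z :: nat
    using that by simp presburger
  then have disj: "disjoint_family (\<lambda>i::nat. {2 * i, 2 * i + 1})"
    unfolding disjoint_family_on_def by blast
  have "P.indep_vars (\<lambda>i. PiM {2 * i, 2 * i + 1} (\<lambda>_. borel)) (\<lambda>i x. restrict (\<lambda>j. x j) {2 * i, 2 * i + 1}) UNIV"
    by (rule P.indep_vars_restrict[OF c]) (rule subset_UNIV, rule disj)
  then have "P.indep_vars (\<lambda>_. borel) (\<lambda>i x. (\<lambda>y. y (2 * i) + y (2 * i + 1)) (restrict (\<lambda>j. x j) {2 * i, 2 * i + 1})) UNIV"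
    by (rule P.indep_vars_compose2) measurable
  then have i: "P.indep_vars (\<lambda>_. borel) (\<lambda>i x. pair_sums x i) UNIV"
    by (simp add: pair_sums_def)
  have m[measurable]: "(\<lambda>x. pair_sums x i) \<in> borel_measurable (iid_steps (Suc k))" for i
    unfolding pair_sums_def by measurable
  have law: "distr (iid_steps (Suc k)) borel (\<lambda>x. pair_sums x i) = \<rho> k" for i
  proof -
    have "P.indep_vars (\<lambda>_. borel) (\<lambda>b x. x (if b then 2 * i else 2 * i + 1)) UNIV"
    proof -
      have "P.indep_vars (\<lambda>b. PiM {if b then 2 * i else 2 * i + 1} (\<lambda>_. borel))
        (\<lambda>b x. restrict (\<lambda>j. x j) {if b then 2 * i else 2 * i + 1}) UNIV"
        by (rule P.indep_vars_restrict[OF c]) (auto simp: disjoint_family_on_def)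
      then have "P.indep_vars (\<lambda>_. borel) (\<lambda>b x. (\<lambda>y. y (if b then 2 * i else 2 * i + 1))
         (restrict (\<lambda>j. x j) {if b then 2 * i else 2 * i + 1})) UNIV"
        by (rule P.indep_vars_compose2) measurable
      then show ?thesis by simp
    qed
    moreover have "(\<lambda>b x. x (if b then 2 * i else 2 * i + 1)) = (case_bool (\<lambda>x. x (2 * i)) (\<lambda>x::nat \<Rightarrow> real^'d. x (2 * i + 1)))"
      by (auto simp: fun_eq_iff split: bool.split)
    moreover have "(\<lambda>_. (borel :: (real^'d) measure)) = case_bool borel borel" by (auto simp: fun_eq_iff split: bool.split)
    ultimately have "P.indep_var borel (\<lambda>x. x (2 * i)) borel (\<lambda>x. x (2 * i + 1))"
      unfolding P.indep_var_def by simp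
    then have "distr (iid_steps (Suc k)) borel (\<lambda>x. pair_sums x i) =
       (distr (iid_steps (Suc k)) borel (\<lambda>x. x (2 * i)) \<star> distr (iid_steps (Suc k)) borel (\<lambda>x. x (2 * i + 1)))"
      unfolding pair_sums_def by (rule P.sum_indep_random_variable) measurable
    moreover have "distr (iid_steps (Suc k)) borel (\<lambda>x. x j) = \<rho> (Suc k)" for j
    proof -
      have "distr (iid_steps (Suc k)) borel (\<lambda>x. x j) = distr (iid_steps (Suc k)) (\<rho> (Suc k)) (\<lambda>x. x j)"
        by (rule distr_cong) auto
      also have "\<dots> = \<rho> (Suc k)"
        unfolding iid_steps_def by (rule distr_PiM_component) (auto simp: prob_\<rho>)
      finally show ?thesis .
    qed
    ultimately show ?thesis by (simp add: halve)
  qed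
  have "distr (iid_steps (Suc k)) (PiM UNIV (\<lambda>_. borel)) (\<lambda>x. \<lambda>i\<in>UNIV. pair_sums x i) =
     PiM UNIV (\<lambda>i. distr (iid_steps (Suc k)) borel (\<lambda>x. pair_sums x i))"
    using i by (subst (asm) P.indep_vars_iff_distr_eq_PiM') auto
  then show ?thesis unfolding law by (simp add: iid_steps_def[of k] restrict_def)
qed

text \<open>Some level must be chosen to define the law at the times \<open>J\<close>; by refinement any level whose grid contains \<open>J\<close> gives the same law.\<close>

definition common_level :: "real set \<Rightarrow> nat" where
  "common_level J = (LEAST k. J \<subseteq> grid k)"

definition fdd :: "real set \<Rightarrow> (real \<Rightarrow> real^'d) measure" where
  "fdd J = distr (iid_steps (common_level J)) (PiM J (\<lambda>_. borel)) (\<lambda>x. \<lambda>t\<in>J. walk (common_level J) x t)"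

lemma distr_walk_mono:
  assumes "k \<le> l" "J \<subseteq> grid k"
  shows "distr (iid_steps l) (PiM J (\<lambda>_. borel)) (\<lambda>x. \<lambda>t\<in>J. walk l x t) =
    distr (iid_steps k) (PiM J (\<lambda>_. borel)) (\<lambda>x. \<lambda>t\<in>J. walk k x t)"
  using assms(1)
proof (induction l rule: dec_induct)
  case (step l)
  have J: "J \<subseteq> grid l" using assms(2) grid_mono[OF step(1)] by auto
  have "distr (iid_steps l) (PiM J (\<lambda>_. borel)) (\<lambda>x. \<lambda>t\<in>J. walk l x t) =
     distr (iid_steps (Suc l)) (PiM J (\<lambda>_. borel)) ((\<lambda>x. \<lambda>t\<in>J. walk l x t) \<circ> pair_sums)"
    unfolding pair_sums_iid_steps[of l, symmetric] by (rule distr_distr) measurable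
  also have "(\<lambda>x. \<lambda>t\<in>J. walk l x t) \<circ> pair_sums = (\<lambda>x. \<lambda>t\<in>J. walk (Suc l) x t)"
    using J by (auto simp: fun_eq_iff walk_pair_sums)
  finally show ?case using step by simp
qed simp

lemma fdd_eq:
  assumes "J \<subseteq> grid k"
  shows "fdd J = distr (iid_steps k) (PiM J (\<lambda>_. borel)) (\<lambda>x. \<lambda>t\<in>J. walk k x t)"
proof -
  have "common_level J \<le> k" "J \<subseteq> grid (common_level J)"
    unfolding common_level_def using assms by (rule Least_le, rule LeastI)
  then show ?thesis unfolding fdd_def using distr_walk_mono by metis
qed

lemma projective_fdd: "projective_family dyadic_times fdd (\<lambda>_. borel)"
  unfolding projective_family_def
proof (intro conjI allI impI)
  fix J H :: "real set" assume JH: "J \<subseteq> H" "finite H" "H \<subseteq> dyadic_times"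
  then obtain k where k: "H \<subseteq> grid k" using finite_subset_grid by blast
  have "distr (fdd H) (PiM J (\<lambda>_. borel)) (\<lambda>f. restrict f J) =
     distr (iid_steps k) (PiM J (\<lambda>_. borel)) ((\<lambda>f. restrict f J) \<circ> (\<lambda>x. \<lambda>t\<in>H. walk k x t))"
    unfolding fdd_eq[OF k] using JH(1) by (intro distr_distr) (auto intro: measurable_restrict_subset)
  also have "\<dots> = fdd J"
    using k JH(1) by (subst fdd_eq[of J k]) (auto intro!: distr_cong simp: fun_eq_iff)
  finally show "fdd J = distr (fdd H) (PiM J (\<lambda>_. borel)) (\<lambda>f. restrict f J)" ..
next
  fix J :: "real set" assume "finite J" "J \<subseteq> dyadic_times"
  interpret prob_space "iid_steps (common_level J)" by (rule prob_iid_steps)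
  show "prob_space (fdd J)" unfolding fdd_def by (rule prob_space_distr) measurable
qed

text \<open>The projective limit of the finite-dimensional laws is a measure on \<open>real \<Rightarrow> real^'d\<close>, the sample space that \<open>Jmap\<close>
asks for, and the process consists of the coordinates.\<close>

lemma dyadic_process_exists:
  "\<exists>(M :: (real \<Rightarrow> real^'d) measure) X. prob_space M \<and> (\<forall>t\<in>dyadic_times. X t \<in> borel_measurable M) \<and>
     (\<forall>k N. prob_space.indep_vars M (\<lambda>_. borel) (\<lambda>i \<omega>. X (real (Suc i) / 2 ^ k) \<omega> - X (real i / 2 ^ k) \<omega>) {..<N}) \<and>
     (\<forall>k i. distr M borel (\<lambda>\<omega>. X (real (Suc i) / 2 ^ k) \<omega> - X (real i / 2 ^ k) \<omega>) = \<rho> k)"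
proof -
  interpret P: polish_projective dyadic_times fdd
    unfolding polish_projective_def by (rule projective_fdd)
  define M where "M = P.lim"
  interpret M: prob_space M unfolding M_def by (rule P.P.prob_space_axioms)
  have sM[measurable_cong]: "sets M = sets (PiM dyadic_times (\<lambda>_. borel))" by (simp add: M_def)
  have fd: "distr M (PiM J (\<lambda>_. borel)) (\<lambda>f. restrict f J) = fdd J" if J: "finite J" "J \<subseteq> dyadic_times" for J
  proof (rule measure_eqI)
    show "sets (distr M (PiM J (\<lambda>_. borel)) (\<lambda>f. restrict f J)) = sets (fdd J)"
      by (simp add: fdd_def)
    fix A assume "A \<in> sets (distr M (PiM J (\<lambda>_. borel)) (\<lambda>f. restrict f J))"
    then have A: "A \<in> sets (PiM J (\<lambda>_. borel))" by simp
    have "(\<lambda>f. restrict f J) \<in> measurable M (PiM J (\<lambda>_. borel))"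
      using measurable_restrict_subset[OF J(2), of "\<lambda>_. borel"] by (simp add: measurable_cong_sets[OF sM refl])
    then show "emeasure (distr M (PiM J (\<lambda>_. borel)) (\<lambda>f. restrict f J)) A = emeasure (fdd J) A"
      using P.emeasure_lim_emb[OF J(2,1) A] A
      by (simp add: emeasure_distr prod_emb_def M_def space_PiM)
  qed
  have m[measurable]: "(\<lambda>\<omega>. \<omega> t) \<in> borel_measurable M" if "t \<in> dyadic_times" for t
    using that by measurable
  have g[simp]: "real i / 2 ^ k \<in> dyadic_times" for i k
    using grid_subset_dyadic_times[of k] by (auto simp: grid_def)
  have g'[simp]: "(1 + real i) / 2 ^ k \<in> dyadic_times" for i k using g[of "Suc i" k] by simp
  have vec: "distr M (PiM {..<N} (\<lambda>_. borel)) (\<lambda>\<omega>. \<lambda>i\<in>{..<N}. \<omega> (real (Suc i) / 2 ^ k) - \<omega> (real i / 2 ^ k)) =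
       PiM {..<N} (\<lambda>_. \<rho> k)" for k N
  proof -
    define J where "J = (\<lambda>i::nat. real i / 2 ^ k) ` {..N}"
    have J: "finite J" "J \<subseteq> grid k" by (auto simp: J_def grid_def)
    define F where "F f = (\<lambda>i\<in>{..<N}. f (real (Suc i) / 2 ^ k) - f (real i / 2 ^ k) :: real^'d)" for f
    have inJ[simp]: "i < N \<Longrightarrow> real (Suc i) / 2 ^ k \<in> J" "i < N \<Longrightarrow> real i / 2 ^ k \<in> J" for i
      unfolding J_def by (rule imageI, simp)+
    have F[measurable]: "F \<in> measurable (PiM J (\<lambda>_. borel)) (PiM {..<N} (\<lambda>_. borel))"
      unfolding F_def by (rule measurable_restrict) (auto intro!: borel_measurable_diff measurable_component_singleton inJ simp del: of_nat_Suc)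
    have r[measurable]: "(\<lambda>f. restrict f J) \<in> measurable M (PiM J (\<lambda>_. borel))"
      unfolding measurable_cong_sets[OF sM refl]
      by (rule measurable_restrict_subset) (use J grid_subset_dyadic_times[of k] in blast)
    interpret Rp: product_prob_space "\<lambda>_::nat. \<rho> k" UNIV
      by (rule product_prob_spaceI) (rule prob_\<rho>)
    have "distr M (PiM {..<N} (\<lambda>_. borel)) (\<lambda>\<omega>. \<lambda>i\<in>{..<N}. \<omega> (real (Suc i) / 2 ^ k) - \<omega> (real i / 2 ^ k))
       = distr M (PiM {..<N} (\<lambda>_. borel)) (F \<circ> (\<lambda>f. restrict f J))"
      by (rule distr_cong) (auto simp: F_def fun_eq_iff inJ simp del: of_nat_Suc)
    also have "\<dots> = distr (fdd J) (PiM {..<N} (\<lambda>_. borel)) F"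
      using J grid_subset_dyadic_times[of k] by (subst fd[symmetric]) (auto simp: distr_distr F r)
    also have "\<dots> = distr (iid_steps k) (PiM {..<N} (\<lambda>_. borel)) (F \<circ> (\<lambda>x. \<lambda>t\<in>J. walk k x t))"
      unfolding fdd_eq[OF J(2)] by (rule distr_distr) measurable
    also have "F \<circ> (\<lambda>x. \<lambda>t\<in>J. walk k x t) = (\<lambda>x. restrict x {..<N})"
      by (auto simp: F_def fun_eq_iff walk_grid inJ simp del: of_nat_Suc)
    also have "distr (iid_steps k) (PiM {..<N} (\<lambda>_. borel)) (\<lambda>x. restrict x {..<N}) =
      distr (iid_steps k) (PiM {..<N} (\<lambda>_. \<rho> k)) (\<lambda>x. restrict x {..<N})"
      by (rule distr_cong) (simp_all cong: sets_PiM_cong)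
    also have "\<dots> = PiM {..<N} (\<lambda>_. \<rho> k)"
      unfolding iid_steps_def by (rule Rp.distr_PiM_restrict_finite) auto
    finally show ?thesis .
  qed
  have mi: "(\<lambda>\<omega>. \<omega> (real (Suc i) / 2 ^ k) - \<omega> (real i / 2 ^ k)) \<in> borel_measurable M" for i k
    using m[OF g[of "Suc i" k]] m[OF g[of i k]] by (rule borel_measurable_diff)
  have law: "distr M borel (\<lambda>\<omega>. \<omega> (real (Suc i) / 2 ^ k) - \<omega> (real i / 2 ^ k)) = \<rho> k" for k i
  proof -
    have "distr (PiM {..<Suc i} (\<lambda>_. \<rho> k)) borel (\<lambda>x. x i) = distr (PiM {..<Suc i} (\<lambda>_. \<rho> k)) (\<rho> k) (\<lambda>x. x i)"
      by (rule distr_cong) auto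
    also have "\<dots> = \<rho> k" by (rule distr_PiM_component) (auto simp: prob_\<rho>)
    finally have "distr (PiM {..<Suc i} (\<lambda>_. \<rho> k)) borel (\<lambda>x. x i) = \<rho> k" .
    then show ?thesis unfolding vec[symmetric]
      by (subst (asm) distr_distr) (auto simp: comp_def mi simp del: of_nat_Suc intro!: measurable_restrict)
  qed
  have "M.indep_vars (\<lambda>_. borel) (\<lambda>i \<omega>. \<omega> (real (Suc i) / 2 ^ k) - \<omega> (real i / 2 ^ k)) {..<N}" for k N
  proof (cases "N = 0")
    case True then show ?thesis by (simp add: M.indep_vars_def M.indep_sets_def)
  next
    case False
    then show ?thesis by (subst M.indep_vars_iff_distr_eq_PiM') (auto simp: vec law mi simp del: of_nat_Suc)
  qed
  then show ?thesis using law m M.prob_space_axioms by (intro exI[of _ M] exI[of _ "\<lambda>t \<omega>. \<omega> t"]) blast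
qed

end

section \<open>Independence under limits\<close>

text \<open>Independence factorises expectations of products of bounded continuous functions, and this survives an almost sure limit by dominated
convergence. A second limit replaces the continuous functions by indicators of closed sets, which are stable under
intersections and generate the Borel sets.\<close>

lemma (in prob_space) indep_vars_AE_limit:
  fixes X :: "nat \<Rightarrow> 'i \<Rightarrow> 'a \<Rightarrow> 'b::metric_space"
  assumes I: "finite I" and X: "\<And>m. indep_vars (\<lambda>_. borel) (X m) I"
    and Y[measurable]: "\<And>i. i \<in> I \<Longrightarrow> Y i \<in> borel_measurable M"
    and lim: "\<And>i. i \<in> I \<Longrightarrow> AE w in M. (\<lambda>m. X m i w) \<longlonglongrightarrow> Y i w"
  shows "indep_vars (\<lambda>_. borel) Y I"
proof (cases "I = {}")
  case True then show ?thesis by (simp add: indep_vars_def indep_sets_def)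
next
  case False
  have Xm[measurable]: "\<And>m i. i \<in> I \<Longrightarrow> X m i \<in> borel_measurable M" using X by (auto simp: indep_vars_def)
  have prod: "expectation (\<lambda>w. \<Prod>i\<in>I. g i (Y i w)) = (\<Prod>i\<in>I. expectation (\<lambda>w. g i (Y i w)))"
    if g: "\<And>i. continuous_on UNIV (g i)" and g01: "\<And>i x. 0 \<le> g i x" "\<And>i x. g i x \<le> 1"
    for g :: "'i \<Rightarrow> 'b \<Rightarrow> real"
  proof (rule LIMSEQ_unique)
    have [measurable]: "g i \<in> borel_measurable borel" for i by (rule borel_measurable_continuous_onI[OF g])
    have gl: "i \<in> I \<Longrightarrow> AE w in M. (\<lambda>m. g i (X m i w)) \<longlonglongrightarrow> g i (Y i w)" for i
      by (rule eventually_mono[OF lim], assumption, rule isCont_tendsto_compose)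
        (use g[of i] in \<open>auto simp: continuous_on_eq_continuous_at\<close>)
    have m: "expectation (\<lambda>w. \<Prod>i\<in>I. g i (X m i w)) = (\<Prod>i\<in>I. expectation (\<lambda>w. g i (X m i w)))" for m
    proof (rule indep_vars_lebesgue_integral[OF I])
      show "indep_vars (\<lambda>_. borel) (\<lambda>i w. g i (X m i w)) I"
        by (rule indep_vars_compose2[OF X]) measurable
      show "integrable M (\<lambda>w. g i (X m i w))" if "i \<in> I" for i
        using that by (intro integrable_const_bound[of _ 1]) (auto simp: g01)
    qed
    have "(\<lambda>m. expectation (\<lambda>w. \<Prod>i\<in>I. g i (X m i w))) \<longlonglongrightarrow> expectation (\<lambda>w. \<Prod>i\<in>I. g i (Y i w))"
    proof (rule integral_dominated_convergence[where w="\<lambda>_. 1"])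
      have "AE w in M. \<forall>i\<in>I. (\<lambda>m. g i (X m i w)) \<longlonglongrightarrow> g i (Y i w)"
        using gl by (intro AE_finite_allI[OF I])
      then show "AE w in M. (\<lambda>m. \<Prod>i\<in>I. g i (X m i w)) \<longlonglongrightarrow> (\<Prod>i\<in>I. g i (Y i w))"
        by eventually_elim (auto intro!: tendsto_prod)
      show "AE w in M. norm (\<Prod>i\<in>I. g i (X m i w)) \<le> 1" for m
        unfolding prod_norm[symmetric] by (auto intro!: prod_le_1 simp: g01)
    qed auto
    then show "(\<lambda>m. \<Prod>i\<in>I. expectation (\<lambda>w. g i (X m i w))) \<longlonglongrightarrow> expectation (\<lambda>w. \<Prod>i\<in>I. g i (Y i w))"
      by (simp add: m)
    show "(\<lambda>m. \<Prod>i\<in>I. expectation (\<lambda>w. g i (X m i w))) \<longlonglongrightarrow> (\<Prod>i\<in>I. expectation (\<lambda>w. g i (Y i w)))"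
    proof (rule tendsto_prod)
      fix i assume i: "i \<in> I"
      show "(\<lambda>m. expectation (\<lambda>w. g i (X m i w))) \<longlonglongrightarrow> expectation (\<lambda>w. g i (Y i w))"
        by (rule integral_dominated_convergence[where w="\<lambda>_. 1"]) (use gl i in \<open>auto simp: g01\<close>)
    qed
  qed
  have closed_prod: "prob (\<Inter>j\<in>I. Y j -` A j \<inter> space M) = (\<Prod>j\<in>I. prob (Y j -` A j \<inter> space M))"
    if A: "\<And>j. j \<in> I \<Longrightarrow> closed (A j)" for A
  proof (cases "\<exists>j\<in>I. A j = {}")
    case True
    then have "(\<Inter>j\<in>I. Y j -` A j \<inter> space M) = {}" by auto
    moreover have "(\<Prod>j\<in>I. prob (Y j -` A j \<inter> space M)) = 0"
    proof -
      obtain j where j: "j \<in> I" "A j = {}" using True by blast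
      then show ?thesis using I by (intro prod_zero bexI[of _ j]) auto
    qed
    ultimately show ?thesis by simp
  next
    case ne: False
    \<comment> \<open>Continuous functions decreasing to the indicator of the closed set \<open>A i\<close>.\<close>
    define g where "g n i x = max 0 (1 - real n * infdist x (A i))" for n i x
    have gl: "(\<lambda>n. g n i x) \<longlonglongrightarrow> indicator (A i) x" if i: "i \<in> I" for i x
    proof (cases "x \<in> A i")
      case True then show ?thesis by (simp add: g_def)
    next
      case False
      then have d: "infdist x (A i) > 0"
        using in_closed_iff_infdist_zero[OF A[OF i]] ne i infdist_nonneg[of x "A i"] by fastforce
      obtain n0 :: nat where "1 / infdist x (A i) \<le> n0" using real_arch_simple by blast
      then have n0: "1 \<le> real n0 * infdist x (A i)" using d by (simp add: field_simps)
      have "g n i x = 0" if "n \<ge> n0" for n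
      proof -
        have "real n0 * infdist x (A i) \<le> real n * infdist x (A i)" using that d by (intro mult_right_mono) auto
        then show ?thesis using n0 by (simp add: g_def)
      qed
      then show ?thesis using False by (intro tendsto_eventually) (auto simp: eventually_sequentially)
    qed
    have gc: "continuous_on UNIV (g n i)" for n i
      unfolding g_def by (intro continuous_intros)
    have [measurable]: "g n i \<in> borel_measurable borel" for n i by (rule borel_measurable_continuous_onI[OF gc])
    have g01: "0 \<le> g n i x" "g n i x \<le> 1" for n i x by (auto simp: g_def infdist_nonneg)
    have [measurable]: "i \<in> I \<Longrightarrow> A i \<in> sets borel" for i using A by auto
    have e: "expectation (\<lambda>w. \<Prod>i\<in>I. indicator (A i) (Y i w)) = (\<Prod>i\<in>I. expectation (\<lambda>w. indicator (A i) (Y i w) :: real))"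
    proof (rule LIMSEQ_unique)
      show "(\<lambda>n. \<Prod>i\<in>I. expectation (\<lambda>w. g n i (Y i w))) \<longlonglongrightarrow> (\<Prod>i\<in>I. expectation (\<lambda>w. indicator (A i) (Y i w)))"
        by (intro tendsto_prod integral_dominated_convergence[where w="\<lambda>_. 1"]) (auto simp: g01 gl)
      have "(\<lambda>n. expectation (\<lambda>w. \<Prod>i\<in>I. g n i (Y i w))) \<longlonglongrightarrow> expectation (\<lambda>w. \<Prod>i\<in>I. indicator (A i) (Y i w))"
      proof (rule integral_dominated_convergence[where w="\<lambda>_. 1"])
        show "AE w in M. norm (\<Prod>i\<in>I. g n i (Y i w)) \<le> 1" for n
          unfolding prod_norm[symmetric] by (auto intro!: prod_le_1 simp: g01)
      qed (auto intro!: tendsto_prod gl)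
      then show "(\<lambda>n. \<Prod>i\<in>I. expectation (\<lambda>w. g n i (Y i w))) \<longlonglongrightarrow> expectation (\<lambda>w. \<Prod>i\<in>I. indicator (A i) (Y i w))"
        using prod[OF gc g01] by simp
    qed
    have "expectation (\<lambda>w. \<Prod>i\<in>I. indicator (A i) (Y i w)) = expectation (indicator (\<Inter>j\<in>I. Y j -` A j \<inter> space M) :: _ \<Rightarrow> real)"
      using I False by (intro Bochner_Integration.integral_cong) (auto simp: indicator_def prod_zero_iff)
    moreover have "expectation (\<lambda>w. indicator (A i) (Y i w) :: real) = prob (Y i -` A i \<inter> space M)" if "i \<in> I" for i
    proof -
      have "expectation (\<lambda>w. indicator (A i) (Y i w) :: real) = expectation (indicator (Y i -` A i \<inter> space M))"
        by (intro Bochner_Integration.integral_cong) (auto simp: indicator_def)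
      then show ?thesis using that by (simp add: Int_commute)
    qed
    moreover have "(\<Inter>j\<in>I. Y j -` A j \<inter> space M) \<in> events"
      using I False by (intro sets.finite_INT) auto
    ultimately show ?thesis using e by simp
  qed
  show ?thesis
  proof (subst indep_vars_finite[OF False I, where E="\<lambda>_. Collect closed"])
    show "sets borel = sigma_sets (space borel) (Collect closed)"
      by (simp add: borel_eq_closed)
    show "\<forall>A\<in>I \<rightarrow> Collect closed. prob (\<Inter>j\<in>I. Y j -` A j \<inter> space M) = (\<Prod>j\<in>I. prob (Y j -` A j \<inter> space M))"
      by (intro ballI closed_prod) (auto simp: Pi_iff)
  qed (auto intro!: Int_stableI)
qed

section \<open>Oscillations of random walks\<close>

text \<open>There are \<open>p\<close> pairs of times \<open>s\<^sub>1 < t\<^sub>1 \<le> s\<^sub>2 < t\<^sub>2 \<le> ...\<close> in \<open>S\<close>, none before \<open>a\<close>, between which \<open>f\<close> moves by more than \<open>e\<close>.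
A function on a bounded time interval has one-sided limits exactly when, for every \<open>e\<close>, the number of such pairs is bounded. The index type is left open because
the same notion is used for random walks (natural numbers) and for processes (real times).\<close>

primrec oscillates :: "'i::linorder set \<Rightarrow> real \<Rightarrow> ('i \<Rightarrow> real^'d) \<Rightarrow> nat \<Rightarrow> 'i \<Rightarrow> bool" where
  "oscillates S e f 0 a \<longleftrightarrow> True"
| "oscillates S e f (Suc p) a \<longleftrightarrow>
     (\<exists>s\<in>S. \<exists>t\<in>S. a \<le> s \<and> s < t \<and> e < norm (f t - f s) \<and> oscillates S e f p t)"

lemma oscillates_antimono: "oscillates S e f p b \<Longrightarrow> a \<le> b \<Longrightarrow> oscillates S e f p a"
  by (cases p) (simp, simp only: oscillates.simps, meson order_trans)

lemma oscillates_cong: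
  fixes a :: "'i::linorder"
  assumes "\<And>s t. s \<in> S \<Longrightarrow> t \<in> S \<Longrightarrow> a \<le> s \<Longrightarrow> s < t \<Longrightarrow> norm (f t - f s) = norm (g t - g s)"
  shows "oscillates S e f p a \<longleftrightarrow> oscillates S e g p a"
  using assms
proof (induction p arbitrary: a)
  case (Suc p)
  have "oscillates S e f p t \<longleftrightarrow> oscillates S e g p t" if "a \<le> t" for t
    by (rule Suc.IH) (use Suc.prems that order_trans in blast)
  moreover have "a \<le> s \<Longrightarrow> s < t \<Longrightarrow> a \<le> t" for s t :: 'i by auto
  ultimately show ?case unfolding oscillates.simps
    by (intro bex_cong refl conj_cong) (simp_all add: Suc.prems)
qed simp

lemma oscillates_mono: "oscillates S e f p a \<Longrightarrow> S \<subseteq> T \<Longrightarrow> oscillates T e f p a"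
proof (induction p arbitrary: a)
  case (Suc p)
  then show ?case unfolding oscillates.simps by (meson subsetD)
qed simp

lemma oscillates_image:
  assumes "strict_mono g"
  shows "oscillates (g ` S) e f p (g a) \<longleftrightarrow> oscillates S e (\<lambda>i. f (g i)) p a"
  by (induction p arbitrary: a) (simp_all add: strict_mono_less[OF assms] strict_mono_less_eq[OF assms])

lemma oscillates_Union:
  assumes "incseq S" "oscillates (\<Union>k. S k) e f p a"
  shows "\<exists>k. oscillates (S k) e f p a"
  using assms(2)
proof (induction p arbitrary: a)
  case (Suc p)
  then obtain s t i j where st: "s \<in> S i" "t \<in> S j" "a \<le> s" "s < t" "e < norm (f t - f s)"
    and "oscillates (\<Union>k. S k) e f p t" by auto
  with Suc.IH obtain k where k: "oscillates (S k) e f p t" by blast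
  define m where "m = max i (max j k)"
  have "S i \<subseteq> S m" "S j \<subseteq> S m" "S k \<subseteq> S m" using assms(1) by (auto simp: m_def incseq_def)
  then have "oscillates (S m) e f (Suc p) a" using st k oscillates_mono[of "S k" e f p t "S m"]
    by (auto simp: subset_eq)
  then show ?case by blast
qed simp

lemma pred_countable_Bex:
  assumes "countable S" "\<And>s. s \<in> S \<Longrightarrow> Measurable.pred M (P s)"
  shows "Measurable.pred M (\<lambda>w. \<exists>s\<in>S. P s w)"
proof -
  have "{w \<in> space M. \<exists>s\<in>S. P s w} = (\<Union>s\<in>S. {w \<in> space M. P s w})" by auto
  also have "\<dots> \<in> sets M" using assms by (intro sets.countable_UN'') (auto simp: pred_def)
  finally show ?thesis by (simp add: pred_def)
qed

lemma pred_oscillates: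
  assumes S: "countable S" and f: "\<And>i. i \<in> S \<Longrightarrow> f i \<in> borel_measurable M"
  shows "Measurable.pred M (\<lambda>w. oscillates S e (\<lambda>i. f i w) p a)"
proof (induction p arbitrary: a)
  case (Suc p)
  show ?case unfolding oscillates.simps
  proof (intro pred_countable_Bex S)
    fix s t assume "s \<in> S" "t \<in> S"
    then have [measurable]: "f s \<in> borel_measurable M" "f t \<in> borel_measurable M" using f by auto
    have [measurable]: "Measurable.pred M (\<lambda>w. oscillates S e (\<lambda>i. f i w) p t)" by (rule Suc)
    show "Measurable.pred M (\<lambda>w. a \<le> s \<and> s < t \<and> e < norm (f t w - f s w) \<and> oscillates S e (\<lambda>i. f i w) p t)"
      by measurable
  qed
qed simp

text \<open>Events decided by the first \<open>j\<close> variables are independent of events decided by the others. The restricted arguments express on which coordinates \<open>P\<close> and \<open>Q\<close> depend.\<close>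

lemma (in prob_space) indep_past_future:
  fixes \<xi> :: "nat \<Rightarrow> 'a \<Rightarrow> 'b::topological_space"
  assumes ind: "indep_vars (\<lambda>_. borel) \<xi> {..<N}" and j: "j \<le> N"
    and P[measurable]: "Measurable.pred (PiM {..<j} (\<lambda>_. borel)) P" and Q[measurable]: "Measurable.pred (PiM {j..<N} (\<lambda>_. borel)) Q"
    and PP: "\<And>x. P (restrict x {..<j}) \<longleftrightarrow> P' x" and QQ: "\<And>x. Q (restrict x {j..<N}) \<longleftrightarrow> Q' x"
  shows "prob {w \<in> space M. P' (\<lambda>i. \<xi> i w) \<and> Q' (\<lambda>i. \<xi> i w)} =
    prob {w \<in> space M. P' (\<lambda>i. \<xi> i w)} * prob {w \<in> space M. Q' (\<lambda>i. \<xi> i w)}"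
proof -
  let ?A = "{x \<in> space (PiM {..<j} (\<lambda>_. borel)). P x}" and ?B = "{x \<in> space (PiM {j..<N} (\<lambda>_. borel)). Q x}"
  have "indep_var (PiM {..<j} (\<lambda>_. borel)) (\<lambda>\<omega>. restrict (\<lambda>i. \<xi> i \<omega>) {..<j})
     (PiM {j..<N} (\<lambda>_. borel)) (\<lambda>\<omega>. restrict (\<lambda>i. \<xi> i \<omega>) {j..<N})"
    by (rule indep_var_restrict[OF ind]) (use j in auto)
  from indep_varD[OF this, of ?A ?B]
  have "prob ((\<lambda>\<omega>. (restrict (\<lambda>i. \<xi> i \<omega>) {..<j}, restrict (\<lambda>i. \<xi> i \<omega>) {j..<N})) -` (?A \<times> ?B) \<inter> space M) =
    prob ((\<lambda>\<omega>. restrict (\<lambda>i. \<xi> i \<omega>) {..<j}) -` ?A \<inter> space M) *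
    prob ((\<lambda>\<omega>. restrict (\<lambda>i. \<xi> i \<omega>) {j..<N}) -` ?B \<inter> space M)"
    by simp
  moreover have "(\<lambda>\<omega>. (restrict (\<lambda>i. \<xi> i \<omega>) {..<j}, restrict (\<lambda>i. \<xi> i \<omega>) {j..<N})) -` (?A \<times> ?B) \<inter> space M =
     {w \<in> space M. P' (\<lambda>i. \<xi> i w) \<and> Q' (\<lambda>i. \<xi> i w)}"
    "(\<lambda>\<omega>. restrict (\<lambda>i. \<xi> i \<omega>) {..<j}) -` ?A \<inter> space M = {w \<in> space M. P' (\<lambda>i. \<xi> i w)}"
    "(\<lambda>\<omega>. restrict (\<lambda>i. \<xi> i \<omega>) {j..<N}) -` ?B \<inter> space M = {w \<in> space M. Q' (\<lambda>i. \<xi> i w)}"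
    by (auto simp: space_PiM PP QQ)
  ultimately show ?thesis by simp
qed

text \<open>Started afresh at index \<open>a\<close>, the walk with steps \<open>x\<close> leaves the ball of radius \<open>r\<close> for the first time at index \<open>j\<close>.\<close>

definition first_exit :: "real \<Rightarrow> nat \<Rightarrow> nat \<Rightarrow> (nat \<Rightarrow> real^'d) \<Rightarrow> bool" where
  "first_exit r a j x \<longleftrightarrow> a \<le> j \<and> r < norm (sum x {a..<j}) \<and> (\<forall>i\<in>{a..<j}. norm (sum x {a..<i}) \<le> r)"

lemma pred_first_exit:
  assumes "\<And>i. i \<le> j \<Longrightarrow> (\<lambda>w. sum (x w) {a..<i}) \<in> borel_measurable M"
  shows "Measurable.pred M (\<lambda>w. first_exit r a j (x w))"
proof -
  have lt: "Measurable.pred M (\<lambda>w. r < norm (sum (x w) {a..<i}))" if "i \<le> j" for i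
    using assms[OF that] by measurable
  have [measurable]: "Measurable.pred M (\<lambda>w. \<exists>i\<in>{a..<j}. r < norm (sum (x w) {a..<i}))"
    by (rule pred_countable_Bex) (auto intro: lt)
  note [measurable] = lt[OF order_refl]
  have *: "first_exit r a j y \<longleftrightarrow>
      a \<le> j \<and> r < norm (sum y {a..<j}) \<and> \<not> (\<exists>i\<in>{a..<j}. r < norm (sum y {a..<i}))" for y
    by (auto simp: first_exit_def not_less)
  show ?thesis unfolding * by measurable
qed

lemma first_exit_unique: "first_exit r a i x \<Longrightarrow> first_exit r a j x \<Longrightarrow> i = j"
  unfolding first_exit_def by (cases i j rule: linorder_cases) (auto simp: not_le[symmetric])

lemma sum_diff_range:
  fixes x :: "nat \<Rightarrow> 'b::ab_group_add"
  shows "i \<le> j \<Longrightarrow> sum x {..<j} - sum x {..<i} = sum x {i..<j}"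
  by (simp add: lessThan_atLeast0 sum_diff_nat_ivl)

text \<open>A move by more than \<open>4 e\<close> between \<open>s\<close> and \<open>t\<close> forces one of the two positions to be further than \<open>2 e\<close> from the position at \<open>a\<close>. So the
first exit happens by time \<open>t\<close>, and the remaining oscillations come after it.\<close>

lemma oscillates_first_exit:
  fixes x :: "nat \<Rightarrow> real^'d"
  assumes "oscillates {..N} (4 * e) (\<lambda>i. sum x {..<i}) (Suc p) a"
  shows "\<exists>j\<in>{a..N}. first_exit (2 * e) a j x \<and> oscillates {..N} (4 * e) (\<lambda>i. sum x {..<i}) p j"
proof -
  obtain s t where st: "t \<le> N" "a \<le> s" "s < t" "4 * e < norm (sum x {..<t} - sum x {..<s})"
    and o: "oscillates {..N} (4 * e) (\<lambda>i. sum x {..<i}) p t"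
    using assms by auto
  have "sum x {..<t} - sum x {..<s} = sum x {a..<t} - sum x {a..<s}"
    using st sum_diff_range[of a t x] sum_diff_range[of a s x] by (auto simp: algebra_simps)
  then have "4 * e < norm (sum x {a..<t}) + norm (sum x {a..<s})"
    using st(4) norm_triangle_ineq4[of "sum x {a..<t}" "sum x {a..<s}"] by simp
  then have "\<exists>j. a \<le> j \<and> j \<le> t \<and> 2 * e < norm (sum x {a..<j})"
  proof (cases "2 * e < norm (sum x {a..<t})")
    case True
    then show ?thesis using st by (intro exI[of _ t]) auto
  next
    case False
    with \<open>4 * e < norm (sum x {a..<t}) + norm (sum x {a..<s})\<close>
    show ?thesis using st by (intro exI[of _ s]) auto
  qed
  define j where "j = (LEAST j. a \<le> j \<and> j \<le> t \<and> 2 * e < norm (sum x {a..<j}))"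
  have j: "a \<le> j \<and> j \<le> t \<and> 2 * e < norm (sum x {a..<j})"
    unfolding j_def by (rule LeastI_ex) fact
  have "norm (sum x {a..<i}) \<le> 2 * e" if "a \<le> i" "i < j" for i
    using not_less_Least[OF that(2)[unfolded j_def]] j that by auto
  then have "first_exit (2 * e) a j x" using j by (auto simp: first_exit_def)
  then show ?thesis using oscillates_antimono[OF o, of j] j st by auto
qed

text \<open>Ottaviani's inequality bounds the probability that the walk ever exits the ball of radius \<open>2 e\<close>. By the Markov property at the first exit,
every further oscillation costs the same factor, which gives a geometric bound that does not depend on \<open>N\<close>.\<close>

lemma (in prob_space)
  fixes \<xi> :: "nat \<Rightarrow> 'a \<Rightarrow> real^'d"
  assumes ind: "indep_vars (\<lambda>_. borel) \<xi> {..<N}" and \<alpha>: "0 \<le> \<alpha>" "\<alpha> < 1"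
    and small: "\<And>i j. i \<le> j \<Longrightarrow> j \<le> N \<Longrightarrow> prob {w \<in> space M. e < norm (\<Sum>l\<in>{i..<j}. \<xi> l w)} \<le> \<alpha>"
  shows first_exit_prob: "a \<le> N \<Longrightarrow> (\<Sum>j\<in>{a..N}. prob {w \<in> space M. first_exit (2 * e) a j (\<lambda>i. \<xi> i w)}) \<le> \<alpha> / (1 - \<alpha>)"
    and oscillates_prob: "a \<le> N \<Longrightarrow> prob {w \<in> space M. oscillates {..N} (4 * e) (\<lambda>i. \<Sum>l<i. \<xi> l w) p a} \<le> (\<alpha> / (1 - \<alpha>)) ^ p"
proof -
  have \<xi>[measurable]: "i < N \<Longrightarrow> \<xi> i \<in> borel_measurable M" for i
    using ind by (auto simp: indep_vars_def)
  have ms: "(\<lambda>w. \<Sum>l\<in>{i..<j}. \<xi> l w) \<in> borel_measurable M" if "j \<le> N" for i j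
    using that by (intro borel_measurable_sum \<xi>) auto
  have mF: "{w \<in> space M. first_exit (2 * e) a j (\<lambda>i. \<xi> i w)} \<in> events" if "j \<le> N" for a j
  proof -
    have "Measurable.pred M (\<lambda>w. first_exit (2 * e) a j (\<lambda>i. \<xi> i w))"
      by (rule pred_first_exit, rule ms) (use that in simp)
    then show ?thesis by (simp add: pred_def)
  qed
  have mO: "{w \<in> space M. oscillates {..N} (4 * e) (\<lambda>i. \<Sum>l<i. \<xi> l w) p a} \<in> events" for p a
  proof -
    have "Measurable.pred M (\<lambda>w. oscillates {..N} (4 * e) (\<lambda>i. (\<lambda>w. \<Sum>l<i. \<xi> l w) w) p a)"
      by (rule pred_oscillates) (auto simp: lessThan_atLeast0 intro: ms)
    then show ?thesis by (simp add: pred_def)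
  qed
  have pF: "Measurable.pred (PiM {..<j} (\<lambda>_. borel)) (first_exit r a j :: (nat \<Rightarrow> real^'d) \<Rightarrow> _)" for j r a
  proof -
    show ?thesis
      by (rule pred_first_exit) (intro borel_measurable_sum measurable_component_singleton, auto)
  qed
  have rF: "first_exit r a j (restrict x {..<j}) \<longleftrightarrow> first_exit r a j x" for r a j and x :: "nat \<Rightarrow> real^'d"
  proof -
    have "sum (restrict x {..<j}) {a..<i} = sum x {a..<i}" if "i \<le> j" for i
      using that by (intro sum.cong) auto
    then show ?thesis by (auto simp: first_exit_def)
  qed
  show exit: "(\<Sum>j\<in>{a..N}. prob {w \<in> space M. first_exit (2 * e) a j (\<lambda>i. \<xi> i w)}) \<le> \<alpha> / (1 - \<alpha>)" if a: "a \<le> N" for a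
  proof -
    \<comment> \<open>After a first exit at \<open>j\<close>, a final displacement of at most \<open>e\<close> from there keeps the walk beyond \<open>e\<close> of its start. This has conditional probability at least \<open>1 - \<alpha>\<close>, but total probability at most \<open>\<alpha>\<close>.\<close>
    let ?F = "\<lambda>j. {w \<in> space M. first_exit (2 * e) a j (\<lambda>i. \<xi> i w)}"
    let ?G = "\<lambda>j. {w \<in> space M. first_exit (2 * e) a j (\<lambda>i. \<xi> i w) \<and> norm (\<Sum>l\<in>{j..<N}. \<xi> l w) \<le> e}"
    have G: "prob (?G j) = prob (?F j) * prob {w \<in> space M. norm (\<Sum>l\<in>{j..<N}. \<xi> l w) \<le> e}" if j: "j \<le> N" for j
    proof (rule indep_past_future[OF ind j pF])
      show "Measurable.pred (PiM {j..<N} (\<lambda>_. borel)) (\<lambda>x. norm (sum x {j..<N} :: real^'d) \<le> e)"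
        by measurable
    qed (auto simp: rF)
    have mG: "?G j \<in> events" if "j \<le> N" for j
    proof -
      have [measurable]: "(\<lambda>w. \<Sum>l\<in>{j..<N}. \<xi> l w) \<in> borel_measurable M" by (rule ms) simp
      have "?G j = ?F j \<inter> {w \<in> space M. norm (\<Sum>l\<in>{j..<N}. \<xi> l w) \<le> e}" by auto
      then show ?thesis using mF[OF that] by auto
    qed
    have l: "1 - \<alpha> \<le> prob {w \<in> space M. norm (\<Sum>l\<in>{j..<N}. \<xi> l w) \<le> e}" if "j \<le> N" for j
    proof -
      have [measurable]: "(\<lambda>w. \<Sum>l\<in>{j..<N}. \<xi> l w) \<in> borel_measurable M" by (rule ms) simp
      have "{w \<in> space M. norm (\<Sum>l\<in>{j..<N}. \<xi> l w) \<le> e} = space M - {w \<in> space M. e < norm (\<Sum>l\<in>{j..<N}. \<xi> l w)}"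
        by auto
      then have "prob {w \<in> space M. norm (\<Sum>l\<in>{j..<N}. \<xi> l w) \<le> e} = 1 - prob {w \<in> space M. e < norm (\<Sum>l\<in>{j..<N}. \<xi> l w)}"
        by (simp add: prob_compl)
      then show ?thesis using small[OF that order_refl] by simp
    qed
    have "(\<Sum>j\<in>{a..N}. prob (?F j)) * (1 - \<alpha>) \<le> (\<Sum>j\<in>{a..N}. prob (?G j))"
      unfolding sum_distrib_right by (rule sum_mono) (auto simp: G l intro!: mult_left_mono)
    also have "\<dots> = prob (\<Union>j\<in>{a..N}. ?G j)"
      by (rule finite_measure_finite_Union[symmetric])
         (use mG in \<open>auto simp: disjoint_family_on_def dest: first_exit_unique\<close>)
    also have "\<dots> \<le> prob {w \<in> space M. e < norm (\<Sum>l\<in>{a..<N}. \<xi> l w)}"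
    proof (rule finite_measure_mono)
      have [measurable]: "(\<lambda>w. \<Sum>l\<in>{a..<N}. \<xi> l w) \<in> borel_measurable M" by (rule ms) simp
      show "{w \<in> space M. e < norm (\<Sum>l\<in>{a..<N}. \<xi> l w)} \<in> events" by measurable
      show "(\<Union>j\<in>{a..N}. ?G j) \<subseteq> {w \<in> space M. e < norm (\<Sum>l\<in>{a..<N}. \<xi> l w)}"
      proof safe
        fix w j assume w: "w \<in> space M" "j \<in> {a..N}" "first_exit (2 * e) a j (\<lambda>i. \<xi> i w)" "norm (\<Sum>l\<in>{j..<N}. \<xi> l w) \<le> e"
        have "(\<Sum>l\<in>{a..<N}. \<xi> l w) = (\<Sum>l\<in>{a..<j}. \<xi> l w) + (\<Sum>l\<in>{j..<N}. \<xi> l w)"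
          using w by (auto simp: sum.atLeastLessThan_concat)
        then show "e < norm (\<Sum>l\<in>{a..<N}. \<xi> l w)"
          using w norm_triangle_ineq4[of "(\<Sum>l\<in>{a..<N}. \<xi> l w)" "(\<Sum>l\<in>{j..<N}. \<xi> l w)"]
          by (auto simp: first_exit_def)
      qed
    qed
    also have "\<dots> \<le> \<alpha>" using small[OF a order_refl] .
    finally show ?thesis using \<alpha> by (simp add: field_simps)
  qed
  show "prob {w \<in> space M. oscillates {..N} (4 * e) (\<lambda>i. \<Sum>l<i. \<xi> l w) p a} \<le> (\<alpha> / (1 - \<alpha>)) ^ p" if "a \<le> N" for a
    using that
  proof (induction p arbitrary: a)
    case (Suc p)
    let ?O = "\<lambda>p a. {w \<in> space M. oscillates {..N} (4 * e) (\<lambda>i. \<Sum>l<i. \<xi> l w) p a}"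
    let ?F = "\<lambda>j. {w \<in> space M. first_exit (2 * e) a j (\<lambda>i. \<xi> i w)}"
    have q: "0 \<le> \<alpha> / (1 - \<alpha>)" using \<alpha> by simp
    \<comment> \<open>Exiting at \<open>j\<close> is decided by the steps before \<open>j\<close>, the remaining oscillations by the later ones.\<close>
    have ind2: "prob (?F j \<inter> ?O p j) = prob (?F j) * prob (?O p j)" if j: "j \<le> N" for j
    proof -
      have "prob {w \<in> space M. first_exit (2 * e) a j (\<lambda>i. \<xi> i w) \<and> oscillates {..N} (4 * e) (\<lambda>i. \<Sum>l<i. \<xi> l w) p j}
        = prob (?F j) * prob (?O p j)"
      proof (rule indep_past_future[OF ind j pF, where Q="\<lambda>x. oscillates {..N} (4 * e) (\<lambda>i. \<Sum>l\<in>{j..<i} \<inter> {..<N}. x l) p j"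
            and Q'="\<lambda>x. oscillates {..N} (4 * e) (\<lambda>i. \<Sum>l<i. x l) p j"])
        show "Measurable.pred (PiM {j..<N} (\<lambda>_. borel)) (\<lambda>x. oscillates {..N} (4 * e) (\<lambda>i. \<Sum>l\<in>{j..<i} \<inter> {..<N}. x l :: real^'d) p j)"
          by (rule pred_oscillates) (auto intro!: borel_measurable_sum measurable_component_singleton)
        show "oscillates {..N} (4 * e) (\<lambda>i. \<Sum>l\<in>{j..<i} \<inter> {..<N}. restrict x {j..<N} l) p j \<longleftrightarrow>
           oscillates {..N} (4 * e) (\<lambda>i. \<Sum>l<i. x l) p j" for x :: "nat \<Rightarrow> real^'d"
        proof (rule oscillates_cong)
          fix s t assume st: "s \<in> {..N}" "t \<in> {..N}" "j \<le> s" "s < t"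
          have "(\<Sum>l\<in>{j..<i} \<inter> {..<N}. restrict x {j..<N} l) = sum x {j..<i}" if "i \<le> N" for i
            using that by (intro sum.cong) auto
          moreover have "sum x {j..<t} - sum x {j..<s} = sum x {..<t} - sum x {..<s}"
            using st sum_diff_range[of j t x] sum_diff_range[of j s x] by (auto simp: algebra_simps)
          ultimately show "norm ((\<Sum>l\<in>{j..<t} \<inter> {..<N}. restrict x {j..<N} l) - (\<Sum>l\<in>{j..<s} \<inter> {..<N}. restrict x {j..<N} l)) =
            norm (sum x {..<t} - sum x {..<s})" using st by simp
        qed
      qed (simp add: rF)
      moreover have "?F j \<inter> ?O p j = {w \<in> space M. first_exit (2 * e) a j (\<lambda>i. \<xi> i w) \<and> oscillates {..N} (4 * e) (\<lambda>i. \<Sum>l<i. \<xi> l w) p j}"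
        by auto
      ultimately show ?thesis by simp
    qed
    have "prob (?O (Suc p) a) \<le> prob (\<Union>j\<in>{a..N}. ?F j \<inter> ?O p j)"
    proof (rule finite_measure_mono)
      show "?O (Suc p) a \<subseteq> (\<Union>j\<in>{a..N}. ?F j \<inter> ?O p j)"
      proof
        fix w assume "w \<in> ?O (Suc p) a"
        then show "w \<in> (\<Union>j\<in>{a..N}. ?F j \<inter> ?O p j)"
          using oscillates_first_exit[of N e "\<lambda>i. \<xi> i w" p a] by blast
      qed
      show "(\<Union>j\<in>{a..N}. ?F j \<inter> ?O p j) \<in> events"
        using mF mO by (intro sets.finite_UN sets.Int) auto
    qed
    also have "\<dots> \<le> (\<Sum>j\<in>{a..N}. prob (?F j \<inter> ?O p j))"
      using mF mO by (intro finite_measure_subadditive_finite) auto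
    also have "\<dots> = (\<Sum>j\<in>{a..N}. prob (?F j) * prob (?O p j))"
      by (intro sum.cong refl ind2) auto
    also have "\<dots> \<le> (\<Sum>j\<in>{a..N}. prob (?F j) * (\<alpha> / (1 - \<alpha>)) ^ p)"
      by (intro sum_mono mult_left_mono Suc.IH) auto
    also have "\<dots> = (\<Sum>j\<in>{a..N}. prob (?F j)) * (\<alpha> / (1 - \<alpha>)) ^ p"
      by (simp add: sum_distrib_right)
    also have "\<dots> \<le> (\<alpha> / (1 - \<alpha>)) * (\<alpha> / (1 - \<alpha>)) ^ p"
      by (rule mult_right_mono[OF exit[OF Suc.prems]]) (use q in auto)
    finally show ?case by simp
  qed simp
qed

section \<open>Concentration near the origin\<close>

text \<open>Each coordinate converges weakly to 0 by the continuity theorem on the line, and a long vector has a large coordinate.\<close>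

lemma charf_tendsto_1_imp_concentrated:
  fixes \<mu> :: "nat \<Rightarrow> (real^'d) measure"
  assumes b: "\<And>n. borel_probability (\<mu> n)" and lim: "\<And>y. (\<lambda>n. charf (\<mu> n) y) \<longlonglongrightarrow> 1" and e: "0 < e"
  shows "(\<lambda>n. measure (\<mu> n) {x. e < norm x}) \<longlonglongrightarrow> 0"
proof -
  have s[measurable_cong]: "sets (\<mu> n) = sets borel" for n using b by (simp add: borel_probability_def)
  have sp: "space (\<mu> n) = UNIV" for n using sets_eq_imp_space_eq[OF s] by simp
  have p: "prob_space (\<mu> n)" for n using b by (simp add: borel_probability_def)
  define c where "c = e / CARD('d)"
  have c: "0 < c" using e by (simp add: c_def)
  let ?A = "{x::real. c < \<bar>x\<bar>}"
  have coord: "(\<lambda>n. measure (distr (\<mu> n) borel (\<lambda>x. x $ k)) ?A) \<longlonglongrightarrow> measure (return borel 0) ?A" for k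
  proof (rule weak_conv_imp_continuity_set_conv)
    show "real_distribution (distr (\<mu> n) borel (\<lambda>x. x $ k))" for n
      using p by (auto simp: real_distribution_def real_distribution_axioms_def intro!: prob_space.prob_space_distr)
    moreover show "real_distribution (return borel (0::real))"
      by (auto simp: real_distribution_def real_distribution_axioms_def prob_space_return)
    moreover have "char (distr (\<mu> n) borel (\<lambda>x. x $ k)) t = charf (\<mu> n) (axis k t)" for n t
      unfolding char_def charf_def by (subst integral_distr) (auto simp: inner_axis')
    moreover have "char (return borel 0) t = 1" for t
      unfolding char_def by (subst integral_return) auto
    ultimately show "weak_conv_m (\<lambda>n. distr (\<mu> n) borel (\<lambda>x. x $ k)) (return borel 0)"
      by (intro levy_continuity) (auto simp: lim)
    have "closed {x::real. c \<le> \<bar>x\<bar>}" by (intro closed_Collect_le continuous_intros)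
    then have "closure ?A \<subseteq> {x. c \<le> \<bar>x\<bar>}" by (intro closure_minimal) auto
    then have "0 \<notin> frontier ?A" using c by (auto simp: frontier_def)
    then show "emeasure (return borel 0) (frontier ?A) = 0"
      by (simp add: emeasure_return)
  qed measurable
  have "(\<lambda>n. \<Sum>k\<in>UNIV. measure (distr (\<mu> n) borel (\<lambda>x. x $ k)) ?A) \<longlonglongrightarrow> (\<Sum>k\<in>(UNIV::'d set). 0)"
    using c coord by (intro tendsto_sum) (simp add: measure_return)
  then have upper: "(\<lambda>n. \<Sum>k\<in>(UNIV::'d set). measure (distr (\<mu> n) borel (\<lambda>x. x $ k)) ?A) \<longlonglongrightarrow> 0"
    by simp
  have bound: "measure (\<mu> n) {x. e < norm x} \<le> (\<Sum>k\<in>UNIV. measure (distr (\<mu> n) borel (\<lambda>x. x $ k)) ?A)" for n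
  proof -
    interpret prob_space "\<mu> n" by (rule p)
    have sub: "{x. e < norm x} \<subseteq> (\<Union>k\<in>UNIV. {x::real^'d. c < \<bar>x $ k\<bar>})"
    proof safe
      fix x :: "real^'d" assume x: "e < norm x"
      show "x \<in> (\<Union>k\<in>UNIV. {x. c < \<bar>x $ k\<bar>})"
      proof (rule ccontr)
        assume "\<not> ?thesis"
        then have "\<And>k. \<bar>x $ k\<bar> \<le> c" by (auto simp: not_less)
        then have "(\<Sum>k\<in>UNIV. \<bar>x $ k\<bar>) \<le> (\<Sum>k\<in>(UNIV::'d set). c)" by (intro sum_mono)
        then show False using x norm_le_l1_cart[of x] by (simp add: c_def)
      qed
    qed
    have "measure (\<mu> n) {x. e < norm x} \<le> measure (\<mu> n) (\<Union>k\<in>UNIV. {x. c < \<bar>x $ k\<bar>})"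
      by (rule finite_measure_mono[OF sub]) (auto simp: s)
    also have "\<dots> \<le> (\<Sum>k\<in>UNIV. measure (\<mu> n) {x. c < \<bar>x $ k\<bar>})"
      by (rule finite_measure_subadditive_finite) (auto simp: s)
    also have "\<dots> = (\<Sum>k\<in>UNIV. measure (distr (\<mu> n) borel (\<lambda>x. x $ k)) ?A)"
      by (intro sum.cong refl, subst measure_distr) (auto simp: sp vimage_def)
    finally show ?thesis .
  qed
  show ?thesis
    by (rule tendsto_sandwich[OF _ _ tendsto_const upper]) (auto intro!: always_eventually bound)
qed

section \<open>One-sided limits along the dyadic times\<close>

text \<open>If \<open>f\<close> keeps moving by more than \<open>e\<close> arbitrarily close to the right of \<open>t\<close>, pairs of times can be added in front of a chain indefinitely.\<close>

lemma right_oscillation_bounded: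
  assumes no: "\<not> oscillates (D \<inter> {a..b}) e f p a" and t: "a \<le> t" "t < (b::real)" and e: "0 \<le> e"
  shows "\<exists>\<delta>>0. \<forall>s\<in>D \<inter> {t<..<t+\<delta>}. \<forall>s'\<in>D \<inter> {t<..<t+\<delta>}. norm (f s - f s') \<le> e"
proof (rule ccontr)
  assume "\<not> ?thesis"
  then have far: "\<exists>s\<in>D \<inter> {t<..<t+\<delta>}. \<exists>s'\<in>D \<inter> {t<..<t+\<delta>}. e < norm (f s - f s')" if "\<delta> > 0" for \<delta>
    using that by (simp add: not_le)
  have pair: "\<exists>s s'. s \<in> D \<and> s' \<in> D \<and> t < s \<and> s < s' \<and> s' < u \<and> e < norm (f s' - f s)" if tu: "t < u" for u
  proof -
    obtain s s' where s: "s \<in> D \<inter> {t<..<u}" "s' \<in> D \<inter> {t<..<u}" "e < norm (f s - f s')"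
    proof -
      have "\<exists>s\<in>D \<inter> {t<..<u}. \<exists>s'\<in>D \<inter> {t<..<u}. e < norm (f s - f s')"
        using far[of "u - t"] tu by simp
      then show ?thesis by (elim bexE) (rule that)
    qed
    have "s \<noteq> s'" using s e by auto
    then consider "s < s'" | "s' < s" by linarith
    then show ?thesis
    proof cases
      case 1
      then show ?thesis using s norm_minus_commute[of "f s" "f s'"] by (intro exI[of _ s] exI[of _ s']) auto
    next
      case 2
      then show ?thesis using s by (intro exI[of _ s'] exI[of _ s]) auto
    qed
  qed
  have "\<exists>u>t. u \<le> b \<and> oscillates (D \<inter> {a..b}) e f p u" for p
  proof (induction p)
    case (Suc p)
    then obtain u where u: "t < u" "u \<le> b" "oscillates (D \<inter> {a..b}) e f p u" by blast
    obtain s s' where s: "s \<in> D" "s' \<in> D" "t < s" "s < s'" "s' < u" "e < norm (f s' - f s)" using pair[OF u(1)] by blast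
    have o: "oscillates (D \<inter> {a..b}) e f p s'" using oscillates_antimono[OF u(3)] s by simp
    have "oscillates (D \<inter> {a..b}) e f (Suc p) s"
      unfolding oscillates.simps by (rule bexI[of _ s], rule bexI[of _ s']) (use o s t u in auto)
    then show ?case using s u by (intro exI[of _ s]) auto
  qed (use t in auto)
  then obtain u where "t < u" "oscillates (D \<inter> {a..b}) e f p u" by blast
  then show False using no t oscillates_antimono[of "D \<inter> {a..b}" e f p u a] by simp
qed

text \<open>The mirror image: to the left of \<open>t\<close> there is always room for one more pair after any given time.\<close>

lemma left_oscillation_bounded:
  assumes no: "\<not> oscillates (D \<inter> {a..b}) e f p a" and t: "a < t" "t \<le> (b::real)" and e: "0 \<le> e"
  shows "\<exists>\<delta>>0. \<forall>s\<in>D \<inter> {t-\<delta><..<t}. \<forall>s'\<in>D \<inter> {t-\<delta><..<t}. norm (f s - f s') \<le> e"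
proof (rule ccontr)
  assume "\<not> ?thesis"
  then have far: "\<exists>s\<in>D \<inter> {t-\<delta><..<t}. \<exists>s'\<in>D \<inter> {t-\<delta><..<t}. e < norm (f s - f s')" if "\<delta> > 0" for \<delta>
    using that by (simp add: not_le)
  have pair: "\<exists>s s'. s \<in> D \<and> s' \<in> D \<and> u < s \<and> s < s' \<and> s' < t \<and> e < norm (f s' - f s)" if tu: "u < t" for u
  proof -
    obtain s s' where s: "s \<in> D \<inter> {u<..<t}" "s' \<in> D \<inter> {u<..<t}" "e < norm (f s - f s')"
    proof -
      have "\<exists>s\<in>D \<inter> {u<..<t}. \<exists>s'\<in>D \<inter> {u<..<t}. e < norm (f s - f s')"
        using far[of "t - u"] tu by simp
      then show ?thesis by (elim bexE) (rule that)
    qed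
    have "s \<noteq> s'" using s e by auto
    then consider "s < s'" | "s' < s" by linarith
    then show ?thesis
    proof cases
      case 1
      then show ?thesis using s norm_minus_commute[of "f s" "f s'"] by (intro exI[of _ s] exI[of _ s']) auto
    next
      case 2
      then show ?thesis using s by (intro exI[of _ s'] exI[of _ s]) auto
    qed
  qed
  have "oscillates (D \<inter> {a..b}) e f p u" if "a \<le> u" "u < t" for p u
    using that
  proof (induction p arbitrary: u)
    case (Suc p)
    obtain s s' where s: "s \<in> D" "s' \<in> D" "u < s" "s < s'" "s' < t" "e < norm (f s' - f s)"
      using pair[OF Suc.prems(2)] by blast
    have o: "oscillates (D \<inter> {a..b}) e f p s'" using Suc s by simp
    show ?case
      unfolding oscillates.simps by (rule bexI[of _ s], rule bexI[of _ s']) (use o s t Suc.prems in auto)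
  qed simp
  then show False using no t by auto
qed

lemma tendsto_within_if_Cauchy:
  fixes f :: "real \<Rightarrow> 'b::complete_space"
  assumes nt: "at t within S \<noteq> bot"
    and c: "\<And>e. e > 0 \<Longrightarrow> \<exists>\<delta>>0. \<forall>s\<in>S. \<forall>s'\<in>S. dist s t < \<delta> \<longrightarrow> dist s' t < \<delta> \<longrightarrow> s \<noteq> t \<longrightarrow> s' \<noteq> t \<longrightarrow> dist (f s) (f s') \<le> e"
  shows "\<exists>l. (f \<longlongrightarrow> l) (at t within S)"
proof -
  have "cauchy_filter (filtermap f (at t within S))"
    unfolding cauchy_filter_metric_filtermap
  proof (intro allI impI)
    fix e :: real assume "e > 0"
    then obtain \<delta> where \<delta>: "\<delta> > 0" "\<forall>s\<in>S. \<forall>s'\<in>S. dist s t < \<delta> \<longrightarrow> dist s' t < \<delta> \<longrightarrow> s \<noteq> t \<longrightarrow> s' \<noteq> t \<longrightarrow> dist (f s) (f s') \<le> e / 2"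
      using c[of "e/2"] by auto
    show "\<exists>P. eventually P (at t within S) \<and> (\<forall>x y. P x \<and> P y \<longrightarrow> dist (f x) (f y) < e)"
    proof (intro exI conjI)
      show "eventually (\<lambda>s. s \<in> S \<and> s \<noteq> t \<and> dist s t < \<delta>) (at t within S)"
        using \<delta>(1) by (auto simp: eventually_at)
      have "dist (f x) (f y) < e" if "x \<in> S \<and> x \<noteq> t \<and> dist x t < \<delta>" "y \<in> S \<and> y \<noteq> t \<and> dist y t < \<delta>" for x y
        using \<delta>(2)[rule_format, of x y] that \<open>e > 0\<close> by auto
      then show "\<forall>x y. (x \<in> S \<and> x \<noteq> t \<and> dist x t < \<delta>) \<and> (y \<in> S \<and> y \<noteq> t \<and> dist y t < \<delta>) \<longrightarrow> dist (f x) (f y) < e"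
        by blast
    qed
  qed
  moreover have "filtermap f (at t within S) \<noteq> bot" using nt by (simp add: filtermap_bot_iff)
  ultimately obtain l where "filtermap f (at t within S) \<le> nhds l"
    using complete_uniform[of "UNIV :: 'b set"] complete_UNIV by (auto simp: )
  then show ?thesis by (auto simp: filterlim_def)
qed

text \<open>For \<open>t \<ge> 0\<close>, the least element of \<open>grid n\<close> strictly above \<open>t\<close>. Strictness makes the sequence approach \<open>t\<close> from the right even when \<open>t\<close> is dyadic.\<close>

definition dyadic_above :: "nat \<Rightarrow> real \<Rightarrow> real" where
  "dyadic_above n t = real (nat \<lfloor>t * 2 ^ n\<rfloor> + 1) / 2 ^ n"

lemma dyadic_above_grid: "dyadic_above n t \<in> grid n"
  unfolding dyadic_above_def grid_def by (rule rangeI)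

lemma dyadic_above_times: "dyadic_above n t \<in> dyadic_times"
  using dyadic_above_grid grid_subset_dyadic_times by blast

lemma dyadic_above_mono: "s \<le> t \<Longrightarrow> dyadic_above n s \<le> dyadic_above n t"
  unfolding dyadic_above_def
  by (intro divide_right_mono of_nat_mono add_right_mono nat_mono floor_mono mult_right_mono) auto

lemma dyadic_above_bounds:
  assumes "0 \<le> t"
  shows "t < dyadic_above n t" "dyadic_above n t \<le> t + 1 / 2 ^ n"
proof -
  have "0 \<le> \<lfloor>t * 2 ^ n\<rfloor>" using assms by simp
  then have r: "real (nat \<lfloor>t * 2 ^ n\<rfloor> + 1) = real_of_int \<lfloor>t * 2 ^ n\<rfloor> + 1" by simp
  show "t < dyadic_above n t" unfolding dyadic_above_def r by (simp add: field_simps) linarith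
  show "dyadic_above n t \<le> t + 1 / 2 ^ n" unfolding dyadic_above_def r by (simp add: field_simps)
qed

lemma LIMSEQ_inverse_pow2: "(\<lambda>n. 1 / 2 ^ n :: real) \<longlonglongrightarrow> 0"
  using LIMSEQ_realpow_zero[of "1/2::real"] by (simp add: power_one_over)

lemma dyadic_above_tendsto:
  assumes "0 \<le> t"
  shows "(\<lambda>n. dyadic_above n t) \<longlonglongrightarrow> t"
proof (rule tendsto_sandwich[of "\<lambda>_. t" _ _ "\<lambda>n. t + 1 / 2 ^ n"])
  show "(\<lambda>n. t + 1 / 2 ^ n) \<longlonglongrightarrow> t"
    using tendsto_add[OF tendsto_const LIMSEQ_inverse_pow2, of t] by simp
qed (use dyadic_above_bounds[OF assms] in \<open>auto intro!: always_eventually less_imp_le\<close>)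

lemma filterlim_dyadic_above:
  assumes "0 \<le> t"
  shows "filterlim (\<lambda>n. dyadic_above n t) (at t within (dyadic_times \<inter> {t<..})) sequentially"
  unfolding filterlim_at
  using dyadic_above_tendsto[OF assms] dyadic_above_bounds(1)[OF assms] dyadic_above_times
  by (auto intro!: always_eventually simp: less_imp_neq[THEN not_sym])

lemma dyadic_right_dense:
  assumes "0 \<le> t"
  shows "at t within (dyadic_times \<inter> {t<..}) \<noteq> bot"
proof
  assume "at t within (dyadic_times \<inter> {t<..}) = bot"
  then have "eventually (\<lambda>_. False) (at t within (dyadic_times \<inter> {t<..}))" by simp
  from filterlim_dyadic_above[OF assms, unfolded filterlim_iff, rule_format, OF this]
  show False by simp
qed

lemma dyadic_left_dense:
  assumes "0 < t"
  shows "at t within (dyadic_times \<inter> {..<t}) \<noteq> bot"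
proof
  assume "at t within (dyadic_times \<inter> {..<t}) = bot"
  then have "eventually (\<lambda>_. False) (at t within (dyadic_times \<inter> {..<t}))" by simp
  then obtain d where d: "d > 0" "\<And>x. x \<in> dyadic_times \<Longrightarrow> x < t \<Longrightarrow> \<not> dist x t < d"
    by (auto simp: eventually_at)
  define u where "u = max 0 (t - d)"
  have u: "0 \<le> u" "u < t" using d(1) assms by (auto simp: u_def)
  have "eventually (\<lambda>n. dyadic_above n u < t) sequentially"
    by (rule order_tendstoD(2)[OF dyadic_above_tendsto]) (use u in auto)
  then obtain n where n: "dyadic_above n u < t" by (auto simp: eventually_sequentially)
  have "dist (dyadic_above n u) t < d"
    using n dyadic_above_bounds(1)[OF u(1), of n] by (auto simp: dist_real_def u_def)
  then show False using d(2)[OF dyadic_above_times n] by simp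
qed

definition right_limit :: "(real \<Rightarrow> real^'d) \<Rightarrow> real \<Rightarrow> real^'d" where
  "right_limit f t = Lim (at t within (dyadic_times \<inter> {t<..})) f"

text \<open>The Cauchy criterion for one-sided limits along the dyadic times.\<close>

definition regulated :: "(real \<Rightarrow> real^'d) \<Rightarrow> bool" where
  "regulated f \<longleftrightarrow> 
    (\<forall>t\<ge>0. \<forall>e>0. \<exists>\<delta>>0. \<forall>s\<in>dyadic_times \<inter> {t<..<t+\<delta>}. \<forall>s'\<in>dyadic_times \<inter> {t<..<t+\<delta>}. norm (f s - f s') \<le> e) \<and>
    (\<forall>t>0. \<forall>e>0. \<exists>\<delta>>0. \<forall>s\<in>dyadic_times \<inter> {t-\<delta><..<t}. \<forall>s'\<in>dyadic_times \<inter> {t-\<delta><..<t}. norm (f s - f s') \<le> e)"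

lemma regulated_right_limit:
  assumes f: "regulated f" and t: "0 \<le> t"
  shows "(f \<longlongrightarrow> right_limit f t) (at t within (dyadic_times \<inter> {t<..}))"
proof -
  have "\<exists>l. (f \<longlongrightarrow> l) (at t within (dyadic_times \<inter> {t<..}))"
  proof (rule tendsto_within_if_Cauchy[OF dyadic_right_dense[OF t]])
    fix e :: real assume "e > 0"
    then obtain \<delta> where "\<delta> > 0" "\<forall>s\<in>dyadic_times \<inter> {t<..<t+\<delta>}. \<forall>s'\<in>dyadic_times \<inter> {t<..<t+\<delta>}. norm (f s - f s') \<le> e"
      using f t unfolding regulated_def by blast
    then show "\<exists>\<delta>>0. \<forall>s\<in>dyadic_times \<inter> {t<..}. \<forall>s'\<in>dyadic_times \<inter> {t<..}. dist s t < \<delta> \<longrightarrow> dist s' t < \<delta> \<longrightarrow> s \<noteq> t \<longrightarrow> s' \<noteq> t \<longrightarrow> dist (f s) (f s') \<le> e"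
      by (intro exI[of _ \<delta>]) (auto simp: dist_norm)
  qed
  then obtain l where l: "(f \<longlongrightarrow> l) (at t within (dyadic_times \<inter> {t<..}))" by blast
  then have "right_limit f t = l" unfolding right_limit_def by (rule tendsto_Lim[OF dyadic_right_dense[OF t]])
  with l show ?thesis by simp
qed

lemma regulated_left_limit:
  assumes f: "regulated f" and t: "0 < t"
  shows "\<exists>l. (f \<longlongrightarrow> l) (at t within (dyadic_times \<inter> {..<t}))"
proof (rule tendsto_within_if_Cauchy[OF dyadic_left_dense[OF t]])
  fix e :: real assume "e > 0"
  then obtain \<delta> where "\<delta> > 0" "\<forall>s\<in>dyadic_times \<inter> {t-\<delta><..<t}. \<forall>s'\<in>dyadic_times \<inter> {t-\<delta><..<t}. norm (f s - f s') \<le> e"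
    using f t unfolding regulated_def by blast
  then show "\<exists>\<delta>>0. \<forall>s\<in>dyadic_times \<inter> {..<t}. \<forall>s'\<in>dyadic_times \<inter> {..<t}. dist s t < \<delta> \<longrightarrow> dist s' t < \<delta> \<longrightarrow> s \<noteq> t \<longrightarrow> s' \<noteq> t \<longrightarrow> dist (f s) (f s') \<le> e"
    by (intro exI[of _ \<delta>]) (auto simp: dist_norm)
qed

lemma right_limit_sequentially:
  assumes "regulated f" "0 \<le> t"
  shows "(\<lambda>n. f (dyadic_above n t)) \<longlonglongrightarrow> right_limit f t"
  by (rule filterlim_compose[OF regulated_right_limit filterlim_dyadic_above]) fact+

lemma right_limit_near:
  assumes f: "regulated f" and u: "0 \<le> u" and uv: "u < v"
    and near: "\<And>s. s \<in> dyadic_times \<Longrightarrow> u < s \<Longrightarrow> s < v \<Longrightarrow> dist (f s) l \<le> e"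
  shows "dist (right_limit f u) l \<le> e"
proof (rule tendsto_upperbound[of "\<lambda>n. dist (f (dyadic_above n u)) l"])
  show "(\<lambda>n. dist (f (dyadic_above n u)) l) \<longlonglongrightarrow> dist (right_limit f u) l"
    by (intro tendsto_intros right_limit_sequentially f u)
  have "eventually (\<lambda>n. dyadic_above n u < v) sequentially"
    by (rule order_tendstoD(2)[OF dyadic_above_tendsto[OF u] uv])
  then show "eventually (\<lambda>n. dist (f (dyadic_above n u)) l \<le> e) sequentially"
    by eventually_elim (use dyadic_above_bounds[OF u] dyadic_above_times near in auto)
qed simp

text \<open>Values of the right limit near \<open>t\<close> are limits of values of \<open>f\<close> at dyadic times near \<open>t\<close> and on the same side; the estimates for \<open>f\<close> pass to the limit.\<close>

lemma cadlag_right_limit: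
  assumes f: "regulated f"
  shows "cadlag (right_limit f)"
  unfolding cadlag_def
proof (intro conjI allI impI)
  fix t :: real assume t: "0 \<le> t"
  show "(right_limit f \<longlongrightarrow> right_limit f t) (at_right t)"
  proof (rule tendstoI)
    fix e :: real assume e: "e > 0"
    have "eventually (\<lambda>s. dist (f s) (right_limit f t) < e/2) (at t within (dyadic_times \<inter> {t<..}))"
      by (rule tendstoD[OF regulated_right_limit[OF f t]]) (use e in simp)
    then obtain d where d: "d > 0" "\<And>s. s \<in> dyadic_times \<Longrightarrow> t < s \<Longrightarrow> dist s t < d \<Longrightarrow> dist (f s) (right_limit f t) < e/2"
      by (auto simp: eventually_at)
    have "dist (right_limit f u) (right_limit f t) < e" if u: "t < u" "u < t + d" for u
    proof -
      have "dist (right_limit f u) (right_limit f t) \<le> e/2"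
        by (rule right_limit_near[OF f _ u(2)]) (use u t d(2) in \<open>auto simp: dist_real_def intro!: less_imp_le\<close>)
      then show ?thesis using e by simp
    qed
    then show "eventually (\<lambda>u. dist (right_limit f u) (right_limit f t) < e) (at_right t)"
      unfolding eventually_at_right_field using d(1) by (intro exI[of _ "t + d"]) auto
  qed
next
  fix t :: real assume t: "0 < t"
  obtain l where l: "(f \<longlongrightarrow> l) (at t within (dyadic_times \<inter> {..<t}))" using regulated_left_limit[OF f t] by blast
  show "\<exists>l. (right_limit f \<longlongrightarrow> l) (at_left t)"
  proof (intro exI tendstoI)
    fix e :: real assume e: "e > 0"
    have "eventually (\<lambda>s. dist (f s) l < e/2) (at t within (dyadic_times \<inter> {..<t}))"
      by (rule tendstoD[OF l]) (use e in simp)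
    then obtain d where d: "d > 0" "\<And>s. s \<in> dyadic_times \<Longrightarrow> s < t \<Longrightarrow> dist s t < d \<Longrightarrow> dist (f s) l < e/2"
      by (auto simp: eventually_at)
    have "dist (right_limit f u) l < e" if u: "max 0 (t - d) < u" "u < t" for u
    proof -
      have "dist (right_limit f u) l \<le> e/2"
        by (rule right_limit_near[OF f _ u(2)]) (use u t d(2) in \<open>auto simp: dist_real_def intro!: less_imp_le\<close>)
      then show ?thesis using e by simp
    qed
    then show "eventually (\<lambda>u. dist (right_limit f u) l < e) (at_left t)"
      unfolding eventually_at_left_field using d(1) t by (intro exI[of _ "max 0 (t - d)"]) auto
  qed
qed

section \<open>Existence of Levy processes\<close>

lemma (in prob_space) indep_vars_reindex:
  fixes X :: "'i \<Rightarrow> 'a \<Rightarrow> 'b::topological_space"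
  assumes ind: "indep_vars (\<lambda>_. borel) X J" and f: "inj_on f I" "f ` I \<subseteq> J"
  shows "indep_vars (\<lambda>_. borel) (\<lambda>i. X (f i)) I"
proof -
  have "indep_vars (\<lambda>i. PiM {f i} (\<lambda>_. borel)) (\<lambda>i w. restrict (\<lambda>j. X j w) {f i}) I"
    by (rule indep_vars_restrict[OF ind]) (use f in \<open>auto simp: disjoint_family_on_def inj_on_def\<close>)
  then have "indep_vars (\<lambda>_. borel) (\<lambda>i w. (\<lambda>y. y (f i)) (restrict (\<lambda>j. X j w) {f i})) I"
    by (rule indep_vars_compose2) measurable
  then show ?thesis by simp
qed

lemma (in prob_space) indep_vars_block_sums:
  fixes \<xi> :: "nat \<Rightarrow> 'a \<Rightarrow> real^'d"
  assumes ind: "indep_vars (\<lambda>_. borel) \<xi> {..<N}"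
    and b: "\<And>i. i < n \<Longrightarrow> b i \<le> b (Suc i)" "b n \<le> N"
  shows "indep_vars (\<lambda>_. borel) (\<lambda>i w. \<Sum>l\<in>{b i..<b (Suc i)}. \<xi> l w) {..<n}"
proof -
  have mono: "b i \<le> b j" if "i \<le> j" "j \<le> n" for i j
    using that
  proof (induction j rule: dec_induct)
    case (step k)
    then show ?case using b(1)[of k] by simp
  qed simp
  have disj: "{b i..<b (Suc i)} \<inter> {b j..<b (Suc j)} = {}" if "i < j" "j < n" for i j
    using mono[of "Suc i" j] that by auto
  have "indep_vars (\<lambda>i. PiM {b i..<b (Suc i)} (\<lambda>_. borel)) (\<lambda>i w. restrict (\<lambda>l. \<xi> l w) {b i..<b (Suc i)}) {..<n}"
  proof (rule indep_vars_restrict[OF ind])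
    show "{b j..<b (Suc j)} \<subseteq> {..<N}" if "j \<in> {..<n}" for j
      using mono[of "Suc j" n] that b(2) by auto
    show "disjoint_family_on (\<lambda>i. {b i..<b (Suc i)}) {..<n}"
      unfolding disjoint_family_on_def
    proof (intro ballI impI)
      fix i j assume "i \<in> {..<n}" "j \<in> {..<n}" "i \<noteq> j"
      then show "{b i..<b (Suc i)} \<inter> {b j..<b (Suc j)} = {}"
        using disj[of i j] disj[of j i] by (cases i j rule: linorder_cases) auto
    qed
  qed
  then have "indep_vars (\<lambda>_. borel) (\<lambda>i w. (\<lambda>y. \<Sum>l\<in>{b i..<b (Suc i)}. y l) (restrict (\<lambda>l. \<xi> l w) {b i..<b (Suc i)})) {..<n}"
    by (rule indep_vars_compose2) (intro borel_measurable_sum measurable_component_singleton)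
  then show ?thesis by simp
qed

lemma cadlag_diff_const:
  assumes "cadlag f"
  shows "cadlag (\<lambda>t. f t - c)"
  unfolding cadlag_def
proof (intro conjI allI impI)
  fix t :: real assume "0 \<le> t"
  then have "(f \<longlongrightarrow> f t) (at_right t)" using assms by (simp add: cadlag_def)
  then show "((\<lambda>t. f t - c) \<longlongrightarrow> f t - c) (at_right t)" by (rule tendsto_diff[OF _ tendsto_const])
next
  fix t :: real assume "0 < t"
  then obtain l where "(f \<longlongrightarrow> l) (at_left t)" using assms by (auto simp: cadlag_def)
  then have "((\<lambda>t. f t - c) \<longlongrightarrow> l - c) (at_left t)" by (rule tendsto_diff[OF _ tendsto_const])
  then show "\<exists>l. ((\<lambda>t. f t - c) \<longlongrightarrow> l) (at_left t)" ..
qed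

text \<open>A process with the increments of a Levy process, but controlled at dyadic times only. Such a process has a version with cadlag paths at all times.\<close>

locale dyadic_levy = prob_space M for M :: "'w measure" +
  fixes X :: "real \<Rightarrow> 'w \<Rightarrow> real^'d" and \<Phi> :: "real^'d \<Rightarrow> complex"
  assumes X_measurable: "\<And>t. t \<in> dyadic_times \<Longrightarrow> X t \<in> borel_measurable M"
    and X_indep: "\<And>k N. indep_vars (\<lambda>_. borel) (\<lambda>i \<omega>. X (real (Suc i) / 2 ^ k) \<omega> - X (real i / 2 ^ k) \<omega>) {..<N}"
    and X_char: "\<And>k i y. (CLINT w|M. iexp (y \<bullet> (X (real (Suc i) / 2 ^ k) w - X (real i / 2 ^ k) w))) = exp (\<Phi> y / 2 ^ k)"
begin

lemma X_telescope: "i \<le> j \<Longrightarrow>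
   (\<Sum>l\<in>{i..<j}. X (real (Suc l) / 2 ^ k) w - X (real l / 2 ^ k) w) = X (real j / 2 ^ k) w - X (real i / 2 ^ k) w"
  using sum_Suc_diff'[of i j "\<lambda>l. X (real l / 2 ^ k) w"] by simp

lemma X_increment_char:
  assumes "s \<in> dyadic_times" "t \<in> dyadic_times" "s \<le> t"
  shows "(CLINT w|M. iexp (y \<bullet> (X t w - X s w))) = exp (of_real (t - s) * \<Phi> y)"
proof -
  obtain k where "{s, t} \<subseteq> grid k" using finite_subset_grid[of "{s,t}"] assms by auto
  then obtain i j :: nat where ij: "s = real i / 2 ^ k" "t = real j / 2 ^ k" by (auto simp: grid_def)
  have le: "i \<le> j" using assms(3) by (simp add: ij divide_le_cancel)
  have "(CLINT w|M. iexp (y \<bullet> (X t w - X s w))) =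
    (CLINT w|M. iexp (\<Sum>l\<in>{i..<j}. y \<bullet> (X (real (Suc l) / 2 ^ k) w - X (real l / 2 ^ k) w)))"
    unfolding ij X_telescope[OF le, symmetric] inner_sum_right ..
  also have "\<dots> = (\<Prod>l\<in>{i..<j}. CLINT w|M. iexp (y \<bullet> (X (real (Suc l) / 2 ^ k) w - X (real l / 2 ^ k) w)))"
    by (rule charf_sum_indep, simp, rule indep_vars_subset[OF X_indep[of k j]]) auto
  also have "\<dots> = exp (\<Phi> y / 2 ^ k) ^ (j - i)" by (simp only: X_char prod_constant card_atLeastLessThan)
  also have "\<dots> = exp (of_nat (j - i) * (\<Phi> y / 2 ^ k))" by (rule exp_of_nat_mult[symmetric])
  also have "of_nat (j - i) * (\<Phi> y / 2 ^ k) = of_real (t - s) * \<Phi> y"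
    using le by (simp add: ij of_nat_diff field_simps)
  finally show ?thesis .
qed

text \<open>Continuity in probability, uniform in the starting time.\<close>

lemma X_increment_small:
  assumes e: "0 < e" and \<alpha>: "0 < \<alpha>"
  shows "\<exists>m. \<forall>s\<in>dyadic_times. \<forall>t\<in>dyadic_times. s \<le> t \<longrightarrow> t \<le> s + 1 / 2 ^ m \<longrightarrow>
    prob {w \<in> space M. e < norm (X t w - X s w)} \<le> \<alpha>"
proof (rule ccontr)
  assume "\<not> ?thesis"
  \<comment> \<open>Otherwise choose, for every \<open>m\<close>, a bad pair at distance at most \<open>2\<^sup>-\<^sup>m\<close>; the laws of these increments converge to the unit mass at 0.\<close>
  then have "\<forall>m. \<exists>p. fst p \<in> dyadic_times \<and> snd p \<in> dyadic_times \<and> fst p \<le> snd p \<and> snd p \<le> fst p + 1 / 2 ^ m \<and>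
     \<alpha> < prob {w \<in> space M. e < norm (X (snd p) w - X (fst p) w)}"
    by (simp add: not_le) meson
  from choice[OF this] obtain p where p: "\<forall>m. fst (p m) \<in> dyadic_times \<and> snd (p m) \<in> dyadic_times \<and>
     fst (p m) \<le> snd (p m) \<and> snd (p m) \<le> fst (p m) + 1 / 2 ^ m \<and>
     \<alpha> < prob {w \<in> space M. e < norm (X (snd (p m)) w - X (fst (p m)) w)}" ..
  define s t where "s m = fst (p m)" and "t m = snd (p m)" for m
  have st: "s m \<in> dyadic_times" "t m \<in> dyadic_times" "s m \<le> t m" "t m \<le> s m + 1 / 2 ^ m"
     "\<alpha> < prob {w \<in> space M. e < norm (X (t m) w - X (s m) w)}" for m
    using p unfolding s_def t_def by blast+
  note [measurable] = X_measurable[OF st(1)] X_measurable[OF st(2)]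
  define \<mu> where "\<mu> m = distr M borel (\<lambda>w. X (t m) w - X (s m) w)" for m
  have "(\<lambda>m. t m - s m) \<longlonglongrightarrow> 0"
    by (rule tendsto_sandwich[OF _ _ tendsto_const LIMSEQ_inverse_pow2])
       (use st(3,4) in \<open>auto intro!: always_eventually simp: algebra_simps\<close>)
  then have lim: "(\<lambda>m. exp (of_real (t m - s m) * \<Phi> y)) \<longlonglongrightarrow> exp (of_real 0 * \<Phi> y)" for y
    by (intro tendsto_intros)
  have ch: "charf (\<mu> m) y = exp (of_real (t m - s m) * \<Phi> y)" for m y
    unfolding \<mu>_def by (subst charf_distr) (auto simp: X_increment_char st)
  have "(\<lambda>m. measure (\<mu> m) {x. e < norm x}) \<longlonglongrightarrow> 0"
  proof (rule charf_tendsto_1_imp_concentrated[OF _ _ e])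
    show "borel_probability (\<mu> n)" for n
      unfolding \<mu>_def by (rule borel_probability_distr[OF prob_space_axioms]) measurable
    show "(\<lambda>n. charf (\<mu> n) y) \<longlonglongrightarrow> 1" for y using lim[of y] by (simp add: ch)
  qed
  then have "eventually (\<lambda>m. measure (\<mu> m) {x. e < norm x} < \<alpha>) sequentially"
    by (rule order_tendstoD(2)) fact
  then obtain m where m: "measure (\<mu> m) {x. e < norm x} < \<alpha>" by (auto simp: eventually_sequentially)
  moreover have "measure (\<mu> m) {x. e < norm x} = prob {w \<in> space M. e < norm (X (t m) w - X (s m) w)}"
    unfolding \<mu>_def by (subst measure_distr) (auto simp: vimage_def Int_def conj_commute)
  ultimately show False using st(5)[of m] by simp
qed

text \<open>The number 3 is chosen so that \<open>(1/3) / (1 - 1/3) = 1/2 < 1\<close>. The bound is the same for all levels \<open>m + k\<close>.\<close>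

lemma block_oscillation_prob:
  fixes i m k p :: nat
  assumes small: "\<forall>s\<in>dyadic_times. \<forall>t\<in>dyadic_times. s \<le> t \<longrightarrow> t \<le> s + 1 / 2 ^ m \<longrightarrow>
      prob {w \<in> space M. e < norm (X t w - X s w)} \<le> 1/3"
  defines "I \<equiv> {real i / 2 ^ m..real (Suc i) / 2 ^ m}"
  shows "prob {w \<in> space M. oscillates (grid (m + k) \<inter> I) (4 * e) (\<lambda>t. X t w) p (real i / 2 ^ m)} \<le> (1/2) ^ p"
proof -
  define b where "b = i * 2 ^ k"
  define N where "N = (2::nat) ^ k"
  define g where "g l = real (b + l) / 2 ^ (m + k)" for l
  define \<xi> where "\<xi> l w = X (g (Suc l)) w - X (g l) w" for l w
  have g: "strict_mono g" by (auto simp: g_def strict_mono_def divide_strict_right_mono)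
  have gd: "g l \<in> dyadic_times" for l
    unfolding g_def by (rule subsetD[OF grid_subset_dyadic_times[of "m + k"]]) (unfold grid_def, rule rangeI)
  have g0: "g 0 = real i / 2 ^ m" by (simp add: g_def b_def power_add)
  have gN: "g N = real (Suc i) / 2 ^ m" 
  proof -
    have "real (b + N) = real (Suc i) * 2 ^ k" by (simp add: b_def N_def algebra_simps)
    then show ?thesis unfolding g_def by (simp add: power_add)
  qed
  have img: "grid (m + k) \<inter> I = g ` {..N}"
  proof (intro equalityI subsetI)
    fix t assume "t \<in> grid (m + k) \<inter> I"
    then obtain l :: nat where l: "t = real l / 2 ^ (m + k)" "g 0 \<le> t" "t \<le> g N"
      by (auto simp: grid_def I_def g0 gN)
    then have "b \<le> l" "l \<le> b + N" by (auto simp: g_def divide_le_cancel simp del: of_nat_add)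
    then have "t = g (l - b)" "l - b \<in> {..N}" using l by (auto simp: g_def)
    then show "t \<in> g ` {..N}" by blast
  next
    fix t assume "t \<in> g ` {..N}"
    then obtain l where l: "t = g l" "l \<le> N" by auto
    then have "g 0 \<le> t" "t \<le> g N" using strict_mono_less_eq[OF g] by auto
    moreover have "t \<in> grid (m + k)" unfolding l g_def grid_def by (rule rangeI)
    ultimately show "t \<in> grid (m + k) \<inter> I" by (auto simp: I_def g0 gN)
  qed
  have tel: "(\<Sum>l\<in>{u..<v}. \<xi> l w) = X (g v) w - X (g u) w" if "u \<le> v" for u v w
    unfolding \<xi>_def using sum_Suc_diff'[OF that, of "\<lambda>l. X (g l) w"] by simp
  have ind: "indep_vars (\<lambda>_. borel) \<xi> {..<N}"
  proof -
    have "indep_vars (\<lambda>_. borel) (\<lambda>l. (\<lambda>i \<omega>. X (real (Suc i) / 2 ^ (m + k)) \<omega> - X (real i / 2 ^ (m + k)) \<omega>) (b + l)) {..<N}"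
      by (rule indep_vars_reindex[OF X_indep[of "m + k" "b + N"]]) auto
    then show ?thesis unfolding \<xi>_def[abs_def] g_def by simp
  qed
  \<comment> \<open>At level \<open>m + k\<close> the block contains \<open>2\<^sup>k + 1\<close> times, and the process on them is a random walk.\<close>
  have osc: "oscillates (grid (m + k) \<inter> I) (4 * e) (\<lambda>t. X t w) p (real i / 2 ^ m) \<longleftrightarrow>
     oscillates {..N} (4 * e) (\<lambda>j. \<Sum>l<j. \<xi> l w) p 0" for w
    unfolding img g0[symmetric] oscillates_image[OF g]
    by (rule oscillates_cong) (simp add: tel lessThan_atLeast0)
  have "prob {w \<in> space M. oscillates {..N} (4 * e) (\<lambda>j. \<Sum>l<j. \<xi> l w) p 0} \<le> ((1/3) / (1 - 1/3)) ^ p"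
  proof (rule oscillates_prob[OF ind])
    fix u v assume uv: "u \<le> v" "v \<le> N"
    have "g u \<le> g v" "g v \<le> g N" "g 0 \<le> g u" using uv strict_mono_less_eq[OF g] by auto
    moreover have "g N = g 0 + 1 / 2 ^ m" by (simp add: g0 gN add_divide_distrib)
    ultimately show "prob {w \<in> space M. e < norm (\<Sum>l = u..<v. \<xi> l w)} \<le> 1/3"
      unfolding tel[OF uv(1)] using small gd by auto
  qed auto
  then show ?thesis unfolding osc by simp
qed

lemma countable_dyadic_times: "countable dyadic_times"
  by (auto simp: dyadic_times_def grid_def)

text \<open>On the \<open>i\<close>-th block of length \<open>2\<^sup>-\<^sup>m\<close> the path oscillates by more than \<open>e\<close> only a bounded number of times.\<close>

definition calm :: "real \<Rightarrow> nat \<Rightarrow> nat \<Rightarrow> 'w \<Rightarrow> bool" where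
  "calm e m i w \<longleftrightarrow> (\<exists>p. \<not> oscillates (dyadic_times \<inter> {real i / 2 ^ m..real (Suc i) / 2 ^ m}) e (\<lambda>t. X t w) p (real i / 2 ^ m))"

lemma pred_calm[measurable]: "Measurable.pred M (calm e m i)"
proof -
  have [measurable]: "Measurable.pred M (\<lambda>w. oscillates (dyadic_times \<inter> {real i / 2 ^ m..real (Suc i) / 2 ^ m}) e (\<lambda>t. X t w) p (real i / 2 ^ m))" for p
    by (rule pred_oscillates) (auto intro: countable_subset[OF _ countable_dyadic_times] X_measurable)
  show ?thesis unfolding calm_def[abs_def] by measurable
qed

text \<open>The event of at least \<open>p\<close> oscillations is an increasing union over the levels, so it inherits the bound \<open>2\<^sup>-\<^sup>p\<close>; let \<open>p\<close> tend to infinity.\<close>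

lemma AE_calm:
  assumes e: "0 < e"
  shows "\<exists>m. \<forall>i. AE w in M. calm e m i w"
proof -
  obtain m where m: "\<forall>s\<in>dyadic_times. \<forall>t\<in>dyadic_times. s \<le> t \<longrightarrow> t \<le> s + 1 / 2 ^ m \<longrightarrow>
      prob {w \<in> space M. e / 4 < norm (X t w - X s w)} \<le> 1/3"
    using X_increment_small[of "e/4" "1/3"] e by auto
  have "AE w in M. calm e m i w" for i
  proof -
    define I where "I = {real i / 2 ^ m..real (Suc i) / 2 ^ m}"
    define E where "E p k = {w \<in> space M. oscillates (grid (m + k) \<inter> I) e (\<lambda>t. X t w) p (real i / 2 ^ m)}" for p k
    define F where "F p = {w \<in> space M. oscillates (dyadic_times \<inter> I) e (\<lambda>t. X t w) p (real i / 2 ^ m)}" for p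
    have mE: "E p k \<in> events" for p k
    proof -
      have "countable (grid (m + k) \<inter> I)" by (auto simp: grid_def)
      then have "Measurable.pred M (\<lambda>w. oscillates (grid (m + k) \<inter> I) e (\<lambda>t. X t w) p (real i / 2 ^ m))"
        by (rule pred_oscillates) (use grid_subset_dyadic_times in \<open>auto intro: X_measurable\<close>)
      then show ?thesis by (simp add: E_def pred_def)
    qed
    have E: "prob (E p k) \<le> (1/2) ^ p" for p k
      using block_oscillation_prob[of m "e/4" k i p] m by (simp add: E_def I_def)
    have inc: "incseq (\<lambda>k. grid (m + k) \<inter> I)"
      using grid_mono by (intro incseq_SucI Int_mono) auto
    have un: "(\<Union>k. grid (m + k) \<inter> I) = dyadic_times \<inter> I"
    proof -
      have "grid k \<subseteq> grid (m + k)" for k by (rule grid_mono) simp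
      then show ?thesis by (fastforce simp: dyadic_times_def)
    qed
    \<comment> \<open>A chain of oscillations uses finitely many dyadic times, hence lives on one grid.\<close>
    have FE: "F p = (\<Union>k. E p k)" for p
    proof
      show "F p \<subseteq> (\<Union>k. E p k)"
      proof
        fix w assume w: "w \<in> F p"
        then have "\<exists>k. oscillates (grid (m + k) \<inter> I) e (\<lambda>t. X t w) p (real i / 2 ^ m)"
          by (intro oscillates_Union[OF inc]) (simp only: un F_def mem_Collect_eq)
        then show "w \<in> (\<Union>k. E p k)" using w by (auto simp: E_def F_def)
      qed
      show "(\<Union>k. E p k) \<subseteq> F p"
        using oscillates_mono[where T="dyadic_times \<inter> I"] grid_subset_dyadic_times
        by (fastforce simp: E_def F_def)
    qed
    have mF: "F p \<in> events" for p using mE by (auto simp: FE)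
    have F: "prob (F p) \<le> (1/2) ^ p" for p
    proof (rule LIMSEQ_le_const2)
      have "incseq (E p)"
      proof (rule incseq_SucI)
        fix k show "E p k \<subseteq> E p (Suc k)"
          using oscillates_mono[of "grid (m + k) \<inter> I" _ _ _ _ "grid (m + Suc k) \<inter> I"] incseq_SucD[OF inc, of k]
          by (auto simp: E_def)
      qed
      then show "(\<lambda>k. prob (E p k)) \<longlonglongrightarrow> prob (F p)"
        unfolding FE using mE by (intro finite_Lim_measure_incseq) auto
    qed (use E in auto)
    have "prob (\<Inter>p. F p) \<le> (1/2) ^ p" for p
      by (rule order_trans[OF finite_measure_mono F[of p]]) (use mF in auto)
    then have "prob (\<Inter>p. F p) \<le> 0"
      by (intro LIMSEQ_le_const[OF LIMSEQ_realpow_zero[of "1/2::real"]]) auto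
    then have "prob (\<Inter>p. F p) = 0" by (simp add: measure_le_0_iff)
    then have "(\<Inter>p. F p) \<in> null_sets M"
      using mF by (auto simp: null_sets_def emeasure_eq_measure)
    then show ?thesis
      by (rule AE_I') (auto simp: F_def calm_def I_def)
  qed
  then show ?thesis by blast
qed

text \<open>A level whose blocks are short enough for oscillations of size \<open>1 / (n + 1)\<close>.\<close>

definition mesh :: "nat \<Rightarrow> nat" where
  "mesh n = (SOME m. \<forall>i. AE w in M. calm (1 / Suc n) m i w)"

lemma AE_calm_mesh: "AE w in M. calm (1 / Suc n) (mesh n) i w"
proof -
  have "\<forall>i. AE w in M. calm (1 / Suc n) (mesh n) i w"
    unfolding mesh_def by (rule someI_ex, rule AE_calm) simp
  then show ?thesis by blast
qed

definition good :: "'w \<Rightarrow> bool" where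
  "good w \<longleftrightarrow> (\<forall>n i. calm (1 / Suc n) (mesh n) i w)"

lemma pred_good[measurable]: "Measurable.pred M good"
  unfolding good_def[abs_def] by measurable

lemma AE_good: "AE w in M. good w"
  unfolding good_def AE_all_countable by (intro allI AE_calm_mesh)

lemma good_regulated:
  assumes "good w"
  shows "regulated (\<lambda>t. X t w)"
  unfolding regulated_def
proof (intro conjI allI impI)
  fix t e :: real assume t: "0 \<le> t" and e: "0 < e"
  obtain n where n: "1 / Suc n < e" using nat_approx_posE[OF e] by blast
  define m where "m = mesh n"
  define i where "i = nat \<lfloor>t * 2 ^ m\<rfloor>"
  have "real i = of_int \<lfloor>t * 2 ^ m\<rfloor>" using t by (simp add: i_def)
  then have "real i \<le> t * 2 ^ m" "t * 2 ^ m < real (Suc i)" by linarith+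
  then have i: "real i / 2 ^ m \<le> t" "t < real (Suc i) / 2 ^ m"
    by (simp_all add: divide_le_eq less_divide_eq)
  obtain p where p: "\<not> oscillates (dyadic_times \<inter> {real i / 2 ^ m..real (Suc i) / 2 ^ m}) (1 / Suc n) (\<lambda>t. X t w) p (real i / 2 ^ m)"
    using assms unfolding good_def calm_def m_def by blast
  show "\<exists>\<delta>>0. \<forall>s\<in>dyadic_times \<inter> {t<..<t + \<delta>}. \<forall>s'\<in>dyadic_times \<inter> {t<..<t + \<delta>}. norm (X s w - X s' w) \<le> e"
  proof -
    obtain \<delta> where "\<delta> > 0" and \<delta>: "\<And>s s'. s \<in> dyadic_times \<inter> {t<..<t + \<delta>} \<Longrightarrow> s' \<in> dyadic_times \<inter> {t<..<t + \<delta>} \<Longrightarrow>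
        norm (X s w - X s' w) \<le> 1 / Suc n"
      using right_oscillation_bounded[OF p i] by auto
    have "norm (X s w - X s' w) \<le> e" if "s \<in> dyadic_times \<inter> {t<..<t + \<delta>}" "s' \<in> dyadic_times \<inter> {t<..<t + \<delta>}" for s s'
      using \<delta>[OF that] n by linarith
    with \<open>\<delta> > 0\<close> show ?thesis by blast
  qed
next
  fix t e :: real assume t: "0 < t" and e: "0 < e"
  obtain n where n: "1 / Suc n < e" using nat_approx_posE[OF e] by blast
  define m where "m = mesh n"
  define i where "i = nat (\<lceil>t * 2 ^ m\<rceil> - 1)"
  have "0 < t * 2 ^ m" using t by simp
  then have "1 \<le> \<lceil>t * 2 ^ m\<rceil>" by linarith
  then have "real i = of_int \<lceil>t * 2 ^ m\<rceil> - 1" by (simp add: i_def)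
  then have "real i < t * 2 ^ m" "t * 2 ^ m \<le> real (Suc i)" by linarith+
  then have i: "real i / 2 ^ m < t" "t \<le> real (Suc i) / 2 ^ m"
    by (simp_all add: divide_less_eq le_divide_eq)
  obtain p where p: "\<not> oscillates (dyadic_times \<inter> {real i / 2 ^ m..real (Suc i) / 2 ^ m}) (1 / Suc n) (\<lambda>t. X t w) p (real i / 2 ^ m)"
    using assms unfolding good_def calm_def m_def by blast
  show "\<exists>\<delta>>0. \<forall>s\<in>dyadic_times \<inter> {t - \<delta><..<t}. \<forall>s'\<in>dyadic_times \<inter> {t - \<delta><..<t}. norm (X s w - X s' w) \<le> e"
  proof -
    obtain \<delta> where "\<delta> > 0" and \<delta>: "\<And>s s'. s \<in> dyadic_times \<inter> {t - \<delta><..<t} \<Longrightarrow> s' \<in> dyadic_times \<inter> {t - \<delta><..<t} \<Longrightarrow>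
        norm (X s w - X s' w) \<le> 1 / Suc n"
      using left_oscillation_bounded[OF p i] by auto
    have "norm (X s w - X s' w) \<le> e" if "s \<in> dyadic_times \<inter> {t - \<delta><..<t}" "s' \<in> dyadic_times \<inter> {t - \<delta><..<t}" for s s'
      using \<delta>[OF that] n by linarith
    with \<open>\<delta> > 0\<close> show ?thesis by blast
  qed
qed

text \<open>Right limits along the dyadic times. On the exceptional null set the path is 0, and the value at time 0 is subtracted, so that every path is cadlag and
starts from 0, as the definition of a Levy process demands.\<close>

definition regularised :: "real \<Rightarrow> 'w \<Rightarrow> real^'d" where
  "regularised t w = (if good w then right_limit (\<lambda>t. X t w) t - right_limit (\<lambda>t. X t w) 0 else 0)"

lemma regularised_0: "regularised 0 w = 0"
  by (simp add: regularised_def)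

lemma X_above_measurable[measurable]: "X (dyadic_above n t) \<in> borel_measurable M"
  by (rule X_measurable[OF dyadic_above_times])

lemma regularised_increment_limit:
  assumes "good w" "0 \<le> s" "0 \<le> t"
  shows "(\<lambda>n. X (dyadic_above n t) w - X (dyadic_above n s) w) \<longlonglongrightarrow> regularised t w - regularised s w"
  using tendsto_diff[OF right_limit_sequentially[OF good_regulated[OF assms(1)] assms(3)]
      right_limit_sequentially[OF good_regulated[OF assms(1)] assms(2)]] assms(1)
  by (simp add: regularised_def)

lemma regularised_measurable[measurable]:
  assumes t: "0 \<le> t"
  shows "regularised t \<in> borel_measurable M"
proof (rule borel_measurable_LIMSEQ_metric)
  fix n show "(\<lambda>w. if good w then X (dyadic_above n t) w - X (dyadic_above n 0) w else 0) \<in> borel_measurable M"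
    by measurable
next
  fix w show "(\<lambda>n. if good w then X (dyadic_above n t) w - X (dyadic_above n 0) w else 0) \<longlonglongrightarrow> regularised t w"
    using regularised_increment_limit[of w 0 t] t by (auto simp: regularised_def)
qed

lemma regularised_increment_char:
  assumes s: "0 \<le> s" and st: "s \<le> t"
  shows "charf (distr M borel (\<lambda>w. regularised t w - regularised s w)) y = exp (of_real (t - s) * \<Phi> y)"
proof -
  have t: "0 \<le> t" using s st by simp
  note [measurable] = regularised_measurable[OF s] regularised_measurable[OF t]
  have "charf (distr M borel (\<lambda>w. regularised t w - regularised s w)) y = (CLINT w|M. iexp (y \<bullet> (regularised t w - regularised s w)))"
    by (rule charf_distr) measurable
  moreover have "(\<lambda>n. CLINT w|M. iexp (y \<bullet> (X (dyadic_above n t) w - X (dyadic_above n s) w))) \<longlonglongrightarrow>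
     (CLINT w|M. iexp (y \<bullet> (regularised t w - regularised s w)))"
  proof (rule integral_dominated_convergence[where w="\<lambda>_. 1"])
    show "AE w in M. (\<lambda>n. iexp (y \<bullet> (X (dyadic_above n t) w - X (dyadic_above n s) w))) \<longlonglongrightarrow> iexp (y \<bullet> (regularised t w - regularised s w))"
      using AE_good by eventually_elim (intro tendsto_intros regularised_increment_limit s t)
  qed auto
  moreover have "(\<lambda>n. exp (of_real (dyadic_above n t - dyadic_above n s) * \<Phi> y)) \<longlonglongrightarrow> exp (of_real (t - s) * \<Phi> y)"
    by (intro tendsto_intros dyadic_above_tendsto s t)
  ultimately show ?thesis
    by (simp add: X_increment_char[OF dyadic_above_times dyadic_above_times dyadic_above_mono[OF st]] LIMSEQ_unique)
qed

lemma X_above_indep: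
  assumes t: "\<And>i. i < n \<Longrightarrow> t i \<le> t (Suc i)"
  shows "indep_vars (\<lambda>_. borel) (\<lambda>i w. X (dyadic_above m (t (Suc i))) w - X (dyadic_above m (t i)) w) {..<n}"
proof -
  define b where "b i = nat \<lfloor>t i * 2 ^ m\<rfloor> + 1" for i
  have b: "b i \<le> b (Suc i)" if "i < n" for i
    unfolding b_def using t[OF that] by (intro add_right_mono nat_mono floor_mono mult_right_mono) auto
  have db: "dyadic_above m (t i) = real (b i) / 2 ^ m" for i by (simp add: dyadic_above_def b_def)
  have "indep_vars (\<lambda>_. borel) (\<lambda>i w. \<Sum>l\<in>{b i..<b (Suc i)}. X (real (Suc l) / 2 ^ m) w - X (real l / 2 ^ m) w) {..<n}"
    by (rule indep_vars_block_sums[where b=b and N="b n", OF X_indep]) (auto intro: b)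
  then show ?thesis
    by (rule indep_vars_cong[THEN iffD1, rotated -1]) (auto simp: fun_eq_iff X_telescope b db simp del: of_nat_Suc)
qed

lemma levy_process_regularised: "levy_process M regularised"
  unfolding levy_process_def
proof (intro conjI allI impI ballI)
  show "prob_space M" by (rule prob_space_axioms)
  show "regularised t \<in> borel_measurable M" if "0 \<le> t" for t using that by (rule regularised_measurable)
  show "regularised 0 w = 0" for w by (simp add: regularised_def)
  show "cadlag (\<lambda>t. regularised t w)" for w
  proof (cases "good w")
    case True
    then have "cadlag (right_limit (\<lambda>t. X t w))" by (intro cadlag_right_limit good_regulated)
    then have "cadlag (\<lambda>t. right_limit (\<lambda>t. X t w) t - right_limit (\<lambda>t. X t w) 0)"
      by (rule cadlag_diff_const)
    then show ?thesis using True by (simp add: regularised_def)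
  qed (auto simp: cadlag_def regularised_def)
  show "distr M borel (\<lambda>\<omega>. regularised (s + h) \<omega> - regularised s \<omega>) = distr M borel (regularised h)" if "0 \<le> s" "0 \<le> h" for s h
  proof (rule charf_uniqueness)
    have [measurable]: "regularised (s + h) \<in> borel_measurable M" "regularised s \<in> borel_measurable M" "regularised h \<in> borel_measurable M"
      using that by auto
    show "borel_probability (distr M borel (\<lambda>\<omega>. regularised (s + h) \<omega> - regularised s \<omega>))" "borel_probability (distr M borel (regularised h))"
      by (auto intro!: borel_probability_distr prob_space_axioms)
    have "charf (distr M borel (regularised h)) y = charf (distr M borel (\<lambda>w. regularised h w - regularised 0 w)) y" for y
      by (simp add: regularised_0)
    then show "charf (distr M borel (\<lambda>\<omega>. regularised (s + h) \<omega> - regularised s \<omega>)) y = charf (distr M borel (regularised h)) y" for y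
      using that by (simp add: regularised_increment_char)
  qed
  show "indep_vars (\<lambda>_. borel) (\<lambda>i \<omega>. regularised (t (Suc i)) \<omega> - regularised (t i) \<omega>) {..<n}"
    if t: "0 \<le> t 0 \<and> (\<forall>i<n. t i \<le> t (Suc i))" for n and t :: "nat \<Rightarrow> real"
  proof (rule indep_vars_AE_limit)
    have pos: "0 \<le> t i" if "i \<le> n" for i
      using that t by (induction i) (auto intro: order_trans)
    show "indep_vars (\<lambda>_. borel) (\<lambda>i w. X (dyadic_above m (t (Suc i))) w - X (dyadic_above m (t i)) w) {..<n}" for m
      by (rule X_above_indep) (use t in auto)
    show "(\<lambda>\<omega>. regularised (t (Suc i)) \<omega> - regularised (t i) \<omega>) \<in> borel_measurable M" if "i \<in> {..<n}" for i
      using that pos[of i] pos[of "Suc i"] by auto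
    show "AE w in M. (\<lambda>m. X (dyadic_above m (t (Suc i))) w - X (dyadic_above m (t i)) w) \<longlonglongrightarrow> regularised (t (Suc i)) w - regularised (t i) w"
      if "i \<in> {..<n}" for i
      using AE_good by eventually_elim (use that pos[of i] pos[of "Suc i"] in \<open>auto intro!: regularised_increment_limit\<close>)
  qed simp
qed

end

text \<open>The roots of order \<open>2\<^sup>k\<close> feed the dyadic construction; \<open>\<rho> (k + 1) \<star> \<rho> (k + 1) = \<rho> k\<close> because both sides have the exponent \<open>\<Phi> / 2\<^sup>k\<close>.\<close>

theorem levy_process_exists:
  fixes \<nu> :: "(real^'d) measure"
  assumes "has_id_exponent \<nu> \<Phi>"
  shows "\<exists>(M :: (real \<Rightarrow> real^'d) measure) Y. levy_process M Y \<and> distr M borel (Y 1) = \<nu>"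
proof -
  have "\<exists>\<rho>. has_exponent \<rho> (\<lambda>y. \<Phi> y / of_nat (2 ^ k))" for k :: nat
  proof -
    have "(2::nat) ^ k \<ge> 1" by simp
    then show ?thesis using assms unfolding has_id_exponent_def by blast
  qed
  then obtain \<rho> where \<rho>: "\<And>k::nat. has_exponent (\<rho> k) (\<lambda>y. \<Phi> y / of_nat (2 ^ k))" by metis
  interpret dyadic_roots \<rho>
  proof
    show b: "borel_probability (\<rho> k)" for k using \<rho>[of k] by (simp add: has_exponent_def)
    show "(\<rho> (Suc k) \<star> \<rho> (Suc k)) = \<rho> k" for k
    proof (rule charf_uniqueness)
      show "borel_probability (\<rho> (Suc k) \<star> \<rho> (Suc k))" "borel_probability (\<rho> k)" 
        by (auto intro: charf_convolution b)
      have "\<Phi> y / of_nat (2 ^ Suc k) + \<Phi> y / of_nat (2 ^ Suc k) = \<Phi> y / of_nat (2 ^ k)" for y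
        by (simp add: field_simps)
      then show "charf (\<rho> (Suc k) \<star> \<rho> (Suc k)) y = charf (\<rho> k) y" for y
        unfolding charf_convolution(2)[OF b b]
        using \<rho>[of k] \<rho>[of "Suc k"] unfolding has_exponent_def by (metis exp_add)
    qed
  qed
  obtain M :: "(real \<Rightarrow> real^'d) measure" and X where MX: "prob_space M" "\<And>t. t \<in> dyadic_times \<Longrightarrow> X t \<in> borel_measurable M"
     "\<And>k N. prob_space.indep_vars M (\<lambda>_. borel) (\<lambda>i \<omega>. X (real (Suc i) / 2 ^ k) \<omega> - X (real i / 2 ^ k) \<omega>) {..<N}"
     "\<And>k i. distr M borel (\<lambda>\<omega>. X (real (Suc i) / 2 ^ k) \<omega> - X (real i / 2 ^ k) \<omega>) = \<rho> k"
    using dyadic_process_exists by blast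
  have [measurable]: "X (real i / 2 ^ k) \<in> borel_measurable M" for i k
    using MX(2) grid_subset_dyadic_times[of k] by (auto simp: grid_def)
  interpret dyadic_levy M X \<Phi>
  proof (unfold dyadic_levy_def dyadic_levy_axioms_def, intro conjI allI impI)
    show "(CLINT w|M. iexp (y \<bullet> (X (real (Suc i) / 2 ^ k) w - X (real i / 2 ^ k) w))) = exp (\<Phi> y / 2 ^ k)" for k i y
    proof -
      have "(CLINT w|M. iexp (y \<bullet> (X (real (Suc i) / 2 ^ k) w - X (real i / 2 ^ k) w))) = charf (\<rho> k) y"
        unfolding MX(4)[symmetric, of k i] by (rule charf_distr[symmetric]) (intro borel_measurable_diff; measurable)
      then show ?thesis using \<rho>[of k] by (simp add: has_exponent_def)
    qed
  qed (use MX in auto)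
  have "distr M borel (regularised 1) = \<nu>"
  proof (rule charf_uniqueness)
    show "borel_probability (distr M borel (regularised 1))"
      by (rule borel_probability_distr[OF prob_space_axioms]) measurable
    show "borel_probability \<nu>" using assms by (simp add: has_id_exponent_def has_exponent_def)
    fix y
    have "distr M borel (regularised 1) = distr M borel (\<lambda>w. regularised 1 w - regularised 0 w)" by (simp add: regularised_0)
    then show "charf (distr M borel (regularised 1)) y = charf \<nu> y"
      using regularised_increment_char[of 0 1 y] assms by (simp add: has_id_exponent_def has_exponent_def)
  qed
  then show ?thesis using levy_process_regularised by blast
qed

section \<open>The law of a random integral\<close>

text \<open>The law at time 1 fixes the law at dyadic times through convolution roots, whose exponents are unique, and right-continuity of the paths extends
this to all times.\<close>

lemma charf_levy_increment:
  fixes Y :: "real \<Rightarrow> 'w \<Rightarrow> real^'d"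
  assumes Y: "levy_process M Y" and \<Phi>: "has_exponent (distr M borel (Y 1)) \<Phi>" and s: "0 \<le> s" and h: "0 \<le> h"
  shows "(CLINT w|M. iexp (y \<bullet> (Y (s + h) w - Y s w))) = exp (of_real h * \<Phi> y)"
proof -
  interpret prob_space M using Y by (simp add: levy_process_def)
  have m[measurable]: "Y t \<in> borel_measurable M" if "0 \<le> t" for t using Y that by (simp add: levy_process_def)
  have Y0: "w \<in> space M \<Longrightarrow> Y 0 w = 0" for w using Y by (simp add: levy_process_def)
  have stat: "distr M borel (\<lambda>\<omega>. Y (s + h) \<omega> - Y s \<omega>) = distr M borel (Y h)" if "0 \<le> s" "0 \<le> h" for s h
    using Y that by (simp add: levy_process_def)
  \<comment> \<open>\<open>Y (n u)\<close> is a sum of \<open>n\<close> independent copies of \<open>Y u\<close>.\<close>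
  have multiple: "charf (distr M borel (Y (real n * u))) y = charf (distr M borel (Y u)) y ^ n" if u: "0 \<le> u" for n u y
  proof -
    have ind: "indep_vars (\<lambda>_. borel) (\<lambda>i \<omega>. Y (real (Suc i) * u) \<omega> - Y (real i * u) \<omega>) {..<n}"
    proof -
      have "indep_vars (\<lambda>_. borel) (\<lambda>i \<omega>. Y (t (Suc i)) \<omega> - Y (t i) \<omega>) {..<n}"
        if "0 \<le> t 0" "\<And>i. i < n \<Longrightarrow> t i \<le> t (Suc i)" for n and t :: "nat \<Rightarrow> real"
        using Y that by (simp add: levy_process_def)
      note this[of "\<lambda>i. real i * u" n]
      then show ?thesis using u by (simp add: mult_right_mono)
    qed
    have "charf (distr M borel (Y (real n * u))) y = (CLINT w|M. iexp (y \<bullet> Y (real n * u) w))"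
      using u by (intro charf_distr m) simp
    also have "\<dots> = (CLINT w|M. iexp (\<Sum>i<n. y \<bullet> (Y (real (Suc i) * u) w - Y (real i * u) w)))"
    proof (intro Bochner_Integration.integral_cong refl)
      fix w assume "w \<in> space M"
      then have "(\<Sum>i<n. Y (real (Suc i) * u) w - Y (real i * u) w) = Y (real n * u) w"
        using sum_lessThan_telescope[of "\<lambda>i. Y (real i * u) w" n] by (simp add: Y0)
      then show "iexp (y \<bullet> Y (real n * u) w) = iexp (\<Sum>i<n. y \<bullet> (Y (real (Suc i) * u) w - Y (real i * u) w))"
        by (simp only: inner_sum_right[symmetric])
    qed
    also have "\<dots> = (\<Prod>i<n. CLINT w|M. iexp (y \<bullet> (Y (real (Suc i) * u) w - Y (real i * u) w)))"
      by (rule charf_sum_indep[OF _ ind]) simp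
    also have "\<dots> = (\<Prod>i<n. charf (distr M borel (Y u)) y)"
    proof (intro prod.cong refl)
      fix i
      have "(CLINT w|M. iexp (y \<bullet> (Y (real (Suc i) * u) w - Y (real i * u) w))) =
         charf (distr M borel (\<lambda>w. Y (real i * u + u) w - Y (real i * u) w)) y"
        using u by (subst charf_distr) (auto simp: algebra_simps)
      also have "\<dots> = charf (distr M borel (Y u)) y"
        using stat[of "real i * u" u] u by simp
      finally show "(CLINT w|M. iexp (y \<bullet> (Y (real (Suc i) * u) w - Y (real i * u) w))) = charf (distr M borel (Y u)) y" .
    qed
    finally show ?thesis by simp
  qed
  \<comment> \<open>The law of \<open>Y (2\<^sup>-\<^sup>n)\<close> is a convolution root of the law of \<open>Y 1\<close>, which pins down its exponent.\<close>
  have dyadic: "charf (distr M borel (Y (dyadic_above n t))) y = exp (of_real (dyadic_above n t) * \<Phi> y)" for n t y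
  proof -
    define j where "j = nat \<lfloor>t * 2 ^ n\<rfloor> + 1"
    have j: "dyadic_above n t = real j * (1 / 2 ^ n)" by (simp add: dyadic_above_def j_def)
    have "has_exponent (distr M borel (Y (1 / 2 ^ n))) (\<lambda>y. \<Phi> y / of_nat (2 ^ n))"
    proof (rule has_exponent_root)
      show "borel_probability (distr M borel (Y (1 / 2 ^ n)))"
        by (rule borel_probability_distr[OF prob_space_axioms]) simp
      show "charf (distr M borel (Y (1 / 2 ^ n))) y ^ (2 ^ n) = exp (\<Phi> y)" for y
        using multiple[of "1 / 2 ^ n" "2 ^ n" y] \<Phi> by (simp add: has_exponent_def)
    qed (use \<Phi> in \<open>auto simp: has_exponent_def\<close>)
    then have "charf (distr M borel (Y (dyadic_above n t))) y = exp (\<Phi> y / 2 ^ n) ^ j"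
      unfolding j by (subst multiple) (auto simp: has_exponent_def)
    also have "\<dots> = exp (of_nat j * (\<Phi> y / 2 ^ n))" by (rule exp_of_nat_mult[symmetric])
    finally show ?thesis by (simp add: j)
  qed
  have lim: "(\<lambda>n. Y (dyadic_above n h) w) \<longlonglongrightarrow> Y h w" if w: "w \<in> space M" for w
  proof -
    have "((\<lambda>t. Y t w) \<longlongrightarrow> Y h w) (at_right h)" using Y w h by (auto simp: levy_process_def cadlag_def)
    moreover have "filterlim (\<lambda>n. dyadic_above n h) (at_right h) sequentially"
      by (rule filterlim_mono[OF filterlim_dyadic_above[OF h] _ order_refl]) (auto intro: at_le)
    ultimately show ?thesis by (rule filterlim_compose)
  qed
  have "charf (distr M borel (Y h)) y = exp (of_real h * \<Phi> y)"
  proof (rule LIMSEQ_unique)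
    have pos: "0 \<le> dyadic_above n h" for n using dyadic_above_bounds(1)[OF h, of n] h by simp
    have "(\<lambda>n. CLINT w|M. iexp (y \<bullet> Y (dyadic_above n h) w)) \<longlonglongrightarrow> (CLINT w|M. iexp (y \<bullet> Y h w))"
    proof (rule integral_dominated_convergence[where w="\<lambda>_. 1"])
      show "AE w in M. (\<lambda>n. iexp (y \<bullet> Y (dyadic_above n h) w)) \<longlonglongrightarrow> iexp (y \<bullet> Y h w)"
        by (intro AE_I2 tendsto_intros lim)
    qed (use pos h in auto)
    then show "(\<lambda>n. charf (distr M borel (Y (dyadic_above n h))) y) \<longlonglongrightarrow> charf (distr M borel (Y h)) y"
      using pos h by (simp add: charf_distr)
    show "(\<lambda>n. charf (distr M borel (Y (dyadic_above n h))) y) \<longlonglongrightarrow> exp (of_real h * \<Phi> y)"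
      unfolding dyadic by (intro tendsto_intros dyadic_above_tendsto h)
  qed
  moreover have "(CLINT w|M. iexp (y \<bullet> (Y (s + h) w - Y s w))) = charf (distr M borel (\<lambda>w. Y (s + h) w - Y s w)) y"
    using s h by (subst charf_distr) auto
  ultimately show ?thesis using stat[OF s h] by simp
qed

text \<open>Every point has a neighbourhood on which \<open>f\<close> is bounded, and the interval is compact.\<close>

lemma cadlag_bounded:
  assumes "cadlag f"
  shows "\<exists>B. \<forall>t\<in>{0..1}. norm (f t) \<le> B"
proof (rule ccontr)
  assume "\<not> ?thesis"
  then have "\<forall>n::nat. \<exists>t. t \<in> {0..1} \<and> real n < norm (f t)" by (meson not_le)
  from choice[OF this] obtain t where t: "\<And>n. t n \<in> {0..1}" "\<And>n. real n < norm (f (t n))" by blast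
  obtain l r where l: "l \<in> {0..1}" "strict_mono r" "(t \<circ> r) \<longlonglongrightarrow> l"
    using seq_compactE[of "{0..1::real}" t] t(1) by (auto simp: compact_imp_seq_compact)
  have near: "\<exists>B. eventually (\<lambda>s. norm (f s) \<le> B) F" if "(f \<longlongrightarrow> L) F" for L F
  proof
    have "eventually (\<lambda>s. dist (f s) L < 1) F" using that by (rule tendstoD) simp
    then show "eventually (\<lambda>s. norm (f s) \<le> norm L + 1) F"
    proof eventually_elim
      case (elim s)
      then show ?case using norm_triangle_ineq2[of "f s" L] by (simp add: dist_norm)
    qed
  qed
  have "(f \<longlongrightarrow> f l) (at_right l)" using assms l by (simp add: cadlag_def)
  then obtain B1 where "eventually (\<lambda>s. norm (f s) \<le> B1) (at_right l)" using near by blast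
  then obtain b where b: "b > l" "\<And>s. l < s \<Longrightarrow> s < b \<Longrightarrow> norm (f s) \<le> B1" by (auto simp: eventually_at_right_field)
  \<comment> \<open>At \<open>l = 0\<close> there is no left limit, but no time of \<open>[0,1]\<close> lies to the left either.\<close>
  obtain a B2 where a: "a < l" "\<And>s. a < s \<Longrightarrow> s < l \<Longrightarrow> 0 \<le> s \<Longrightarrow> norm (f s) \<le> B2"
  proof (cases "l = 0")
    case True
    then show ?thesis using that[of "-1" 0] by auto
  next
    case False
    then have "0 < l" using l by auto
    then obtain L where "(f \<longlongrightarrow> L) (at_left l)" using assms by (auto simp: cadlag_def)
    then obtain B2 where "eventually (\<lambda>s. norm (f s) \<le> B2) (at_left l)" using near by blast
    then obtain a where "a < l" "\<And>s. a < s \<Longrightarrow> s < l \<Longrightarrow> norm (f s) \<le> B2" by (auto simp: eventually_at_left_field)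
    then show ?thesis using that by blast
  qed
  define B where "B = max B1 (max B2 (norm (f l)))"
  have bd: "norm (f s) \<le> B" if "a < s" "s < b" "0 \<le> s" for s
    using a(2)[of s] b(2)[of s] that by (cases s l rule: linorder_cases) (auto simp: B_def)
  have "eventually (\<lambda>n. (t \<circ> r) n < b) sequentially" "eventually (\<lambda>n. a < (t \<circ> r) n) sequentially"
    using order_tendstoD[OF l(3)] a(1) b(1) by auto
  then have "eventually (\<lambda>n. real (r n) < B) sequentially"
  proof eventually_elim
    case (elim n)
    then have "norm (f (t (r n))) \<le> B" using t(1)[of "r n"] by (intro bd) auto
    then show ?case using t(2)[of "r n"] by simp
  qed
  moreover obtain N :: nat where "B \<le> N" using real_arch_simple by blast
  then have "eventually (\<lambda>n. B \<le> real (r n)) sequentially"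
    using seq_suble[OF l(2)] by (intro eventually_sequentiallyI[of N]) (meson of_nat_le_iff order_trans)
  ultimately have "eventually (\<lambda>n::nat. False) sequentially" by eventually_elim simp
  then show False by simp
qed

text \<open>Riemann-Stieltjes sums with right end points, for an integrand that is merely right-continuous and bounded.\<close>

lemma step_integral_tendsto:
  fixes f :: "real \<Rightarrow> 'b::{banach, second_countable_topology}"
  assumes s[measurable_cong]: "sets \<mu> = sets borel" and fin: "emeasure \<mu> {0<..1} < \<infinity>"
    and rc: "\<And>t. 0 \<le> t \<Longrightarrow> (f \<longlongrightarrow> f t) (at_right t)" and bd: "\<And>t. t \<in> {0..1} \<Longrightarrow> norm (f t) \<le> B"
  shows "(\<lambda>n. \<Sum>i<Suc n. measure \<mu> {real i / Suc n<..real (Suc i) / Suc n} *\<^sub>R f (real (Suc i) / Suc n))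
     \<longlonglongrightarrow> (LINT t:{0<..1}|\<mu>. f t)"
proof -
  \<comment> \<open>The step function \<open>g n\<close> evaluates \<open>f\<close> at the right end of the cell of \<open>t\<close>, so that right-continuity applies.\<close>
  define g where "g n t = (\<Sum>i<Suc n. indicator {real i / Suc n<..real (Suc i) / Suc n} t *\<^sub>R f (real (Suc i) / Suc n))" for n t
  have B: "0 \<le> B" using bd[of 0] norm_ge_zero[of "f 0"] by (meson order_trans atLeastAtMost_iff order_refl zero_le_one)
  have sub: "{real i / Suc n<..real (Suc i) / Suc n} \<subseteq> {0<..1}" if "i < Suc n" for i n
  proof -
    have "0 \<le> real i / Suc n" "real (Suc i) / Suc n \<le> 1" using that by (auto simp: divide_le_eq)
    then show ?thesis by (intro subsetI) (simp only: greaterThanAtMost_iff, linarith)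
  qed
  have g_eq: "\<exists>u. t \<le> u \<and> u \<le> t + 1 / Suc n \<and> u \<le> 1 \<and> g n t = f u" if t: "0 < t" "t \<le> 1" for n t
  proof -
    define k where "k = nat (\<lceil>t * Suc n\<rceil> - 1)"
    have "0 < t * Suc n" using t by simp
    then have c: "1 \<le> \<lceil>t * Suc n\<rceil>" by linarith
    have "t * real (Suc n) \<le> 1 * real (Suc n)" using t by (intro mult_right_mono) auto
    then have c2: "\<lceil>t * Suc n\<rceil> \<le> int (Suc n)" by (simp add: ceiling_le_iff)
    have k: "real k = of_int \<lceil>t * Suc n\<rceil> - 1" "k < Suc n" using c c2 by (auto simp: k_def)
    then have k1: "real k < t * Suc n" "t * Suc n \<le> real (Suc k)" by linarith+
    then have k2: "real k / Suc n < t" "t \<le> real (Suc k) / Suc n" by (simp_all add: divide_less_eq le_divide_eq del: of_nat_Suc)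
    have uniq: "i = k" if "real i / Suc n < t" "t \<le> real (Suc i) / Suc n" for i
    proof -
      have "real i < t * Suc n" "t * Suc n \<le> real (Suc i)" using that by (simp_all add: divide_less_eq le_divide_eq del: of_nat_Suc)
      then show ?thesis using k1 by linarith
    qed
    have "g n t = (\<Sum>i<Suc n. if i = k then f (real (Suc k) / Suc n) else 0)"
      unfolding g_def
    proof (intro sum.cong refl)
      fix i
      show "indicator {real i / Suc n<..real (Suc i) / Suc n} t *\<^sub>R f (real (Suc i) / Suc n) =
        (if i = k then f (real (Suc k) / Suc n) else 0)"
      proof (cases "i = k")
        case True
        then show ?thesis using k2 by (simp del: of_nat_Suc)
      next
        case False
        then have "t \<notin> {real i / Suc n<..real (Suc i) / Suc n}"
          using uniq[of i] by (metis greaterThanAtMost_iff)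
        then show ?thesis using False by (simp del: of_nat_Suc)
      qed
    qed
    also have "\<dots> = f (real (Suc k) / Suc n)" using k(2) by simp
    finally have "g n t = f (real (Suc k) / Suc n)" .
    moreover have "real (Suc k) / Suc n \<le> t + 1 / Suc n" using k2(1) by (simp add: add_divide_distrib)
    moreover have "real (Suc k) / Suc n \<le> 1" using k(2) by (simp add: divide_le_eq)
    ultimately show ?thesis using k2(2) by blast
  qed
  have g0: "g n t = 0" if "t \<notin> {0<..1}" for n t
    unfolding g_def by (intro sum.neutral) (use sub that in \<open>fastforce simp: indicator_def simp del: of_nat_Suc\<close>)
  have gm[measurable]: "g n \<in> borel_measurable borel" for n unfolding g_def[abs_def] by measurable
  have lim: "(\<lambda>n. g n t) \<longlonglongrightarrow> indicator {0<..1} t *\<^sub>R f t" for t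
  proof (cases "t \<in> {0<..1}")
    case True
    show ?thesis
    proof (rule LIMSEQ_I)
      fix e :: real assume e: "0 < e"
      have "eventually (\<lambda>s. dist (f s) (f t) < e) (at_right t)" using True e by (intro tendstoD[OF rc]) auto
      then obtain b where b: "b > t" "\<And>s. t < s \<Longrightarrow> s < b \<Longrightarrow> dist (f s) (f t) < e" by (auto simp: eventually_at_right_field)
      obtain N where N: "1 / Suc N < b - t" using nat_approx_posE[of "b - t"] b(1) by auto
      have "norm (g n t - indicator {0<..1} t *\<^sub>R f t) < e" if n: "n \<ge> N" for n
      proof -
        obtain u where u: "t \<le> u" "u \<le> t + 1 / Suc n" "g n t = f u" using g_eq[of t n] True by auto
        have "1 / real (Suc n) \<le> 1 / Suc N" using n by (intro divide_left_mono) auto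
        then have "u < b" using u N by linarith
        then show ?thesis using b(2)[of u] u e True by (cases "u = t") (auto simp: dist_norm)
      qed
      then show "\<exists>no. \<forall>n\<ge>no. norm (g n t - indicator {0<..1} t *\<^sub>R f t) < e" by blast
    qed
  qed (simp add: g0)
  have fm: "(\<lambda>t. indicator {0<..1} t *\<^sub>R f t) \<in> borel_measurable borel"
    by (rule borel_measurable_LIMSEQ_metric[OF gm lim])
  have "(\<lambda>n. LINT t|\<mu>. g n t) \<longlonglongrightarrow> (LINT t|\<mu>. indicator {0<..1} t *\<^sub>R f t)"
  proof (rule integral_dominated_convergence[where w="\<lambda>t. B * indicator {0<..1} t"])
    show "integrable \<mu> (\<lambda>t. B * indicator {0<..1} t)"
      using fin by (intro integrable_mult_right integrable_real_indicator) auto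
    show "AE t in \<mu>. norm (g n t) \<le> B * indicator {0<..1} t" for n
    proof (rule AE_I2)
      fix t show "norm (g n t) \<le> B * indicator {0<..1} t"
      proof (cases "t \<in> {0<..1}")
        case True
        then obtain u where "t \<le> u" "u \<le> 1" "g n t = f u" using g_eq[of t n] by auto
        then show ?thesis using True bd[of u] by auto
      qed (simp add: g0)
    qed
  qed (use fm lim in \<open>auto simp: measurable_cong_sets[OF s refl]\<close>)
  moreover have "(LINT t|\<mu>. g n t) = (\<Sum>i<Suc n. measure \<mu> {real i / Suc n<..real (Suc i) / Suc n} *\<^sub>R f (real (Suc i) / Suc n))" for n
  proof -
    have fi: "emeasure \<mu> {real i / Suc n<..real (Suc i) / Suc n} < \<infinity>" if "i < Suc n" for i
      using emeasure_mono[OF sub[OF that], of \<mu>] fin by (auto intro: le_less_trans)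
    have "(LINT t|\<mu>. g n t) = (\<Sum>i<Suc n. LINT t|\<mu>. indicator {real i / Suc n<..real (Suc i) / Suc n} t *\<^sub>R f (real (Suc i) / Suc n))"
      unfolding g_def using fi by (intro Bochner_Integration.integral_sum integrable_scaleR_left integrable_real_indicator) (auto simp del: of_nat_Suc)
    also have "\<dots> = (\<Sum>i<Suc n. measure \<mu> {real i / Suc n<..real (Suc i) / Suc n} *\<^sub>R f (real (Suc i) / Suc n))"
    proof (intro sum.cong refl)
      fix i assume i: "i \<in> {..<Suc n}"
      have sp: "space \<mu> = UNIV" using sets_eq_imp_space_eq[OF s] by simp
      have "integrable \<mu> (indicator {real i / Suc n<..real (Suc i) / Suc n} :: real \<Rightarrow> real)"
        using fi i by (intro integrable_real_indicator) (auto simp del: of_nat_Suc)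
      then show "(LINT t|\<mu>. indicator {real i / Suc n<..real (Suc i) / Suc n} t *\<^sub>R f (real (Suc i) / Suc n)) =
        measure \<mu> {real i / Suc n<..real (Suc i) / Suc n} *\<^sub>R f (real (Suc i) / Suc n)"
        by (subst integral_scaleR_left) (simp_all add: sp del: of_nat_Suc)
    qed
    finally show ?thesis .
  qed
  ultimately show ?thesis by (simp add: set_lebesgue_integral_def)
qed

lemma sum_by_parts_scaleR:
  fixes a :: "nat \<Rightarrow> real" and b :: "nat \<Rightarrow> 'b::real_vector"
  shows "a n *\<^sub>R b n - a 0 *\<^sub>R b 0 - (\<Sum>i<n. (a (Suc i) - a i) *\<^sub>R b (Suc i)) = (\<Sum>i<n. a i *\<^sub>R (b (Suc i) - b i))"
  by (induction n) (auto simp: algebra_simps)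

text \<open>The integral that defines \<open>random_integral\<close> is a limit of Riemann sums, and summation by parts undoes the formal integration by parts: what remains
are sums of increments of \<open>Y\<close> with deterministic coefficients. This yields both measurability and the law.\<close>

lemma random_integral_tendsto:
  fixes Y :: "real \<Rightarrow> 'w \<Rightarrow> real^'d"
  assumes Y: "levy_process M Y" and w: "w \<in> space M"
    and hc: "continuous_on {0..1} h" and hm: "\<And>s t. 0 \<le> s \<Longrightarrow> s \<le> t \<Longrightarrow> t \<le> 1 \<Longrightarrow> h s \<le> h t"
  shows "(\<lambda>n. \<Sum>i<Suc n. h (real i / Suc n) *\<^sub>R (Y (real (Suc i) / Suc n) w - Y (real i / Suc n) w))
    \<longlonglongrightarrow> random_integral 0 1 h Y (\<lambda>t. t) w"
proof -
  define F where "F s = h (max 0 (min 1 s))" for s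
  have Fm: "F s \<le> F t" if "s \<le> t" for s t unfolding F_def using that by (intro hm) auto
  have Fc: "continuous_on UNIV F"
    unfolding F_def by (rule continuous_on_compose2[OF hc]) (auto intro!: continuous_intros)
  have Fr: "continuous (at_right a) F" for a
    using Fc by (auto simp: continuous_on_eq_continuous_at intro: continuous_at_imp_continuous_within)
  have cad: "cadlag (\<lambda>t. Y t w)" using Y w by (simp add: levy_process_def)
  obtain B where B: "\<And>t. t \<in> {0..1} \<Longrightarrow> norm (Y t w) \<le> B" using cadlag_bounded[OF cad] by blast
  have lim: "(\<lambda>n. \<Sum>i<Suc n. measure (interval_measure F) {real i / Suc n<..real (Suc i) / Suc n} *\<^sub>R Y (real (Suc i) / Suc n) w)
     \<longlonglongrightarrow> (LINT t:{0<..1}|interval_measure F. Y t w)"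
  proof (rule step_integral_tendsto)
    show "emeasure (interval_measure F) {0<..1} < \<infinity>"
      by (subst emeasure_interval_measure_Ioc) (auto intro: Fm Fr)
    show "((\<lambda>t. Y t w) \<longlongrightarrow> Y t w) (at_right t)" if "0 \<le> t" for t using cad that by (simp add: cadlag_def)
  qed (use B in auto)
  have term_eq: "measure (interval_measure F) {real i / Suc n<..real (Suc i) / Suc n} = h (real (Suc i) / Suc n) - h (real i / Suc n)"
    if i: "i < Suc n" for i n
  proof -
    have "real i / Suc n \<le> real (Suc i) / Suc n" by (intro divide_right_mono) auto
    then have "measure (interval_measure F) {real i / Suc n<..real (Suc i) / Suc n} = F (real (Suc i) / Suc n) - F (real i / Suc n)"
      by (rule measure_interval_measure_Ioc) (auto intro: Fm Fr)
    moreover have "F (real k / Suc n) = h (real k / Suc n)" if "k \<le> Suc n" for k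
    proof -
      have "0 \<le> real k / Suc n" "real k / Suc n \<le> 1" using that by (auto simp: divide_le_eq)
      then show ?thesis by (simp add: F_def)
    qed
    from this[of i] this[of "Suc i"] have "F (real i / Suc n) = h (real i / Suc n)" "F (real (Suc i) / Suc n) = h (real (Suc i) / Suc n)"
      using i by auto
    ultimately show ?thesis by simp
  qed
  have "(\<lambda>n. h 1 *\<^sub>R Y 1 w - h 0 *\<^sub>R Y 0 w - (\<Sum>i<Suc n. measure (interval_measure F) {real i / Suc n<..real (Suc i) / Suc n} *\<^sub>R Y (real (Suc i) / Suc n) w))
     \<longlonglongrightarrow> random_integral 0 1 h Y (\<lambda>t. t) w"
    unfolding random_integral_def F_def[symmetric] by (intro tendsto_diff tendsto_const lim)
  moreover have "h 1 *\<^sub>R Y 1 w - h 0 *\<^sub>R Y 0 w - (\<Sum>i<Suc n. measure (interval_measure F) {real i / Suc n<..real (Suc i) / Suc n} *\<^sub>R Y (real (Suc i) / Suc n) w)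
     = (\<Sum>i<Suc n. h (real i / Suc n) *\<^sub>R (Y (real (Suc i) / Suc n) w - Y (real i / Suc n) w))" for n
  proof -
    have "(\<Sum>i<Suc n. measure (interval_measure F) {real i / Suc n<..real (Suc i) / Suc n} *\<^sub>R Y (real (Suc i) / Suc n) w) =
      (\<Sum>i<Suc n. (h (real (Suc i) / Suc n) - h (real i / Suc n)) *\<^sub>R Y (real (Suc i) / Suc n) w)"
      by (intro sum.cong refl) (simp only: term_eq lessThan_iff)
    then show ?thesis
      using sum_by_parts_scaleR[of "\<lambda>i. h (real i / Suc n)" "Suc n" "\<lambda>i. Y (real i / Suc n) w"]
      by (simp del: sum.lessThan_Suc of_nat_Suc)
  qed
  ultimately show ?thesis by (simp only:)
qed

text \<open>The effect of \<open>Jmap \<beta>\<close> on exponents.\<close>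

definition J_exponent :: "real \<Rightarrow> (real^'d \<Rightarrow> complex) \<Rightarrow> real^'d \<Rightarrow> complex" where
  "J_exponent \<beta> \<Phi> y = integral {0..1} (\<lambda>t. \<Phi> (t powr (1 / \<beta>) *\<^sub>R y))"

lemma continuous_powr_path:
  fixes \<Phi> :: "real^'d \<Rightarrow> complex"
  assumes "continuous_on UNIV \<Phi>" "0 < \<beta>"
  shows "continuous_on {0..} (\<lambda>t::real. \<Phi> (t powr (1 / \<beta>) *\<^sub>R y))"
proof -
  have "continuous_on {0..} (\<lambda>t::real. t powr (1 / \<beta>))"
    by (rule continuous_on_powr') (use assms(2) in \<open>auto intro: continuous_intros\<close>)
  then show ?thesis
    by (intro continuous_on_compose2[OF assms(1)] continuous_on_scaleR continuous_on_const) auto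
qed

lemma continuous_J_exponent:
  fixes \<Phi> :: "real^'d \<Rightarrow> complex"
  assumes "continuous_on UNIV \<Phi>" "0 < \<beta>"
  shows "continuous_on UNIV (J_exponent \<beta> \<Phi>)"
proof -
  have "continuous_on (UNIV \<times> {0..1}) (\<lambda>z. \<Phi> (snd z powr (1 / \<beta>) *\<^sub>R fst z))"
    by (rule continuous_on_compose2[OF assms(1)])
       (use assms(2) in \<open>auto intro!: continuous_intros continuous_on_powr'\<close>)
  then have "continuous_on UNIV (\<lambda>y. integral (cbox 0 1) (\<lambda>t. \<Phi> (t powr (1 / \<beta>) *\<^sub>R y)))"
    by (intro integral_continuous_on_param) (simp add: case_prod_beta)
  then show ?thesis by (simp add: J_exponent_def[abs_def])
qed

lemma J_exponent_integrable:
  fixes \<Phi> :: "real^'d \<Rightarrow> complex"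
  assumes "continuous_on UNIV \<Phi>" "0 < \<beta>"
  shows "(\<lambda>t. \<Phi> (t powr (1 / \<beta>) *\<^sub>R y)) integrable_on {0..1}"
  by (rule integrable_continuous_real, rule continuous_on_subset[OF continuous_powr_path[OF assms]]) auto

lemma left_Riemann_sum_tendsto:
  fixes \<phi> :: "real \<Rightarrow> complex"
  assumes c: "continuous_on {0..} \<phi>"
  shows "(\<lambda>n. \<Sum>i<Suc n. (1 / Suc n) *\<^sub>R \<phi> (real i / Suc n)) \<longlonglongrightarrow> integral {0..1} \<phi>"
proof -
  have c1: "continuous_on {0..1} \<phi>" by (rule continuous_on_subset[OF c]) auto
  have "bounded (\<phi> ` {0..1})" by (rule compact_imp_bounded[OF compact_continuous_image[OF c1 compact_Icc]])
  then obtain B where "\<forall>x\<in>\<phi> ` {0..1}. norm x \<le> B" unfolding bounded_iff by blast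
  then have B: "\<And>t. t \<in> {0..1} \<Longrightarrow> norm (\<phi> t) \<le> B" by blast
  have R: "(\<lambda>n. \<Sum>i<Suc n. measure lborel {real i / Suc n<..real (Suc i) / Suc n} *\<^sub>R \<phi> (real (Suc i) / Suc n))
     \<longlonglongrightarrow> (LINT t:{0<..1}|lborel. \<phi> t)"
  proof (rule step_integral_tendsto)
    fix t :: real assume t: "0 \<le> t"
    then have "(\<phi> \<longlongrightarrow> \<phi> t) (at t within {0..})" using c by (auto simp: continuous_on_def)
    then show "(\<phi> \<longlongrightarrow> \<phi> t) (at_right t)" by (rule tendsto_mono[rotated]) (use t in \<open>auto intro!: at_le\<close>)
  qed (use B in auto)
  have len: "measure lborel {real i / Suc n<..real (Suc i) / Suc n} = 1 / Suc n" for i n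
  proof -
    have "real i / Suc n \<le> real (Suc i) / Suc n" by (intro divide_right_mono) auto
    then show ?thesis by (simp add: diff_divide_distrib[symmetric] del: of_nat_Suc)
  qed
  have "set_integrable lborel {0..1} \<phi>" using c1 by (intro borel_integrable_compact[unfolded set_integrable_def[symmetric]]) auto
  then have "set_integrable lborel {0<..1} \<phi>" by (rule set_integrable_subset) auto
  then have "(LINT t:{0<..1}|lborel. \<phi> t) = integral {0<..1} \<phi>" by (rule set_borel_integral_eq_integral)
  also have "\<dots> = integral {0..1} \<phi>" by (rule integral_subset_negligible) (auto intro: negligible_subset[of "{0}"])
  finally have I: "(LINT t:{0<..1}|lborel. \<phi> t) = integral {0..1} \<phi>" .
  \<comment> \<open>Passing from right to left end points changes the sum by \<open>(\<phi> 1 - \<phi> 0) / (n + 1)\<close>.\<close>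
  have shift: "(\<Sum>i<Suc n. (1 / Suc n) *\<^sub>R \<phi> (real i / Suc n)) = (\<Sum>i<Suc n. (1 / Suc n) *\<^sub>R \<phi> (real (Suc i) / Suc n)) - (1 / Suc n) *\<^sub>R (\<phi> 1 - \<phi> 0)" for n
  proof -
    have "(\<Sum>i<Suc n. \<phi> (real (Suc i) / Suc n) - \<phi> (real i / Suc n)) = \<phi> 1 - \<phi> 0"
      using sum_lessThan_telescope[of "\<lambda>i. \<phi> (real i / Suc n)" "Suc n"] by (simp del: sum.lessThan_Suc of_nat_Suc)
    then have *: "(\<Sum>i<Suc n. \<phi> (real i / Suc n)) = (\<Sum>i<Suc n. \<phi> (real (Suc i) / Suc n)) - (\<phi> 1 - \<phi> 0)"
      by (simp add: sum_subtractf algebra_simps del: sum.lessThan_Suc of_nat_Suc)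
    show ?thesis unfolding scaleR_sum_right[symmetric] * scaleR_diff_right ..
  qed
  have "(\<lambda>n. (1 / Suc n) *\<^sub>R (\<phi> 1 - \<phi> 0)) \<longlonglongrightarrow> 0 *\<^sub>R (\<phi> 1 - \<phi> 0)"
    by (intro tendsto_intros LIMSEQ_inverse_real_of_nat[unfolded inverse_eq_divide])
  from tendsto_diff[OF R[unfolded len I] this] show ?thesis unfolding shift by simp
qed

text \<open>The characteristic function of a Riemann sum is \<open>exp\<close> of a Riemann sum for \<open>J_exponent\<close>, by independence of the increments.\<close>

lemma random_integral_has_exponent:
  fixes Y :: "real \<Rightarrow> 'w \<Rightarrow> real^'d"
  assumes Y: "levy_process M Y" and \<Phi>: "has_exponent (distr M borel (Y 1)) \<Phi>" and \<beta>: "0 < \<beta>"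
  shows "has_exponent (distr M borel (random_integral 0 1 (\<lambda>t. t powr (1 / \<beta>)) Y (\<lambda>t. t))) (J_exponent \<beta> \<Phi>)"
proof -
  interpret prob_space M using Y by (simp add: levy_process_def)
  have m: "Y t \<in> borel_measurable M" if "0 \<le> t" for t using Y that by (simp add: levy_process_def)
  have [measurable]: "Y (real i / Suc n) \<in> borel_measurable M" for i n by (rule m) simp
  define h where "h t = t powr (1 / \<beta>)" for t :: real
  have c\<Phi>: "continuous_on UNIV \<Phi>" "\<Phi> 0 = 0" using \<Phi> by (auto simp: has_exponent_def)
  define S where "S n w = (\<Sum>i<Suc n. h (real i / Suc n) *\<^sub>R (Y (real (Suc i) / Suc n) w - Y (real i / Suc n) w))" for n w
  define I where "I = random_integral 0 1 h Y (\<lambda>t. t)"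
  have Sm[measurable]: "S n \<in> borel_measurable M" for n unfolding S_def[abs_def] by measurable
  have SI: "(\<lambda>n. S n w) \<longlonglongrightarrow> I w" if "w \<in> space M" for w
    unfolding S_def I_def
  proof (rule random_integral_tendsto[OF Y that])
    show "continuous_on {0..1} h" unfolding h_def using \<beta> by (auto intro!: continuous_intros continuous_on_powr')
    show "h s \<le> h t" if "0 \<le> s" "s \<le> t" "t \<le> 1" for s t unfolding h_def using that \<beta> by (intro powr_mono2) auto
  qed
  have Im[measurable]: "I \<in> borel_measurable M" by (rule borel_measurable_LIMSEQ_metric[OF Sm SI])
  have S_char: "(CLINT w|M. iexp (y \<bullet> S n w)) = exp (\<Sum>i<Suc n. (1 / Suc n) *\<^sub>R \<Phi> (h (real i / Suc n) *\<^sub>R y))" for n y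
  proof -
    have "indep_vars (\<lambda>_. borel) (\<lambda>i \<omega>. Y (t (Suc i)) \<omega> - Y (t i) \<omega>) {..<n}"
      if "0 \<le> t 0" "\<And>i. i < n \<Longrightarrow> t i \<le> t (Suc i)" for n and t :: "nat \<Rightarrow> real"
      using Y that by (simp add: levy_process_def)
    note this[of "\<lambda>i. real i / Suc n" "Suc n"]
    then have ind: "indep_vars (\<lambda>_. borel) (\<lambda>i \<omega>. Y (real (Suc i) / Suc n) \<omega> - Y (real i / Suc n) \<omega>) {..<Suc n}"
      by (simp add: divide_right_mono)
    have "(CLINT w|M. iexp (y \<bullet> S n w)) =
      (CLINT w|M. iexp (\<Sum>i<Suc n. (h (real i / Suc n) *\<^sub>R y) \<bullet> (Y (real (Suc i) / Suc n) w - Y (real i / Suc n) w)))"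
      unfolding S_def by (simp only: inner_sum_right inner_scaleR_right inner_scaleR_left)
    also have "\<dots> = (\<Prod>i<Suc n. CLINT w|M. iexp ((h (real i / Suc n) *\<^sub>R y) \<bullet> (Y (real (Suc i) / Suc n) w - Y (real i / Suc n) w)))"
      by (rule charf_sum_indep[OF _ ind]) simp
    also have "\<dots> = (\<Prod>i<Suc n. exp ((1 / Suc n) *\<^sub>R \<Phi> (h (real i / Suc n) *\<^sub>R y)))"
    proof (intro prod.cong refl)
      fix i
      have "real (Suc i) / Suc n = real i / Suc n + 1 / Suc n" by (simp add: add_divide_distrib)
      then show "(CLINT w|M. iexp ((h (real i / Suc n) *\<^sub>R y) \<bullet> (Y (real (Suc i) / Suc n) w - Y (real i / Suc n) w))) =
        exp ((1 / Suc n) *\<^sub>R \<Phi> (h (real i / Suc n) *\<^sub>R y))"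
        using charf_levy_increment[OF Y \<Phi>, of "real i / Suc n" "1 / Suc n" "h (real i / Suc n) *\<^sub>R y"]
        by (simp add: scaleR_conv_of_real)
    qed
    finally show ?thesis by (simp only: exp_sum[OF finite_lessThan])
  qed
  have "charf (distr M borel I) y = exp (J_exponent \<beta> \<Phi> y)" for y
  proof (rule LIMSEQ_unique)
    have "(\<lambda>n. CLINT w|M. iexp (y \<bullet> S n w)) \<longlonglongrightarrow> (CLINT w|M. iexp (y \<bullet> I w))"
    proof (rule integral_dominated_convergence[where w="\<lambda>_. 1"])
      show "AE w in M. (\<lambda>n. iexp (y \<bullet> S n w)) \<longlonglongrightarrow> iexp (y \<bullet> I w)"
        by (intro AE_I2 tendsto_intros SI)
    qed auto
    then show "(\<lambda>n. CLINT w|M. iexp (y \<bullet> S n w)) \<longlonglongrightarrow> charf (distr M borel I) y" by (simp add: charf_distr)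
    show "(\<lambda>n. CLINT w|M. iexp (y \<bullet> S n w)) \<longlonglongrightarrow> exp (J_exponent \<beta> \<Phi> y)"
      unfolding S_char J_exponent_def h_def
      by (intro tendsto_exp left_Riemann_sum_tendsto[OF continuous_powr_path[OF c\<Phi>(1) \<beta>]])
  qed
  moreover have "borel_probability (distr M borel I)" by (rule borel_probability_distr[OF prob_space_axioms Im])
  moreover have "J_exponent \<beta> \<Phi> 0 = 0" by (simp add: J_exponent_def c\<Phi>)
  ultimately show ?thesis
    using continuous_J_exponent[OF c\<Phi>(1) \<beta>] by (simp add: has_exponent_def I_def h_def[abs_def])
qed

text \<open>The exponent determines the law of the random integral, so all processes give the same law, and \<open>levy_process_exists\<close> provides one.\<close>

lemma Jmap_has_exponent:
  fixes \<nu> :: "(real^'d) measure"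
  assumes \<nu>: "has_id_exponent \<nu> \<Phi>" and \<beta>: "0 < \<beta>"
  shows "has_exponent (Jmap \<beta> \<nu>) (J_exponent \<beta> \<Phi>)"
proof -
  have e: "has_exponent \<nu> \<Phi>" using \<nu> by (simp add: has_id_exponent_def)
  let ?I = "\<lambda>Y. random_integral 0 1 (\<lambda>t. t powr (1 / \<beta>)) Y (\<lambda>t. t)"
  obtain M :: "(real \<Rightarrow> real^'d) measure" and Y where MY: "levy_process M Y" "distr M borel (Y 1) = \<nu>"
    using levy_process_exists[OF \<nu>] by blast
  have ex: "has_exponent (distr M borel (?I Y)) (J_exponent \<beta> \<Phi>)"
    by (rule random_integral_has_exponent[OF MY(1) _ \<beta>]) (simp add: MY(2) e)
  have "Jmap \<beta> \<nu> = distr M borel (?I Y)"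
    unfolding Jmap_def
  proof (rule the_equality)
    show "\<exists>(M' :: (real \<Rightarrow> real^'d) measure) Y'. levy_process M' Y' \<and> distr M' borel (Y' 1) = \<nu> \<and> distr M borel (?I Y) = distr M' borel (?I Y')"
      using MY by blast
    fix \<mu> assume "\<exists>(M' :: (real \<Rightarrow> real^'d) measure) Y'. levy_process M' Y' \<and> distr M' borel (Y' 1) = \<nu> \<and> \<mu> = distr M' borel (?I Y')"
    then obtain M' :: "(real \<Rightarrow> real^'d) measure" and Y' where M': "levy_process M' Y'" "distr M' borel (Y' 1) = \<nu>" "\<mu> = distr M' borel (?I Y')" by blast
    have "has_exponent \<mu> (J_exponent \<beta> \<Phi>)"
      unfolding M'(3) by (rule random_integral_has_exponent[OF M'(1) _ \<beta>]) (simp add: M'(2) e)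
    then show "\<mu> = distr M borel (?I Y)" using ex by (rule has_exponent_measure_eq)
  qed
  with ex show ?thesis by simp
qed

text \<open>The image of an \<open>n\<close>-th root is an \<open>n\<close>-th root of the image, because \<open>J_exponent\<close> is linear. This makes \<open>Jmap\<close> applicable again.\<close>

lemma Jmap_has_id_exponent:
  fixes \<nu> :: "(real^'d) measure"
  assumes \<nu>: "has_id_exponent \<nu> \<Phi>" and \<beta>: "0 < \<beta>"
  shows "has_id_exponent (Jmap \<beta> \<nu>) (J_exponent \<beta> \<Phi>)"
proof -
  have "\<exists>\<rho>. has_exponent \<rho> (\<lambda>y. J_exponent \<beta> \<Phi> y / of_nat n)" if n: "n \<ge> 1" for n
  proof -
    obtain \<rho> where \<rho>: "has_exponent \<rho> (\<lambda>y. \<Phi> y / of_nat n)" using \<nu> n unfolding has_id_exponent_def by blast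
    have "has_exponent (Jmap \<beta> \<rho>) (J_exponent \<beta> (\<lambda>y. \<Phi> y / of_nat n))"
      by (rule Jmap_has_exponent[OF has_id_exponent_root[OF \<nu> \<rho> n] \<beta>])
    then show ?thesis by (auto simp: J_exponent_def[abs_def])
  qed
  then show ?thesis using Jmap_has_exponent[OF assms] by (simp add: has_id_exponent_def)
qed

section \<open>Composition of the maps on exponents\<close>

text \<open>Along the ray through \<open>y\<close>, the substitution \<open>s = r\<^sup>\<beta> t\<close> turns \<open>r\<^sup>\<beta>\<close> times \<open>J_exponent \<beta> \<Phi> (r y)\<close> into an integral with variable upper
limit \<open>r\<^sup>\<beta>\<close>, which can be differentiated in \<open>r\<close>.\<close>

definition ray_primitive :: "real \<Rightarrow> (real^'d \<Rightarrow> complex) \<Rightarrow> real^'d \<Rightarrow> real \<Rightarrow> complex" where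
  "ray_primitive \<beta> \<Phi> y x = integral {0..x} (\<lambda>s. \<Phi> (s powr (1 / \<beta>) *\<^sub>R y))"

lemma ray_primitive_eq:
  fixes \<Phi> :: "real^'d \<Rightarrow> complex"
  assumes c: "continuous_on UNIV \<Phi>" and \<beta>: "0 < \<beta>" and r: "0 < r"
  shows "ray_primitive \<beta> \<Phi> y (r powr \<beta>) = r powr \<beta> *\<^sub>R J_exponent \<beta> \<Phi> (r *\<^sub>R y)"
proof -
  define m where "m = r powr \<beta>"
  have m: "0 < m" using r by (simp add: m_def)
  have mr: "m powr (1 / \<beta>) = r" using r \<beta> by (simp add: m_def powr_powr)
  let ?f = "\<lambda>s. \<Phi> (s powr (1 / \<beta>) *\<^sub>R y)"
  have "continuous_on {0..m} ?f" by (rule continuous_on_subset[OF continuous_powr_path[OF c \<beta>]]) auto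
  then have "?f integrable_on {0..m}" by (rule integrable_continuous_real)
  then have "(?f has_integral ray_primitive \<beta> \<Phi> y m) (cbox 0 m)"
    unfolding ray_primitive_def by (simp add: has_integral_integral)
  from has_integral_affinity'[OF this m, of 0]
  have "((\<lambda>t. ?f (m * t)) has_integral (ray_primitive \<beta> \<Phi> y m /\<^sub>R m)) {0..1}"
    using m by simp
  moreover have "?f (m * t) = \<Phi> (t powr (1 / \<beta>) *\<^sub>R (r *\<^sub>R y))" if "t \<in> {0..1}" for t
    using that m by (simp add: powr_mult mr mult.commute)
  ultimately have "((\<lambda>t. \<Phi> (t powr (1 / \<beta>) *\<^sub>R (r *\<^sub>R y))) has_integral (ray_primitive \<beta> \<Phi> y m /\<^sub>R m)) {0..1}"
    by (rule has_integral_eq[rotated]) 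
  then have "J_exponent \<beta> \<Phi> (r *\<^sub>R y) = ray_primitive \<beta> \<Phi> y m /\<^sub>R m"
    unfolding J_exponent_def by (rule integral_unique)
  then show ?thesis using m by (simp add: m_def)
qed

lemma ray_primitive_derivative:
  fixes \<Phi> :: "real^'d \<Rightarrow> complex"
  assumes c: "continuous_on UNIV \<Phi>" and \<beta>: "0 < \<beta>" and r: "0 < r"
  shows "((\<lambda>r. r powr \<beta> *\<^sub>R J_exponent \<beta> \<Phi> (r *\<^sub>R y)) has_vector_derivative (\<beta> * r powr (\<beta> - 1)) *\<^sub>R \<Phi> (r *\<^sub>R y)) (at r)"
proof -
  define x where "x = r powr \<beta>"
  have x: "0 < x" using r by (simp add: x_def)
  let ?f = "\<lambda>s. \<Phi> (s powr (1 / \<beta>) *\<^sub>R y)"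
  have "continuous_on {0..x + 1} ?f" by (rule continuous_on_subset[OF continuous_powr_path[OF c \<beta>]]) auto
  then have "(ray_primitive \<beta> \<Phi> y has_vector_derivative ?f x) (at x within {0..x + 1})"
    unfolding ray_primitive_def using x by (intro integral_has_vector_derivative) auto
  then have "(ray_primitive \<beta> \<Phi> y has_vector_derivative ?f x) (at x)"
    using x by (subst (asm) at_within_Icc_at) auto
  moreover have "((\<lambda>r. r powr \<beta>) has_vector_derivative \<beta> * r powr (\<beta> - 1)) (at r)"
    using r by (auto intro!: derivative_eq_intros simp flip: has_real_derivative_iff_has_vector_derivative)
  ultimately have "((ray_primitive \<beta> \<Phi> y \<circ> (\<lambda>r. r powr \<beta>)) has_vector_derivative (\<beta> * r powr (\<beta> - 1)) *\<^sub>R ?f x) (at r)"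
    unfolding x_def by (rule vector_diff_chain_at[rotated])
  moreover have "?f x = \<Phi> (r *\<^sub>R y)" using r \<beta> by (simp add: x_def powr_powr)
  ultimately have "((\<lambda>r. ray_primitive \<beta> \<Phi> y (r powr \<beta>)) has_vector_derivative (\<beta> * r powr (\<beta> - 1)) *\<^sub>R \<Phi> (r *\<^sub>R y)) (at r)"
    by (simp add: comp_def)
  then show ?thesis
    by (rule has_vector_derivative_transform_within_open[where S="{0<..}"])
       (use r ray_primitive_eq[OF c \<beta>] in auto)
qed

text \<open>The case of two parameters. Along the ray through \<open>y\<close>, multiply the difference of both sides by \<open>r\<^sup>b\<close>: the result vanishes at
\<open>r = 0\<close>, and its derivative on \<open>(0,1)\<close> is 0 because \<open>p (b - a) = b\<close> and \<open>p a + q b = 0\<close> for the two coefficients \<open>p\<close> and \<open>q\<close>.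
So it vanishes at \<open>r = 1\<close>.\<close>

lemma J_exponent_comp:
  fixes \<Phi> :: "real^'d \<Rightarrow> complex"
  assumes c: "continuous_on UNIV \<Phi>" and a: "0 < a" and b: "0 < b" and ab: "a \<noteq> b"
  shows "J_exponent b (J_exponent a \<Phi>) y = of_real (b / (b - a)) * J_exponent a \<Phi> y + of_real (a / (a - b)) * J_exponent b \<Phi> y"
proof -
  note ca = continuous_J_exponent[OF c a] and cb = continuous_J_exponent[OF c b]
  note cba = continuous_J_exponent[OF ca b]
  define p where "p = b / (b - a)"
  define q where "q = a / (a - b)"
  \<comment> \<open>\<open>Q\<close> is the difference of both sides along the ray through \<open>y\<close>; the claim is \<open>Q 1 = 0\<close>.\<close>
  define Q where "Q r = J_exponent b (J_exponent a \<Phi>) (r *\<^sub>R y) - p *\<^sub>R J_exponent a \<Phi> (r *\<^sub>R y) - q *\<^sub>R J_exponent b \<Phi> (r *\<^sub>R y)" for r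
  have cont: "continuous_on {0..1} (\<lambda>r. r powr b *\<^sub>R Q r)"
  proof -
    have "continuous_on {0..1} (\<lambda>r::real. r powr b)"
      by (rule continuous_on_powr') (use b in \<open>auto intro: continuous_intros\<close>)
    moreover have "continuous_on {0..1} Q"
      unfolding Q_def
      by (intro continuous_intros continuous_on_compose2[OF ca] continuous_on_compose2[OF cb] continuous_on_compose2[OF cba]) auto
    ultimately show ?thesis by (rule continuous_on_scaleR)
  qed
  have deriv: "((\<lambda>r. r powr b *\<^sub>R Q r) has_vector_derivative 0) (at r)" if r: "0 < r" for r
  proof -
    \<comment> \<open>\<open>r\<^sup>b Q(r) = H(r) - p r\<^sup>b\<^sup>-\<^sup>a A(r) - q B(r)\<close>, where \<open>A\<close>, \<open>B\<close>, \<open>H\<close> have the derivatives computed for a ray.\<close>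
    let ?A = "\<lambda>r. r powr a *\<^sub>R J_exponent a \<Phi> (r *\<^sub>R y)"
    let ?B = "\<lambda>r. r powr b *\<^sub>R J_exponent b \<Phi> (r *\<^sub>R y)"
    let ?H = "\<lambda>r. r powr b *\<^sub>R J_exponent b (J_exponent a \<Phi>) (r *\<^sub>R y)"
    let ?g = "J_exponent a \<Phi> (r *\<^sub>R y)" and ?\<phi> = "\<Phi> (r *\<^sub>R y)"
    have dA: "(?A has_vector_derivative (a * r powr (a - 1)) *\<^sub>R ?\<phi>) (at r)"
      by (rule ray_primitive_derivative[OF c a r])
    have dB: "(?B has_vector_derivative (b * r powr (b - 1)) *\<^sub>R ?\<phi>) (at r)"
      by (rule ray_primitive_derivative[OF c b r])
    have dH: "(?H has_vector_derivative (b * r powr (b - 1)) *\<^sub>R ?g) (at r)"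
      by (rule ray_primitive_derivative[OF ca b r])
    have dP: "((\<lambda>r. r powr (b - a)) has_real_derivative (b - a) * r powr (b - a - 1)) (at r)"
      using r by (auto intro!: derivative_eq_intros)
    have dPA: "((\<lambda>r. r powr (b - a) *\<^sub>R ?A r) has_vector_derivative
       (r powr (b - a) *\<^sub>R ((a * r powr (a - 1)) *\<^sub>R ?\<phi>) + ((b - a) * r powr (b - a - 1)) *\<^sub>R ?A r)) (at r)"
      by (rule has_vector_derivative_scaleR[OF dP dA])
    have "((\<lambda>r. ?H r - p *\<^sub>R (r powr (b - a) *\<^sub>R ?A r) - q *\<^sub>R ?B r) has_vector_derivative
       ((b * r powr (b - 1)) *\<^sub>R ?g - p *\<^sub>R (r powr (b - a) *\<^sub>R ((a * r powr (a - 1)) *\<^sub>R ?\<phi>) + ((b - a) * r powr (b - a - 1)) *\<^sub>R ?A r)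
         - q *\<^sub>R ((b * r powr (b - 1)) *\<^sub>R ?\<phi>))) (at r)"
      by (intro has_vector_derivative_diff dH bounded_linear.has_vector_derivative[OF bounded_linear_scaleR_right] dPA dB)
    moreover have "(b * r powr (b - 1)) *\<^sub>R ?g - p *\<^sub>R (r powr (b - a) *\<^sub>R ((a * r powr (a - 1)) *\<^sub>R ?\<phi>) + ((b - a) * r powr (b - a - 1)) *\<^sub>R ?A r)
         - q *\<^sub>R ((b * r powr (b - 1)) *\<^sub>R ?\<phi>) = 0"
    proof -
      have e1: "r powr (b - a) * (a * r powr (a - 1)) = a * r powr (b - 1)"
      proof -
        have "r powr (b - a) * r powr (a - 1) = r powr (b - 1)" by (simp add: powr_add[symmetric])
        then show ?thesis by simp
      qed
      have e2: "(b - a) * r powr (b - a - 1) * r powr a = (b - a) * r powr (b - 1)"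
      proof -
        have "r powr (b - a - 1) * r powr a = r powr (b - 1)" by (simp add: powr_add[symmetric])
        then show ?thesis by simp
      qed
      have pq: "p * (b - a) = b" "p * a + q * b = 0" using ab by (auto simp: p_def q_def field_simps)
      have "(b * r powr (b - 1)) *\<^sub>R ?g - p *\<^sub>R (r powr (b - a) *\<^sub>R ((a * r powr (a - 1)) *\<^sub>R ?\<phi>) + ((b - a) * r powr (b - a - 1)) *\<^sub>R ?A r)
         - q *\<^sub>R ((b * r powr (b - 1)) *\<^sub>R ?\<phi>) =
         (b * r powr (b - 1)) *\<^sub>R ?g - p *\<^sub>R ((a * r powr (b - 1)) *\<^sub>R ?\<phi> + ((b - a) * r powr (b - 1)) *\<^sub>R ?g)
         - q *\<^sub>R ((b * r powr (b - 1)) *\<^sub>R ?\<phi>)"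
        by (simp only: scaleR_scaleR e1 e2)
      also have "\<dots> = (r powr (b - 1)) *\<^sub>R ((b - p * (b - a)) *\<^sub>R ?g) - (r powr (b - 1)) *\<^sub>R ((p * a + q * b) *\<^sub>R ?\<phi>)"
        by (simp add: algebra_simps)
      finally show ?thesis by (simp only: pq) simp
    qed
    ultimately have "((\<lambda>r. ?H r - p *\<^sub>R (r powr (b - a) *\<^sub>R ?A r) - q *\<^sub>R ?B r) has_vector_derivative 0) (at r)"
      by simp
    then show ?thesis
    proof (rule has_vector_derivative_transform_within_open[where S="{0<..}"])
      fix s :: real assume "s \<in> {0<..}"
      then have "s powr (b - a) * s powr a = s powr b" by (simp add: powr_add[symmetric])
      then have *: "s powr (b - a) *\<^sub>R ?A s = s powr b *\<^sub>R J_exponent a \<Phi> (s *\<^sub>R y)"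
        by (simp only: scaleR_scaleR)
      show "?H s - p *\<^sub>R (s powr (b - a) *\<^sub>R ?A s) - q *\<^sub>R ?B s = s powr b *\<^sub>R Q s"
        unfolding * Q_def by (simp add: scaleR_diff_right mult.commute)
    qed (use r in auto)
  qed
  have "1 powr b *\<^sub>R Q 1 = (0 powr b *\<^sub>R Q 0)"
  proof (rule has_derivative_zero_unique_strong_interval[where k="{0, 1}" and a=0 and b=1 and x=1 and f="\<lambda>r. r powr b *\<^sub>R Q r"])
    fix r :: real assume "r \<in> {0..1} - {0, 1}"
    then have "((\<lambda>r. r powr b *\<^sub>R Q r) has_vector_derivative 0) (at r)" by (intro deriv) auto
    then show "((\<lambda>r. r powr b *\<^sub>R Q r) has_derivative (\<lambda>h. 0)) (at r within {0..1})"
      by (auto simp: has_vector_derivative_def intro: has_derivative_at_withinI)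
  qed (use cont in auto)
  then have "Q 1 = 0" by simp
  then show ?thesis by (simp add: Q_def p_def q_def scaleR_conv_of_real algebra_simps)
qed

lemma J_exponent_sum:
  fixes \<Psi> :: "'i \<Rightarrow> real^'d \<Rightarrow> complex"
  assumes "finite S" "\<And>j. j \<in> S \<Longrightarrow> continuous_on UNIV (\<Psi> j)" and b: "0 < b"
  shows "J_exponent b (\<lambda>y. \<Sum>j\<in>S. c j * \<Psi> j y) y = (\<Sum>j\<in>S. c j * J_exponent b (\<Psi> j) y)"
proof -
  have "integral {0..1} (\<lambda>t. \<Sum>j\<in>S. c j * \<Psi> j (t powr (1 / b) *\<^sub>R y)) = (\<Sum>j\<in>S. integral {0..1} (\<lambda>t. c j * \<Psi> j (t powr (1 / b) *\<^sub>R y)))"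
    using assms by (intro integral_sum integrable_on_mult_right J_exponent_integrable) auto
  then show ?thesis unfolding J_exponent_def by simp
qed

section \<open>Partial fractions and the iterated map\<close>

lemma Ccoeff_Suc:
  assumes "j \<in> {1..m}"
  shows "Ccoeff \<beta> j (Suc m) = Ccoeff \<beta> j m * (\<beta> (Suc m) / (\<beta> (Suc m) - \<beta> j))"
proof -
  have "{1..Suc m} - {j} = insert (Suc m) ({1..m} - {j})" using assms by auto
  then show ?thesis unfolding Ccoeff_def by simp
qed

lemma Ccoeff_last: "Ccoeff \<beta> (Suc m) (Suc m) = (\<Prod>k\<in>{1..m}. \<beta> k / (\<beta> k - \<beta> (Suc m)))"
proof -
  have "{1..Suc m} - {Suc m} = {1..m}" by auto
  then show ?thesis unfolding Ccoeff_def by simp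
qed

text \<open>Partial fraction decomposition in \<open>x\<close> of the product on the right. At \<open>x = \<beta> (m + 1)\<close> the product is the new coefficient with index \<open>m + 1\<close>,
which is how the identity is used.\<close>

lemma partial_fractions:
  assumes "inj_on \<beta> {1..m}" "m \<ge> 1" "x \<notin> \<beta> ` {1..m}"
  shows "(\<Sum>j=1..m. Ccoeff \<beta> j m * (\<beta> j / (\<beta> j - x))) = (\<Prod>k\<in>{1..m}. \<beta> k / (\<beta> k - x))"
  using assms(2,1,3)
proof (induction m arbitrary: x rule: dec_induct)
  case base
  then show ?case by (simp add: Ccoeff_def)
next
  case (step m)
  define b where "b = \<beta> (Suc m)"
  have inj: "inj_on \<beta> {1..m}" by (rule inj_on_subset[OF step.prems(1)]) auto
  have b: "b \<notin> \<beta> ` {1..m}" using step.prems(1) unfolding b_def inj_on_def by force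
  have x: "x \<notin> \<beta> ` {1..m}" "x \<noteq> b" using step.prems(2) by (auto simp: b_def)
  \<comment> \<open>The case of two poles; summing it over \<open>u = \<beta> j\<close> gives the induction step.\<close>
  have term_eq: "b / (b - u) * (u / (u - x)) + u / (u - b) * (b / (b - x)) = u / (u - x) * (b / (b - x))"
    if "u \<noteq> b" "u \<noteq> x" for u
  proof -
    have "b - u \<noteq> 0" "u - x \<noteq> 0" "b - x \<noteq> 0" using that x by auto
    moreover have "u / (u - b) = - (u / (b - u))" by (metis minus_diff_eq minus_divide_right)
    ultimately show ?thesis by (simp add: divide_simps) (simp add: algebra_simps)
  qed
  have "(\<Sum>j=1..Suc m. Ccoeff \<beta> j (Suc m) * (\<beta> j / (\<beta> j - x))) =
    (\<Sum>j=1..m. Ccoeff \<beta> j m * (b / (b - \<beta> j)) * (\<beta> j / (\<beta> j - x))) + (\<Prod>k\<in>{1..m}. \<beta> k / (\<beta> k - b)) * (b / (b - x))"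
    using step.hyps by (simp add: Ccoeff_last Ccoeff_Suc b_def)
  also have "(\<Prod>k\<in>{1..m}. \<beta> k / (\<beta> k - b)) = (\<Sum>j=1..m. Ccoeff \<beta> j m * (\<beta> j / (\<beta> j - b)))"
    by (rule step.IH[OF inj b, symmetric])
  also have "(\<Sum>j=1..m. Ccoeff \<beta> j m * (b / (b - \<beta> j)) * (\<beta> j / (\<beta> j - x))) + (\<Sum>j=1..m. Ccoeff \<beta> j m * (\<beta> j / (\<beta> j - b))) * (b / (b - x)) =
    (\<Sum>j=1..m. Ccoeff \<beta> j m * (b / (b - \<beta> j) * (\<beta> j / (\<beta> j - x)) + \<beta> j / (\<beta> j - b) * (b / (b - x))))"
    by (simp only: sum_distrib_right sum.distrib[symmetric] distrib_left mult.assoc)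
  also have "\<dots> = (\<Sum>j=1..m. Ccoeff \<beta> j m * (\<beta> j / (\<beta> j - x) * (b / (b - x))))"
  proof (intro sum.cong refl)
    fix j assume "j \<in> {1..m}"
    then have "\<beta> j \<noteq> b" "\<beta> j \<noteq> x" using b x by auto
    from term_eq[OF this] show "Ccoeff \<beta> j m * (b / (b - \<beta> j) * (\<beta> j / (\<beta> j - x)) + \<beta> j / (\<beta> j - b) * (b / (b - x))) =
      Ccoeff \<beta> j m * (\<beta> j / (\<beta> j - x) * (b / (b - x)))" by (rule arg_cong)
  qed
  also have "\<dots> = (\<Sum>j=1..m. Ccoeff \<beta> j m * (\<beta> j / (\<beta> j - x))) * (b / (b - x))"
    by (simp only: sum_distrib_right mult.assoc)
  also have "\<dots> = (\<Prod>k\<in>{1..m}. \<beta> k / (\<beta> k - x)) * (b / (b - x))"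
    by (simp only: step.IH[OF inj x(1)])
  also have "\<dots> = (\<Prod>k\<in>{1..Suc m}. \<beta> k / (\<beta> k - x))" by (simp add: b_def)
  finally show ?case .
qed

text \<open>Applying \<open>J_exponent b\<close> to the sum for \<open>m\<close> parameters splits each term in two. The first parts carry the coefficients for \<open>m + 1\<close> parameters; the second parts
are all multiples of \<open>J_exponent b \<Phi>\<close>, and their coefficients add up to the missing one by partial fractions.\<close>

lemma Jmap_iter_has_id_exponent:
  fixes \<nu> :: "(real^'d) measure"
  assumes m: "m \<ge> 1" and pos: "\<And>j. j \<in> {1..m} \<Longrightarrow> \<beta> j > 0" and inj: "inj_on \<beta> {1..m}"
    and \<nu>: "has_id_exponent \<nu> \<Phi>"
  shows "has_id_exponent (Jmap_iter \<beta> m \<nu>) (\<lambda>y. \<Sum>j=1..m. of_real (Ccoeff \<beta> j m) * J_exponent (\<beta> j) \<Phi> y)"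
  using m pos inj
proof (induction m rule: dec_induct)
  case base
  then show ?case using Jmap_has_id_exponent[OF \<nu>, of "\<beta> 1"] by (simp add: Ccoeff_def)
next
  case (step m)
  define b where "b = \<beta> (Suc m)"
  have c: "continuous_on UNIV \<Phi>" using \<nu> by (simp add: has_id_exponent_def has_exponent_def)
  have inj: "inj_on \<beta> {1..m}" by (rule inj_on_subset[OF step.prems(2)]) auto
  have b: "b \<notin> \<beta> ` {1..m}" using step.prems(2) unfolding b_def inj_on_def by force
  have pos: "0 < \<beta> j" if "j \<in> {1..m}" for j using step.prems(1) that by auto
  have b0: "0 < b" using step.prems(1) by (auto simp: b_def)
  have IH: "has_id_exponent (Jmap_iter \<beta> m \<nu>) (\<lambda>y. \<Sum>j=1..m. of_real (Ccoeff \<beta> j m) * J_exponent (\<beta> j) \<Phi> y)"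
    using step.IH pos inj by blast
  have "J_exponent b (\<lambda>y. \<Sum>j=1..m. of_real (Ccoeff \<beta> j m) * J_exponent (\<beta> j) \<Phi> y) y =
     (\<Sum>j=1..Suc m. of_real (Ccoeff \<beta> j (Suc m)) * J_exponent (\<beta> j) \<Phi> y)" for y
  proof -
    have "J_exponent b (\<lambda>y. \<Sum>j=1..m. of_real (Ccoeff \<beta> j m) * J_exponent (\<beta> j) \<Phi> y) y =
      (\<Sum>j=1..m. of_real (Ccoeff \<beta> j m) * J_exponent b (J_exponent (\<beta> j) \<Phi>) y)"
      by (rule J_exponent_sum) (use pos b0 c in \<open>auto intro: continuous_J_exponent\<close>)
    also have "\<dots> = (\<Sum>j=1..m. of_real (Ccoeff \<beta> j (Suc m)) * J_exponent (\<beta> j) \<Phi> y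
        + of_real (Ccoeff \<beta> j m * (\<beta> j / (\<beta> j - b))) * J_exponent b \<Phi> y)"
    proof (intro sum.cong refl)
      fix j assume j: "j \<in> {1..m}"
      then have "\<beta> j \<noteq> b" using b by auto
      then show "of_real (Ccoeff \<beta> j m) * J_exponent b (J_exponent (\<beta> j) \<Phi>) y =
        of_real (Ccoeff \<beta> j (Suc m)) * J_exponent (\<beta> j) \<Phi> y + of_real (Ccoeff \<beta> j m * (\<beta> j / (\<beta> j - b))) * J_exponent b \<Phi> y"
        using J_exponent_comp[OF c pos[OF j] b0, of y] Ccoeff_Suc[OF j, of \<beta>]
        by (simp add: b_def ring_distribs mult.assoc)
    qed
    also have "\<dots> = (\<Sum>j=1..m. of_real (Ccoeff \<beta> j (Suc m)) * J_exponent (\<beta> j) \<Phi> y)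
      + of_real (\<Sum>j=1..m. Ccoeff \<beta> j m * (\<beta> j / (\<beta> j - b))) * J_exponent b \<Phi> y"
      by (simp add: sum.distrib sum_distrib_right)
    also have "(\<Sum>j=1..m. Ccoeff \<beta> j m * (\<beta> j / (\<beta> j - b))) = Ccoeff \<beta> (Suc m) (Suc m)"
      using partial_fractions[OF inj step.hyps(1) b] by (simp add: Ccoeff_last b_def)
    finally show ?thesis using step.hyps by (simp add: b_def)
  qed
  then have "J_exponent b (\<lambda>y. \<Sum>j=1..m. of_real (Ccoeff \<beta> j m) * J_exponent (\<beta> j) \<Phi> y) =
     (\<lambda>y. \<Sum>j=1..Suc m. of_real (Ccoeff \<beta> j (Suc m)) * J_exponent (\<beta> j) \<Phi> y)" by (rule ext)
  with Jmap_has_id_exponent[OF IH b0] show ?case by (simp only: Jmap_iter.simps b_def)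
qed

theorem corollary1:
  fixes \<beta> :: "nat \<Rightarrow> real" and n :: nat and \<nu> :: "(real^'d) measure"
  assumes "n \<ge> 1"
    and "\<And>j. j \<in> {1..n} \<Longrightarrow> \<beta> j > 0"
    and "inj_on \<beta> {1..n}"
    and "infinitely_divisible \<nu>"
  shows "\<forall>y. charf (Jmap_iter \<beta> n \<nu>) y =
    (\<Prod>j=1..n. exp (complex_of_real (Ccoeff \<beta> j n) * levy_exponent (Jmap (\<beta> j) \<nu>) y))"
proof
  fix y
  obtain \<Phi> where \<Phi>: "has_id_exponent \<nu> \<Phi>"
    using infinitely_divisible_has_id_exponent[OF assms(4)] by blast
  have "levy_exponent (Jmap (\<beta> j) \<nu>) = J_exponent (\<beta> j) \<Phi>" if "j \<in> {1..n}" for j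
    by (rule has_exponent_levy_exponent[OF Jmap_has_exponent[OF \<Phi> assms(2)[OF that]]])
  moreover have "charf (Jmap_iter \<beta> n \<nu>) y = exp (\<Sum>j=1..n. of_real (Ccoeff \<beta> j n) * J_exponent (\<beta> j) \<Phi> y)"
    using Jmap_iter_has_id_exponent[OF assms(1-3) \<Phi>] by (simp add: has_id_exponent_def has_exponent_def)
  ultimately show "charf (Jmap_iter \<beta> n \<nu>) y =
    (\<Prod>j=1..n. exp (complex_of_real (Ccoeff \<beta> j n) * levy_exponent (Jmap (\<beta> j) \<nu>) y))"
    by (simp add: exp_sum)
qed

end
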